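(* (i) For the Euclidean unit balls $\mathbf{B}_2^2\subset\mathbb{R}^2$ and $\mathbf{B}_2^3\subset\mathbb{R}^3$ we have $$\mathrm{vein}(\mathbf{B}_2^2)=4\sqrt{2},\qquad \mathrm{vein}(\mathbf{B}_2^3)=6\sqrt{3}.$$ (ii) If $\mathbf{K}\subset\mathbb{R}^2$ and $\mathbf{L}\subset\mathbb{R}^3$ are arbitrary $0$-symmetric convex bodies, then $$4\le\mathrm{vein}(\mathbf{K})\le 6\le\mathrm{vein}(\mathbf{L})\le 18.$$
   Context: A convex body in $\mathbb{R}^d$ is a compact convex set with non-empty interior; it is $0$-symmetric if it is symmetric about the origin $0$. For a $0$-symmetric convex body $\mathbf{K}\subset\mathbb{R}^d$, $d\ge 2$, let $\|x\|_{\mathbf{K}}=\inf\{\lambda>0 : x\in\lambda\mathbf{K}\}$ be the norm with unit ball $\mathbf{K}$. The vertex index of $\mathbf{K}$ is $$\mathrm{vein}(\mathbf{K})=\inf\Big\{\sum_i\|p_i\|_{\mathbf{K}} : \mathbf{K}\subset\mathrm{conv}\{p_i\}\Big\},$$ where the infimum is over all finite families of points $p_1,\dots,p_n\in\mathbb{R}^d$ whose convex hull contains $\mathbf{K}$. *)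

theory Defs
  imports "HOL-Analysis.Analysis"
begin

definition convex_body :: "'a::euclidean_space set \<Rightarrow> bool" where
  "convex_body K \<longleftrightarrow> compact K \<and> convex K \<and> interior K \<noteq> {}"

definition symmetric_convex_body :: "'a::euclidean_space set \<Rightarrow> bool" where
  "symmetric_convex_body K \<longleftrightarrow> convex_body K \<and> uminus ` K = K"

definition body_norm :: "'a::euclidean_space set \<Rightarrow> 'a \<Rightarrow> real" where
  "body_norm K x = Inf {l. l > 0 \<and> x \<in> (\<lambda>y. l *\<^sub>R y) ` K}"

text \<open>Finite families of points are lists, so repetitions count in the sum. For a symmetric
  convex body the sets in both infima are non-empty and bounded below by 0, so the
  conditionally complete infimum on the reals is the true infimum.\<close>

definition vein :: "'a::euclidean_space set \<Rightarrow> real" where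
  "vein K = Inf {(\<Sum>p\<leftarrow>ps. body_norm K p) | ps. K \<subseteq> convex hull (set ps)}"

end

theory Submission
  imports Defs
begin

text \<open>Upper bounds come from explicit polytopes: for the ball the circumscribed cross-polytope, for
  a body in space the cross-polytope spanned by a dilated Auerbach basis, and in the plane a
  parallelogram circumscribed about the body, built from an inscribed affinely regular hexagon.

  For the lower bounds, John's theorem squeezes a linear image of the body between the unit ball
  and its dilation by \<open>\<surd>d\<close>, which reduces the general case to the ball at the cost of
  a factor \<open>\<surd>d\<close>. If the convex hull of the points contains the ball, the normal
  cones at the points cover space, and the normal cone at \<open>p\<close> lies in the circular cone of
  angular radius \<open>arccos (1 / norm p)\<close> about \<open>p\<close>. In the plane one compares angles and
  uses the convexity of the secant. In space, the normal cone at a vertex of degree \<open>k\<close> is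
  covered by at most \<open>k\<close> isosceles spherical triangles with their apices at a common axis.
  Bounding their areas by affine functions of \<open>norm p\<close> and \<open>k\<close> and summing over all vertices
  leaves the sum of the degrees to be estimated; for at most seven vertices Radon's theorem supplies
  enough pairs of vertices that are not joined by an edge, and from eight vertices on a bound that
  ignores the degrees suffices.\<close>

section \<open>Cross-polytopes and Auerbach bases\<close>

text \<open>The equality case dictates the shape of the spatial bound. A vertex at distance R with k
  neighbours gets an estimate \<open>y * R + v k\<close>, affine in both, so that summing involves
  only the sum of the norms and the sum of the degrees. For six points y = 2 is the slope at the
  regular octahedron (k = 4, R = sqrt 3), where the estimate is exact; the increment in k must
  absorb k = 3 and k = 5, and the degree sum must be at most 24, without slack. For 4, 5 and 6
  points the degree bounds 12, 18, 24 agree with Euler's 6 n - 12, but come from counting pairs: a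
  Radon partition of five points in convex position exhibits a segment that is not an edge. For six
  points this yields two such pairs directly; the third takes a separate argument. For seven points
  three pairs (36 instead of Euler's 30) leave enough room.

  In the plane the parallelogram has two sides on the support lines at \<open>e1\<close> and
  \<open>- e1\<close> and two parallel to a side of the hexagon; the corner bounds 2 - m and 1 + m
  have a sum free of m.\<close>

lemma body_norm_le:
  assumes "y \<in> K" "0 < l" "x = l *\<^sub>R y" shows "body_norm K x \<le> l"
  unfolding body_norm_def using assms by (intro cInf_lower bdd_belowI[of _ 0]) auto

lemma body_norm_ge:
  assumes "cball 0 r \<subseteq> K" "0 < r" "\<And>l y. 0 < l \<Longrightarrow> y \<in> K \<Longrightarrow> x = l *\<^sub>R y \<Longrightarrow> c \<le> l"
  shows "c \<le> body_norm K x"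
  unfolding body_norm_def
proof (rule cInf_greatest)
  \<comment> \<open>\<open>l\<close> brings \<open>x\<close> into the inscribed ball, so that the
    infimum is over a non-empty set; the summand 1 keeps \<open>l\<close> positive at x = 0.\<close>
  define l where "l = (norm x + 1) / r"
  have nx: "norm x + 1 > 0" by (simp add: add_nonneg_pos)
  then have l: "l > 0" using assms(2) by (simp add: l_def)
  have "norm ((1 / l) *\<^sub>R x) = norm x * r / (norm x + 1)" using assms(2) nx by (simp add: l_def)
  also have "\<dots> \<le> r" using assms(2) nx by (simp add: divide_le_eq algebra_simps)
  finally have "norm ((1 / l) *\<^sub>R x) \<le> r" .
  then have "(1 / l) *\<^sub>R x \<in> K" using assms(1) by auto
  then have "x \<in> (\<lambda>y. l *\<^sub>R y) ` K" using l by (intro image_eqI[of _ _ "(1 / l) *\<^sub>R x"]) auto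
  then show "{l. 0 < l \<and> x \<in> (\<lambda>y. l *\<^sub>R y) ` K} \<noteq> {}" using l by auto
qed (use assms(3) in auto)

lemma body_norm_nonneg:
  assumes "cball 0 r \<subseteq> K" "0 < r" shows "0 \<le> body_norm K x"
  using assms by (intro body_norm_ge[of r]) auto

lemma body_norm_cball: "body_norm (cball 0 1) x = norm x"
proof (rule antisym)
  show "norm x \<le> body_norm (cball 0 1) x"
    by (rule body_norm_ge[of 1]) (auto intro: mult_left_le)
  show "body_norm (cball 0 1) x \<le> norm x"
  proof (rule field_le_epsilon)
    fix e :: real assume "e > 0"
    then have "norm x + e > 0" by (simp add: add_nonneg_pos)
    then show "body_norm (cball 0 1) x \<le> norm x + e"
      using \<open>e > 0\<close> by (intro body_norm_le[of "(1 / (norm x + e)) *\<^sub>R x"]) (auto simp: divide_simps)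
  qed
qed

lemma vein_le:
  assumes "cball 0 r \<subseteq> K" "0 < r" "K \<subseteq> convex hull (set ps)"
  shows "vein K \<le> (\<Sum>p\<leftarrow>ps. body_norm K p)"
  unfolding vein_def using assms body_norm_nonneg[OF assms(1,2)]
  by (intro cInf_lower bdd_belowI[of _ 0]) (auto intro!: sum_list_nonneg)

lemma vein_ge:
  assumes "K \<subseteq> convex hull (set qs)" "\<And>ps. K \<subseteq> convex hull (set ps) \<Longrightarrow> c \<le> (\<Sum>p\<leftarrow>ps. body_norm K p)"
  shows "c \<le> vein K"
  unfolding vein_def using assms by (intro cInf_greatest) auto

lemma symmetric_convex_body_cball:
  assumes "symmetric_convex_body K"
  obtains r where "0 < r" "cball 0 r \<subseteq> K"
proof -
  have K: "convex K" "interior K \<noteq> {}" "uminus ` K = K"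
    using assms by (auto simp: symmetric_convex_body_def convex_body_def)
  then obtain x e where e: "0 < e" "cball x e \<subseteq> K" using mem_interior_cball[of _ K] by blast
  have "y \<in> K" if "norm y \<le> e" for y
  proof -
    have "x + y \<in> cball x e" "x - y \<in> cball x e" using that by (auto simp: dist_norm)
    then have xy: "x + y \<in> K" "x - y \<in> K" using e(2) by auto
    then have "- (x - y) \<in> uminus ` K" by (intro imageI)
    then have "- (x - y) \<in> K" unfolding K(3) .
    with xy(1) have "(1/2) *\<^sub>R (x + y) + (1/2) *\<^sub>R (- (x - y)) \<in> K" by (intro convexD[OF K(1)]) auto
    also have "(1/2) *\<^sub>R (x + y) + (1/2) *\<^sub>R (- (x - y)) = (1/2 + 1/2) *\<^sub>R y"
      unfolding scaleR_add_left by (simp add: algebra_simps)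
    finally show ?thesis by simp
  qed
  then have "cball 0 e \<subseteq> K" by auto
  then show thesis using that[of e] e(1) by simp
qed

text \<open>Negative coefficients are absorbed by passing from \<open>u i\<close> to
  \<open>- u i\<close>; the remaining weight 1 - A goes to 0, the midpoint of an opposite
  pair.\<close>

lemma abs_sum_le_one_hull:
  fixes u :: "'n::finite \<Rightarrow> 'a::real_vector"
  assumes "(\<Sum>i\<in>UNIV. \<bar>c i\<bar>) \<le> 1"
  shows "(\<Sum>i\<in>UNIV. c i *\<^sub>R u i) \<in> convex hull (range u \<union> range (\<lambda>i. - u i))"
proof -
  let ?H = "convex hull (range u \<union> range (\<lambda>i. - u i))"
  define A where "A = (\<Sum>i\<in>UNIV. \<bar>c i\<bar>)"
  define y where "y i = (if 0 \<le> c i then u i else - u i)" for i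
  have "u i \<in> ?H" "- u i \<in> ?H" for i by (auto intro: hull_inc)
  then have yH: "y i \<in> ?H" and mem: "u i \<in> ?H" "- u i \<in> ?H" for i by (auto simp: y_def)
  obtain i0 :: 'n where True by blast
  have "(1/2) *\<^sub>R u i0 + (1/2) *\<^sub>R (- u i0) \<in> ?H" using mem by (intro convexD[OF convex_convex_hull]) auto
  then have zero: "0 \<in> ?H" by simp
  have cy: "c i *\<^sub>R u i = \<bar>c i\<bar> *\<^sub>R y i" for i by (simp add: y_def)
  have A: "0 \<le> A" "A \<le> 1" using assms by (auto simp: A_def sum_nonneg)
  show ?thesis
  proof (cases "A = 0")
    case True
    then have "c i = 0" for i unfolding A_def by (subst (asm) sum_nonneg_eq_0_iff) auto
    then show ?thesis using zero by simp
  next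
    case False
    then have A0: "A > 0" using A by simp
    have "(\<Sum>i\<in>UNIV. (\<bar>c i\<bar> / A) *\<^sub>R y i) \<in> ?H"
      using A0 yH by (intro convex_sum) (auto simp: A_def sum_divide_distrib[symmetric])
    then have "A *\<^sub>R (\<Sum>i\<in>UNIV. (\<bar>c i\<bar> / A) *\<^sub>R y i) + (1 - A) *\<^sub>R 0 \<in> ?H"
      using A zero by (intro convexD[OF convex_convex_hull]) auto
    moreover have "A *\<^sub>R (\<Sum>i\<in>UNIV. (\<bar>c i\<bar> / A) *\<^sub>R y i) = (\<Sum>i\<in>UNIV. c i *\<^sub>R u i)"
      using A0 by (simp add: scaleR_sum_right cy)
    ultimately show ?thesis by simp
  qed
qed

text \<open>Listing by index counts coinciding points with multiplicity, in step with the list sum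
  in \<open>vein\<close>.\<close>

lemma cross_polytope_list:
  fixes u :: "'n::finite \<Rightarrow> 'a::real_vector" and g :: "'a \<Rightarrow> real"
  obtains ps where "set ps = range u \<union> range (\<lambda>i. - u i)"
    "(\<Sum>p\<leftarrow>ps. g p) = (\<Sum>i\<in>UNIV. g (u i)) + (\<Sum>i\<in>UNIV. g (- u i))"
proof -
  obtain ks :: "'n list" where "set ks = UNIV" "distinct ks" using finite_distinct_list[of "UNIV :: 'n set"] by auto
  then show thesis
    using that[of "map u ks @ map (\<lambda>i. - u i) ks"] by (simp add: sum_list_distinct_conv_sum_set o_def)
qed

lemma vein_cross_polytope_le:
  fixes u :: "'n::finite \<Rightarrow> 'a::euclidean_space" and s :: real
  assumes "cball 0 r \<subseteq> K" "0 < r"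
    and "\<And>x. x \<in> K \<Longrightarrow> \<exists>c. x = (\<Sum>i\<in>UNIV. c i *\<^sub>R u i) \<and> (\<Sum>i\<in>UNIV. \<bar>c i\<bar>) \<le> 1"
    and "\<And>i. body_norm K (u i) \<le> s" "\<And>i. body_norm K (- u i) \<le> s"
  shows "vein K \<le> 2 * real CARD('n) * s"
proof -
  obtain ps where ps: "set ps = range u \<union> range (\<lambda>i. - u i)"
    "(\<Sum>p\<leftarrow>ps. body_norm K p) = (\<Sum>i\<in>UNIV. body_norm K (u i)) + (\<Sum>i\<in>UNIV. body_norm K (- u i))"
    by (rule cross_polytope_list)
  have "K \<subseteq> convex hull (set ps)" unfolding ps(1) using assms(3) abs_sum_le_one_hull by blast
  then have "vein K \<le> (\<Sum>i\<in>UNIV. body_norm K (u i)) + (\<Sum>i\<in>UNIV. body_norm K (- u i))"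
    using vein_le[OF assms(1,2), of ps] ps(2) by simp
  also have "\<dots> \<le> (\<Sum>i\<in>(UNIV::'n set). s) + (\<Sum>i\<in>(UNIV::'n set). s)" using assms(4,5) by (intro add_mono sum_mono)
  finally show ?thesis by (simp add: mult_ac)
qed

lemma vec_eq_sum_axis: "(x :: real^'n) = (\<Sum>i\<in>UNIV. (x $ i) *\<^sub>R axis i 1)"
  using basis_expansion[of x] by (simp add: scalar_mult_eq_scaleR)

lemma sum_abs_le_sqrt_card_norm:
  fixes x :: "real^'n"
  shows "(\<Sum>i\<in>UNIV. \<bar>x $ i\<bar>) \<le> sqrt CARD('n) * norm x"
proof (rule power2_le_imp_le)
  have "(\<Sum>i\<in>UNIV. \<bar>x $ i\<bar> * 1)\<^sup>2 \<le> (\<Sum>i\<in>UNIV. \<bar>x $ i\<bar>\<^sup>2) * (\<Sum>i\<in>(UNIV::'n set). 1\<^sup>2)"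
    by (rule Cauchy_Schwarz_ineq_sum)
  then show "(\<Sum>i\<in>UNIV. \<bar>x $ i\<bar>)\<^sup>2 \<le> (sqrt CARD('n) * norm x)\<^sup>2"
    by (simp add: power_mult_distrib norm_vec_def L2_set_def sum_nonneg mult.commute)
qed simp

text \<open>By Cauchy-Schwarz the l1 norm is at most sqrt n on the unit ball, so the cross-polytope
  with its 2 n vertices at distance sqrt n contains the ball.\<close>

lemma vein_ball_le: "vein (cball 0 1 :: (real^'n) set) \<le> 2 * real CARD('n) * sqrt CARD('n)"
proof (rule vein_cross_polytope_le[of 1 _ "\<lambda>i::'n. sqrt CARD('n) *\<^sub>R axis i 1"])
  let ?s = "sqrt CARD('n)"
  have s: "?s > 0" by simp
  fix x :: "real^'n" assume x: "x \<in> cball 0 1"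
  have "x = (\<Sum>i\<in>UNIV. (x $ i / ?s) *\<^sub>R ?s *\<^sub>R axis i 1)" using s by (subst vec_eq_sum_axis) simp
  moreover have "(\<Sum>i\<in>UNIV. \<bar>x $ i / ?s\<bar>) \<le> 1"
  proof -
    have "(\<Sum>i\<in>UNIV. \<bar>x $ i / ?s\<bar>) = (\<Sum>i\<in>UNIV. \<bar>x $ i\<bar>) / ?s" by (simp add: sum_divide_distrib abs_divide)
    also have "\<dots> \<le> (?s * norm x) / ?s" by (intro divide_right_mono sum_abs_le_sqrt_card_norm) simp
    finally show ?thesis using x s by simp
  qed
  ultimately show "\<exists>c. x = (\<Sum>i\<in>UNIV. c i *\<^sub>R ?s *\<^sub>R axis i 1) \<and> (\<Sum>i\<in>UNIV. \<bar>c i\<bar>) \<le> 1"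
    by (intro exI[of _ "\<lambda>i. x $ i / ?s"] conjI)
qed (auto simp: body_norm_cball)

lemma bounded_subset_hull:
  fixes K :: "(real^'n) set"
  assumes "bounded K" obtains ps where "K \<subseteq> convex hull (set ps)"
proof -
  obtain b where b: "b > 0" "\<And>x. x \<in> K \<Longrightarrow> norm x \<le> b" using assms by (auto simp: bounded_pos)
  define t where "t = b * sqrt CARD('n)"
  have t: "t > 0" using b by (simp add: t_def)
  obtain ps where ps: "set ps = range (\<lambda>i::'n. t *\<^sub>R axis i (1::real)) \<union> range (\<lambda>i. - (t *\<^sub>R axis i 1))"
    by (rule cross_polytope_list)
  have "x \<in> convex hull (set ps)" if x: "x \<in> K" for x
  proof -
    have "x = (\<Sum>i\<in>UNIV. (x $ i / t) *\<^sub>R t *\<^sub>R axis i 1)" using t by (subst vec_eq_sum_axis) simp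
    moreover have "(\<Sum>i\<in>UNIV. \<bar>x $ i / t\<bar>) \<le> 1"
    proof -
      have "(\<Sum>i\<in>UNIV. \<bar>x $ i / t\<bar>) = (\<Sum>i\<in>UNIV. \<bar>x $ i\<bar>) / t" using t by (simp add: sum_divide_distrib abs_divide)
      also have "\<dots> \<le> (sqrt CARD('n) * norm x) / t" using t by (intro divide_right_mono sum_abs_le_sqrt_card_norm) simp
      also have "\<dots> \<le> (sqrt CARD('n) * b) / t" using t b(2)[OF x] by (intro divide_right_mono mult_left_mono) auto
      also have "(sqrt CARD('n) * b) / t = 1" using b(1) by (simp add: t_def)
      finally show ?thesis .
    qed
    ultimately show ?thesis unfolding ps using abs_sum_le_one_hull by metis
  qed
  then show thesis using that by blast
qed

lemma continuous_on_det:
  fixes f :: "'a::topological_space \<Rightarrow> real^'n^'n"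
  assumes "continuous_on S f" shows "continuous_on S (\<lambda>x. det (f x))"
  unfolding det_def using assms by (intro continuous_intros)

lemma auerbach:
  fixes K :: "(real^'n) set"
  assumes K: "symmetric_convex_body K"
  obtains u :: "'n \<Rightarrow> real^'n" where "\<And>i. u i \<in> K"
    "\<And>x. x \<in> K \<Longrightarrow> \<exists>c. x = (\<Sum>i\<in>UNIV. c i *\<^sub>R u i) \<and> (\<forall>i. \<bar>c i\<bar> \<le> 1)"
proof -
  have cpt: "compact K" using K by (auto simp: symmetric_convex_body_def convex_body_def)
  obtain r where r: "0 < r" "cball 0 r \<subseteq> K" using symmetric_convex_body_cball[OF K] .
  \<comment> \<open>Maximise the determinant over bases in the body; by Cramer's rule the coordinates of any
    point of the body are then at most 1.\<close>
  define M where "M = {A :: real^'n^'n. \<forall>i. A $ i \<in> K}"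
  have "closed M"
  proof -
    have "M = (\<Inter>i. (\<lambda>A. A $ i) -` K)" by (auto simp: M_def)
    then show ?thesis
      by (auto intro!: closed_INT closed_vimage[OF compact_imp_closed[OF cpt]] continuous_intros)
  qed
  moreover have "bounded M"
  proof -
    obtain b where b: "\<And>x. x \<in> K \<Longrightarrow> norm x \<le> b" using compact_imp_bounded[OF cpt] by (auto simp: bounded_iff)
    have "norm A \<le> (\<Sum>i\<in>(UNIV::'n set). b)" if "A \<in> M" for A
    proof -
      have "norm A \<le> (\<Sum>i\<in>UNIV. norm (A $ i))" unfolding norm_vec_def by (intro L2_set_le_sum) simp
      also have "\<dots> \<le> (\<Sum>i\<in>(UNIV::'n set). b)" using that b by (intro sum_mono) (simp add: M_def)
      finally show ?thesis .
    qed
    then show ?thesis by (auto simp: bounded_iff)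
  qed
  ultimately have "compact M" by (simp add: compact_eq_bounded_closed)
  moreover have rM: "(\<chi> i. r *\<^sub>R axis i 1) \<in> M" using r by (auto simp: M_def)
  moreover have "continuous_on M (\<lambda>A. \<bar>det A\<bar>)"
    by (intro continuous_on_rabs continuous_on_det continuous_on_id)
  ultimately obtain A where A: "A \<in> M" "\<And>B. B \<in> M \<Longrightarrow> \<bar>det B\<bar> \<le> \<bar>det A\<bar>"
    using continuous_attains_sup[of M "\<lambda>A. \<bar>det A\<bar>"] by blast
  have "det (\<chi> i. r *\<^sub>R axis i 1 :: real^'n^'n) = r ^ CARD('n)"
    by (subst det_diagonal) (auto simp: axis_def)
  then have "0 < det A \<or> det A < 0" using A(2)[OF rM] zero_less_power[OF r(1), of "CARD('n)"] by linarith
  then have det0: "det A \<noteq> 0" by auto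
  then have inv: "invertible (transpose A)" by (simp add: invertible_det_nz)
  show thesis
  proof (rule that[of "\<lambda>i. A $ i"])
    show "A $ i \<in> K" for i using A(1) by (simp add: M_def)
    fix x assume x: "x \<in> K"
    obtain c where c: "transpose A *v c = x" using inv by (metis invertible_def matrix_vector_mul_assoc matrix_vector_mul_lid)
    have xc: "x = (\<Sum>i\<in>UNIV. (c $ i) *s row i A)"
      unfolding c[symmetric] matrix_mult_sum by (simp add: column_transpose)
    have "\<bar>c $ k\<bar> \<le> 1" for k
    proof -
      define B where "B = (\<chi> i. if i = k then x else row i A)"
      have "B \<in> M" using A(1) x by (auto simp: M_def B_def row_def)
      then have "\<bar>det B\<bar> \<le> \<bar>det A\<bar>" by (rule A(2))
      moreover have "det B = c $ k * det A" unfolding B_def xc by (rule cramer_lemma_transpose)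
      ultimately have "\<bar>c $ k\<bar> * \<bar>det A\<bar> \<le> 1 * \<bar>det A\<bar>" by (simp add: abs_mult)
      then show ?thesis using det0 by (simp del: mult_1)
    qed
    moreover have "x = (\<Sum>i\<in>UNIV. (c $ i) *\<^sub>R A $ i)" using xc by (simp add: row_def scalar_mult_eq_scaleR)
    ultimately show "\<exists>c. x = (\<Sum>i\<in>UNIV. c i *\<^sub>R A $ i) \<and> (\<forall>i. \<bar>c i\<bar> \<le> 1)" by blast
  qed
qed

text \<open>In an Auerbach basis the n coordinates are at most 1 in absolute value; dilating the
  basis by n brings the sum of their absolute values down to at most 1.\<close>

lemma vein_le_general:
  fixes K :: "(real^'n) set"
  assumes K: "symmetric_convex_body K" shows "vein K \<le> 2 * (real CARD('n))\<^sup>2"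
proof -
  obtain r where r: "0 < r" "cball 0 r \<subseteq> K" using symmetric_convex_body_cball[OF K] .
  obtain u :: "'n \<Rightarrow> real^'n" where u: "\<And>i. u i \<in> K"
    "\<And>x. x \<in> K \<Longrightarrow> \<exists>c. x = (\<Sum>i\<in>UNIV. c i *\<^sub>R u i) \<and> (\<forall>i. \<bar>c i\<bar> \<le> 1)" using auerbach[OF K] by blast
  let ?n = "real CARD('n)"
  have "vein K \<le> 2 * ?n * ?n"
  proof (rule vein_cross_polytope_le[OF r(2,1), of "\<lambda>i. ?n *\<^sub>R u i"])
    fix x assume "x \<in> K"
    then obtain c where c: "x = (\<Sum>i\<in>UNIV. c i *\<^sub>R u i)" "\<And>i. \<bar>c i\<bar> \<le> 1" using u(2) by blast
    have "(\<Sum>i\<in>UNIV. \<bar>c i / ?n\<bar>) \<le> (\<Sum>i\<in>(UNIV::'n set). 1 / ?n)" using c(2) by (intro sum_mono) (simp add: divide_right_mono)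
    then show "\<exists>c. x = (\<Sum>i\<in>UNIV. c i *\<^sub>R ?n *\<^sub>R u i) \<and> (\<Sum>i\<in>UNIV. \<bar>c i\<bar>) \<le> 1"
      using c(1) by (intro exI[of _ "\<lambda>i. c i / ?n"]) simp
  next
    fix i
    show "body_norm K (?n *\<^sub>R u i) \<le> ?n" using u(1) by (intro body_norm_le[of "u i"]) auto
    have "uminus ` K = K" using K by (simp add: symmetric_convex_body_def)
    then have "- u i \<in> K" using u(1) by blast
    then show "body_norm K (- (?n *\<^sub>R u i)) \<le> ?n" by (intro body_norm_le[of "- u i"]) auto
  qed
  then show ?thesis by (simp add: power2_eq_square)
qed

section \<open>John position\<close>

text \<open>At d = 0 the product is 1 with derivative P - m > 0, so small d work; the chosen d
  satisfies d P m < P - m, and Bernoulli's inequality does the rest. In \<open>john\<close> the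
  product is the squared factor by which the volume grows, with m = n - 1.\<close>

lemma john_stretch:
  fixes P :: real and m :: nat
  assumes "real m < P"
  obtains d where "0 < d" "d < 1" "1 < (1 + d * P) * (1 - d) ^ m"
proof -
  define d where "d = (P - m) / (2 * P * (m + 1))"
  have P: "P > 0" using assms by linarith
  have d0: "0 < d" unfolding d_def using assms P by (intro divide_pos_pos mult_pos_pos) auto
  have "P - m < 2 * P * (m + 1)" using P by (simp add: algebra_simps add_pos_nonneg)
  then have d1: "d < 1" unfolding d_def using P by (simp add: divide_less_eq)
  have "d * P * m < P - m"
  proof -
    have "d * P = (P - m) / (2 * (m + 1))" unfolding d_def using P by simp
    then have "d * P * m = (P - m) * (m / (2 * (m + 1)))" by simp
    also have "\<dots> < (P - m) * 1" using assms by (intro mult_strict_left_mono) (auto simp: field_simps)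
    finally show ?thesis by simp
  qed
  then have "0 < d * (P - m - d * P * m)" using d0 by simp
  then have "1 < (1 + d * P) * (1 - m * d)" by (simp add: algebra_simps)
  also have "\<dots> \<le> (1 + d * P) * (1 - d) ^ m"
    using Bernoulli_inequality[of "- d" m] d0 d1 P by (intro mult_left_mono) auto
  finally show thesis using that d0 d1 by blast
qed

lemma john:
  fixes K :: "(real^'n) set"
  assumes K: "symmetric_convex_body K"
  obtains T S :: "real^'n \<Rightarrow> real^'n" where "linear T" "linear S" "\<And>x. S (T x) = x" "\<And>x. T (S x) = x"
    "\<And>x. norm x \<le> 1 \<Longrightarrow> T x \<in> K" "\<And>y. y \<in> K \<Longrightarrow> norm (S y) \<le> sqrt CARD('n)"
proof -
  have cpt: "compact K" and cvx: "convex K" and sym: "uminus ` K = K"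
    using K by (auto simp: symmetric_convex_body_def convex_body_def)
  have clK: "closed K" using cpt by (rule compact_imp_closed)
  obtain r where r: "0 < r" "cball 0 r \<subseteq> K" using symmetric_convex_body_cball[OF K] .
  define M where "M = {A :: real^'n^'n. \<forall>x\<in>cball 0 1. A *v x \<in> K}"
  have "closed M"
  proof -
    have "M = (\<Inter>x\<in>cball 0 1. (\<lambda>A. A *v x) -` K)" by (auto simp: M_def)
    moreover have "continuous_on UNIV (\<lambda>A::real^'n^'n. A *v x)" for x
      unfolding matrix_vector_mult_def by (intro continuous_intros)
    ultimately show ?thesis by (auto intro!: closed_INT closed_vimage[OF clK])
  qed
  moreover have "bounded M"
  proof -
    obtain b where b: "\<And>x. x \<in> K \<Longrightarrow> norm x \<le> b" using compact_imp_bounded[OF cpt] by (auto simp: bounded_iff)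
    have "norm A \<le> (\<Sum>i\<in>(UNIV::'n set). \<Sum>j\<in>(UNIV::'n set). b)" if "A \<in> M" for A
    proof -
      have Aij: "\<bar>A $ i $ j\<bar> \<le> b" for i j
      proof -
        have "A *v axis j 1 \<in> K" using that by (simp add: M_def)
        then have "norm (A *v axis j 1) \<le> b" by (rule b)
        then show ?thesis using component_le_norm_cart[of "A *v axis j 1" i]
          by (simp add: matrix_vector_mul_component inner_axis)
      qed
      have "norm A \<le> (\<Sum>i\<in>UNIV. norm (A $ i))" unfolding norm_vec_def by (intro L2_set_le_sum) simp
      also have "\<dots> \<le> (\<Sum>i\<in>(UNIV::'n set). \<Sum>j\<in>UNIV. \<bar>A $ i $ j\<bar>)" by (intro sum_mono norm_le_l1_cart)
      also have "\<dots> \<le> (\<Sum>i\<in>(UNIV::'n set). \<Sum>j\<in>(UNIV::'n set). b)" using Aij by (intro sum_mono)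
      finally show ?thesis .
    qed
    then show ?thesis by (auto simp: bounded_iff)
  qed
  ultimately have "compact M" by (simp add: compact_eq_bounded_closed)
  moreover have rM: "(\<chi> i j. if i = j then r else 0) \<in> M"
  proof -
    have "(\<chi> i j. if i = j then r else 0) *v x = r *\<^sub>R x" for x :: "real^'n"
      by (simp add: matrix_vector_mult_def vec_eq_iff if_distrib[of "\<lambda>y. y * _"] cong: if_cong)
    moreover have "r *\<^sub>R x \<in> K" if "norm x \<le> 1" for x using r that by (intro subsetD[OF r(2)]) (auto simp: mult_left_le)
    ultimately show ?thesis by (auto simp: M_def)
  qed
  moreover have "continuous_on M (\<lambda>A. \<bar>det A\<bar>)"
    by (intro continuous_on_rabs continuous_on_det continuous_on_id)
  ultimately obtain A where A: "A \<in> M" "\<And>B. B \<in> M \<Longrightarrow> \<bar>det B\<bar> \<le> \<bar>det A\<bar>"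
    using continuous_attains_sup[of M "\<lambda>A. \<bar>det A\<bar>"] by blast
  have "det (\<chi> i j. if i = j then r else 0 :: real^'n^'n) = r ^ CARD('n)"
    by (subst det_diagonal) auto
  then have "0 < det A \<or> det A < 0" using A(2)[OF rM] zero_less_power[OF r(1), of "CARD('n)"] by linarith
  then have det0: "det A \<noteq> 0" by auto
  then obtain A' where A': "A' ** A = mat 1" "A ** A' = mat 1" by (auto simp: invertible_det_nz[symmetric] invertible_def)
  have inv: "A' *v (A *v x) = x" "A *v (A' *v x) = x" for x by (simp_all add: matrix_vector_mul_assoc A')
  \<comment> \<open>Otherwise stretching the ellipsoid of maximal volume towards \<open>y\<close> and shrinking it slightly
    in the orthogonal directions would keep it inside the body and increase its volume.\<close>
  have bound: "norm (A' *v y) \<le> sqrt CARD('n)" if y: "y \<in> K" for y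
  proof (rule ccontr)
    define w R where "w = A' *v y" and "R = norm (A' *v y)"
    define P where "P = R\<^sup>2 - 1"
    assume "\<not> norm (A' *v y) \<le> sqrt CARD('n)"
    then have "(sqrt CARD('n))\<^sup>2 < R\<^sup>2" unfolding R_def by (intro power_strict_mono) auto
    then have "real (CARD('n) - 1) < P" by (simp add: P_def of_nat_diff Suc_leI)
    then obtain d where d: "0 < d" "d < 1" "1 < (1 + d * P) * (1 - d) ^ (CARD('n) - 1)" by (rule john_stretch)
    have P0: "0 < P" using \<open>real (CARD('n) - 1) < P\<close> by linarith
    then have R1: "1 < R\<^sup>2" by (simp add: P_def)
    then have R0: "R > 0" unfolding R_def by (metis norm_ge_zero not_less_iff_gr_or_eq order.order_iff_strict power_zero_numeral zero_less_one)
    have wy: "A *v w = y" by (simp add: w_def inv)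
    obtain k :: 'n where True by blast
    have "axis k R = R *\<^sub>R axis k (1::real)" by (simp add: vec_eq_iff axis_def)
    then have "norm (axis k R) = norm w" using R0 by (simp add: w_def R_def)
    then obtain q where q: "orthogonal_transformation q" "q (axis k R) = w"
      by (rule orthogonal_transformation_exists)
    \<comment> \<open>Since a^2 = (1 - d) + d R^2 and b^2 = 1 - d, the squared support function of
      the new ellipsoid is the average, with weights 1 - d and d, of those of the old ellipsoid and
      of the segment from \<open>- y\<close> to \<open>y\<close>. Both lie in \<open>K\<close>,
      hence so does the new ellipsoid.\<close>
    define a b where "a = sqrt (1 + d * P)" and "b = sqrt (1 - d)"
    have ab: "a\<^sup>2 = 1 + d * P" "b\<^sup>2 = 1 - d" "0 \<le> a" "0 \<le> b" using d P0 by (auto simp: a_def b_def)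
    define D where "D = (\<chi> i j. if i = j then (if i = k then a else b) else 0 :: real^'n^'n)"
    define B where "B = A ** (matrix q ** D)"
    have "det D = (\<Prod>i\<in>UNIV. if i = k then a else b)" unfolding D_def by (subst det_diagonal) auto
    also have "\<dots> = a * b ^ (CARD('n) - 1)"
      by (subst prod.remove[of _ k]) (auto simp: card_Diff_singleton)
    finally have detD: "det D = a * b ^ (CARD('n) - 1)" .
    have "(det D)\<^sup>2 = (1 + d * P) * (1 - d) ^ (CARD('n) - 1)"
      unfolding detD power_mult_distrib ab(1) by (metis ab(2) power_mult mult.commute)
    then have "1 < (det D)\<^sup>2" using d(3) by simp
    then have "1 < \<bar>det D\<bar>" using abs_square_le_1[of "det D"] by linarith
    moreover have "\<bar>det B\<bar> = \<bar>det A\<bar> * \<bar>det D\<bar>" using q(1) by (simp add: B_def det_mul abs_mult)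
    ultimately have "\<bar>det A\<bar> < \<bar>det B\<bar>" using det0 by simp
    moreover have "B \<in> M"
    proof -
      have "B *v x \<in> K" if x: "norm x \<le> 1" for x
      proof (rule ccontr)
        assume "B *v x \<notin> K"
        then obtain v' c' where v': "v' \<bullet> (B *v x) < c'" "\<And>z. z \<in> K \<Longrightarrow> c' < v' \<bullet> z"
          using separating_hyperplane_closed_point[OF cvx clK] by metis
        define v c where "v = - v'" and "c = - c'"
        have v: "c < v \<bullet> (B *v x)" "\<And>z. z \<in> K \<Longrightarrow> v \<bullet> z \<le> c"
          using v' by (auto simp: v_def c_def intro: less_imp_le)
        define t where "t = v v* (A ** matrix q)"
        have vt: "v \<bullet> (A *v (q z)) = t \<bullet> z" for z
        proof -
          have "A *v (q z) = (A ** matrix q) *v z"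
            using q(1) by (simp add: matrix_vector_mul_assoc[symmetric] orthogonal_transformation_linear)
          then show ?thesis by (simp add: t_def dot_lmul_matrix)
        qed
        have "q z \<in> cball 0 1" if "norm z \<le> 1" for z using that q(1) by (simp add: orthogonal_transformation_norm)
        then have tz: "t \<bullet> z \<le> c" if "norm z \<le> 1" for z
          unfolding vt[symmetric] using that A(1) by (intro v(2)) (auto simp: M_def)
        have c0: "0 \<le> c" using tz[of 0] by simp
        have tc: "norm t \<le> c"
        proof (cases "t = 0")
          case False
          then have "t \<bullet> (t /\<^sub>R norm t) \<le> c" by (intro tz) auto
          moreover have "t \<bullet> (t /\<^sub>R norm t) = norm t" using False by (simp add: power2_norm_eq_inner[symmetric] power2_eq_square)
          ultimately show ?thesis by simp
        qed (use c0 in simp)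
        have "- y \<in> K" using y sym by blast
        then have "\<bar>v \<bullet> y\<bar> \<le> c" using v(2)[OF y] v(2)[of "- y"] by auto
        moreover have "v \<bullet> y = t $ k * R" using vt[of "axis k R"] q(2) wy by (simp add: inner_axis)
        ultimately have tk: "\<bar>t $ k\<bar> * R \<le> c" using R0 by (simp add: abs_mult)
        have Dx: "v \<bullet> (B *v x) = t \<bullet> (D *v x)"
        proof -
          have "B *v x = A *v (q (D *v x))"
            unfolding B_def using q(1) by (simp add: matrix_vector_mul_assoc[symmetric] orthogonal_transformation_linear)
          then show ?thesis using vt by simp
        qed
        define s where "s = (\<chi> i. (if i = k then a else b) * t $ i)"
        have "t \<bullet> (D *v x) = s \<bullet> x"
        proof -
          have "(D *v x) $ i = (if i = k then a else b) * x $ i" for i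
            by (simp add: D_def matrix_vector_mult_def if_distrib[of "\<lambda>y. y * _"] cong: if_cong)
          then show ?thesis by (simp add: inner_vec_def s_def algebra_simps)
        qed
        also have "\<dots> \<le> norm s * norm x" by (rule norm_cauchy_schwarz)
        also have "\<dots> \<le> norm s * 1" using x by (intro mult_left_mono) auto
        also have "\<dots> \<le> c"
        proof -
          have "(norm s)\<^sup>2 = (\<Sum>i\<in>UNIV. (s $ i)\<^sup>2)" by (simp add: norm_vec_def L2_set_def sum_nonneg)
          also have "\<dots> = (\<Sum>i\<in>UNIV. b\<^sup>2 * (t $ i)\<^sup>2 + (if i = k then (a\<^sup>2 - b\<^sup>2) * (t $ i)\<^sup>2 else 0))"
            by (intro sum.cong) (auto simp: s_def power_mult_distrib algebra_simps)
          also have "\<dots> = b\<^sup>2 * (\<Sum>i\<in>UNIV. (t $ i)\<^sup>2) + (a\<^sup>2 - b\<^sup>2) * (t $ k)\<^sup>2"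
            by (simp add: sum.distrib sum_distrib_left)
          also have "(\<Sum>i\<in>UNIV. (t $ i)\<^sup>2) = (norm t)\<^sup>2" by (simp add: norm_vec_def L2_set_def sum_nonneg)
          also have "a\<^sup>2 - b\<^sup>2 = d * R\<^sup>2" unfolding ab by (simp add: P_def algebra_simps)
          also have "b\<^sup>2 * (norm t)\<^sup>2 + d * R\<^sup>2 * (t $ k)\<^sup>2 = b\<^sup>2 * (norm t)\<^sup>2 + d * (\<bar>t $ k\<bar> * R)\<^sup>2"
            by (simp add: power_mult_distrib)
          also have "\<dots> \<le> b\<^sup>2 * c\<^sup>2 + d * c\<^sup>2"
            using tc tk R0 d by (intro add_mono mult_left_mono power_mono) auto
          also have "\<dots> = c\<^sup>2" unfolding ab by (simp add: algebra_simps)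
          finally have "(norm s)\<^sup>2 \<le> c\<^sup>2" .
          then show ?thesis using c0 by (auto intro: power2_le_imp_le)
        qed
        finally show False using v(1) Dx by simp
      qed
      then show ?thesis by (simp add: M_def)
    qed
    ultimately show False using A(2)[of B] by simp
  qed
  show thesis
    by (rule that[of "(*v) A" "(*v) A'"]) (use inv bound A(1) in \<open>auto simp: M_def\<close>)
qed

text \<open>In John position the hull of the points \<open>S p\<close> contains the unit ball, and
  \<open>norm (S p)\<close> is at most sqrt n times the norm of \<open>p\<close> in
  \<open>K\<close>. With c = 4 sqrt 2 and c = 6 sqrt 3 this gives 4 and 6.\<close>

lemma vein_ge_ball:
  fixes K :: "(real^'n) set"
  assumes K: "symmetric_convex_body K"
    and c: "\<And>ps :: (real^'n) list. cball 0 1 \<subseteq> convex hull (set ps) \<Longrightarrow> c \<le> (\<Sum>p\<leftarrow>ps. norm p)"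
  shows "c / sqrt CARD('n) \<le> vein K"
proof -
  have "bounded K" using K by (auto simp: symmetric_convex_body_def convex_body_def compact_imp_bounded)
  then obtain qs where qs: "K \<subseteq> convex hull (set qs)" by (rule bounded_subset_hull)
  obtain r where r: "0 < r" "cball 0 r \<subseteq> K" using symmetric_convex_body_cball[OF K] .
  obtain T S :: "real^'n \<Rightarrow> real^'n" where T: "linear T" "linear S" "\<And>x. S (T x) = x" "\<And>x. T (S x) = x"
    "\<And>x. norm x \<le> 1 \<Longrightarrow> T x \<in> K" "\<And>y. y \<in> K \<Longrightarrow> norm (S y) \<le> sqrt CARD('n)" using john[OF K] by blast
  show ?thesis
  proof (rule vein_ge[OF qs])
    fix ps assume ps: "K \<subseteq> convex hull (set ps)"
    have "cball 0 1 \<subseteq> convex hull (set (map S ps))"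
    proof
      fix x :: "real^'n" assume "x \<in> cball 0 1"
      then have "S (T x) \<in> S ` (convex hull (set ps))" using T(5) ps by auto
      then show "x \<in> convex hull (set (map S ps))" using convex_hull_linear_image[OF T(2), of "set ps"] T(3) by simp
    qed
    then have "c \<le> (\<Sum>p\<leftarrow>map S ps. norm p)" by (rule c)
    then have "c / sqrt CARD('n) \<le> (\<Sum>p\<leftarrow>map S ps. norm p) / sqrt CARD('n)" by (intro divide_right_mono) auto
    also have "\<dots> = (\<Sum>p\<leftarrow>ps. norm (S p) / sqrt CARD('n))" by (induction ps) (auto simp: add_divide_distrib)
    also have "\<dots> \<le> (\<Sum>p\<leftarrow>ps. body_norm K p)"
    proof (rule sum_list_mono)
      fix p
      show "norm (S p) / sqrt CARD('n) \<le> body_norm K p"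
      proof (rule body_norm_ge[OF r(2,1)])
        fix l y assume ly: "0 < l" "y \<in> K" "p = l *\<^sub>R y"
        have "norm (S p) = l * norm (S y)" using ly by (simp add: linear_scale[OF T(2)])
        also have "\<dots> \<le> l * sqrt CARD('n)" using ly T(6) by (intro mult_left_mono) auto
        finally show "norm (S p) / sqrt CARD('n) \<le> l" by (simp add: divide_le_eq)
      qed
    qed
    finally show "c / sqrt CARD('n) \<le> (\<Sum>p\<leftarrow>ps. body_norm K p)" .
  qed
qed

section \<open>Planar bodies\<close>

lemma body_norm_combination_le:
  assumes K: "convex K" "0 \<in> K" and uv: "u \<in> K" "v \<in> K" and c: "0 \<le> k" "0 \<le> l" "k + l \<le> L" "0 < L"
  shows "body_norm K (k *\<^sub>R u + l *\<^sub>R v) \<le> L"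
proof (rule body_norm_le)
  define t where "t = (k + l) / L"
  have t: "0 \<le> t" "t \<le> 1" using c by (auto simp: t_def)
  show "(k / L) *\<^sub>R u + (l / L) *\<^sub>R v \<in> K"
  proof (cases "k + l = 0")
    case True
    then have "k = 0" "l = 0" using c by linarith+
    then show ?thesis using K by simp
  next
    case False
    then have pos: "k + l > 0" using c by linarith
    have w: "(k / (k + l)) *\<^sub>R u + (l / (k + l)) *\<^sub>R v \<in> K"
      using pos c uv by (intro convexD[OF K(1)]) (auto simp: add_divide_distrib[symmetric])
    then have "t *\<^sub>R ((k / (k + l)) *\<^sub>R u + (l / (k + l)) *\<^sub>R v) + (1 - t) *\<^sub>R 0 \<in> K"
      using t by (intro convexD[OF K(1) w K(2)]) auto
    then show ?thesis using pos by (simp add: scaleR_add_right t_def)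
  qed
  show "k *\<^sub>R u + l *\<^sub>R v = L *\<^sub>R ((k / L) *\<^sub>R u + (l / L) *\<^sub>R v)" using c by (simp add: scaleR_add_right)
qed (use c in simp)

text \<open>The corner is where the lines \<open>f \<bullet> x = 1\<close> and
  \<open>b \<bullet> x = h\<close> meet; its first coordinate is x = 1 - m h. Written as k c + l e
  with k, l nonnegative and e one of \<open>e1\<close>, \<open>e2\<close>, it has norm at most k +
  l. Applying a + b gives k + l = h + x - k (h - 1), so a lower bound 1 - m for k is all that
  remains.\<close>

lemma body_norm_corner_le:
  fixes K :: "'a::euclidean_space set"
  assumes K: "convex K" "0 \<in> K" and e: "e1 \<in> K" "e2 \<in> K"
    and basis: "\<And>x. x = (a \<bullet> x) *\<^sub>R e1 + (b \<bullet> x) *\<^sub>R e2"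
    and dual: "a \<bullet> e1 = 1" "b \<bullet> e1 = 0"
    and f: "\<And>x. f \<bullet> x = a \<bullet> x + m * (b \<bullet> x)" "\<And>x. x \<in> K \<Longrightarrow> f \<bullet> x \<le> 1" and m: "0 \<le> m" "m \<le> 1"
    and h: "1 \<le> h" "\<And>x. x \<in> K \<Longrightarrow> b \<bullet> x \<le> h" and c0: "c0 \<in> K" "h \<le> a \<bullet> c0 + b \<bullet> c0"
  shows "body_norm K ((1 - m * h) *\<^sub>R e1 + h *\<^sub>R e2) \<le> 2 - m"
proof -
  \<comment> \<open>Interpolation between \<open>e1\<close>, where a + b is 1, and \<open>c0\<close>
    gives a point where a + b is exactly h.\<close>
  obtain c where c: "c \<in> K" "a \<bullet> c + b \<bullet> c = h"
  proof (cases "a \<bullet> c0 + b \<bullet> c0 = h")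
    case False
    define t where "t = (h - 1) / (a \<bullet> c0 + b \<bullet> c0 - 1)"
    have pos: "a \<bullet> c0 + b \<bullet> c0 - 1 > 0" using False c0(2) h(1) by linarith
    have t: "0 \<le> t" "t \<le> 1" using pos h(1) c0(2) by (auto simp: t_def)
    have "(1 - t) *\<^sub>R e1 + t *\<^sub>R c0 \<in> K" using t e c0 by (intro convexD[OF K(1)]) auto
    moreover have "t * (a \<bullet> c0 + b \<bullet> c0 - 1) = h - 1" using pos by (simp add: t_def)
    then have "a \<bullet> ((1 - t) *\<^sub>R e1 + t *\<^sub>R c0) + b \<bullet> ((1 - t) *\<^sub>R e1 + t *\<^sub>R c0) = h"
      by (simp add: inner_simps dual algebra_simps)
    ultimately show thesis using that by blast
  qed (use c0 that in auto)
  define A B x where "A = a \<bullet> c" and "B = b \<bullet> c" and "x = 1 - m * h"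
  have ce: "c = A *\<^sub>R e1 + B *\<^sub>R e2" using basis[of c] by (simp add: A_def B_def)
  have AB: "A + B = h" using c(2) by (simp add: A_def B_def)
  have "B \<le> h" using h(2)[OF c(1)] by (simp add: B_def)
  then have A0: "0 \<le> A" using AB by linarith
  have "A + m * B \<le> 1" using f(2)[OF c(1)] f(1)[of c] by (simp add: A_def B_def)
  then have Ax: "A * (1 - m) \<le> x" using AB unfolding x_def by (simp add: AB[symmetric] algebra_simps)
  have x0: "0 \<le> x" using Ax A0 m by (meson diff_ge_0_iff_ge mult_nonneg_nonneg order_trans)
  have key: "k + l \<le> 2 - m" if "1 - m \<le> k" "k + l = h + x - k * (h - 1)" for k l
  proof -
    have "0 \<le> (h - 1) * (k - (1 - m))" using that h by simp
    then show ?thesis unfolding that(2) x_def by (simp add: algebra_simps)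
  qed
  show ?thesis
  \<comment> \<open>The sign of the determinant \<open>h * A - B * x\<close> tells on which side of
    the ray through \<open>c\<close> the corner lies: towards \<open>e2\<close> here, towards
    \<open>e1\<close> in the other case.\<close>
  proof (cases "0 < A \<and> B * x \<le> h * A")
    case True
    define k l where "k = x / A" and "l = h - B * (x / A)"
    have "B * x / A \<le> h" using True by (simp add: divide_le_eq)
    then have l: "0 \<le> k" "0 \<le> l" using x0 True by (auto simp: k_def l_def)
    have lA: "k * A = x" using True by (simp add: k_def)
    have "1 - m \<le> k" using Ax True by (simp add: k_def le_divide_eq mult.commute)
    moreover have "k + l = h + x - k * (h - 1)"
    proof -
      have "l = h - k * B" by (simp add: k_def l_def)
      then show ?thesis using lA AB[symmetric] by (simp add: algebra_simps)
    qed
    ultimately have "k + l \<le> 2 - m" by (rule key)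
    then have "body_norm K (k *\<^sub>R c + l *\<^sub>R e2) \<le> 2 - m"
      using m by (intro body_norm_combination_le[OF K c(1) e(2) l]) auto
    moreover have "k *\<^sub>R c + l *\<^sub>R e2 = (k * A) *\<^sub>R e1 + (k * B + l) *\<^sub>R e2"
      by (simp add: ce algebra_simps)
    moreover have "k * B + l = h" by (simp add: k_def l_def)
    ultimately show ?thesis using lA by (simp add: x_def)
  next
    case False
    have B0: "B > 0"
    proof (cases "A = 0")
      case False
      then have "0 < B * x" using \<open>\<not> (0 < A \<and> B * x \<le> h * A)\<close> A0 h(1) by (smt (verit) mult_pos_pos)
      then show ?thesis using x0 by (simp add: zero_less_mult_iff)
    qed (use AB h in auto)
    define k l where "k = h / B" and "l = x - A * (h / B)"
    have "h * A \<le> B * x" using False A0 B0 x0 by (cases "A = 0") auto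
    then have "A * h / B \<le> x" using B0 by (simp add: divide_le_eq mult.commute)
    then have l: "0 \<le> k" "0 \<le> l" using B0 h(1) by (auto simp: k_def l_def)
    have lB: "k * B = h" using B0 by (simp add: k_def)
    have "1 \<le> k" using \<open>B \<le> h\<close> B0 by (simp add: k_def)
    then have "1 - m \<le> k" using m by linarith
    moreover have "k + l = h + x - k * (h - 1)"
    proof -
      have "l = x - k * A" by (simp add: k_def l_def)
      moreover have "k * A = k * h - k * B" using AB by (simp add: algebra_simps flip: AB)
      ultimately show ?thesis using lB by (simp add: algebra_simps)
    qed
    ultimately have "k + l \<le> 2 - m" by (rule key)
    then have "body_norm K (k *\<^sub>R c + l *\<^sub>R e1) \<le> 2 - m"
      using m by (intro body_norm_combination_le[OF K c(1) e(1) l]) auto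
    moreover have "k *\<^sub>R c + l *\<^sub>R e1 = (k * A + l) *\<^sub>R e1 + (k * B) *\<^sub>R e2"
      by (simp add: ce algebra_simps)
    moreover have "k * A + l = x" by (simp add: k_def l_def)
    ultimately show ?thesis using lB by (simp add: x_def)
  qed
qed

lemma body_norm_minus:
  assumes "uminus ` K = K" shows "body_norm K (- x) = body_norm K x"
proof -
  have neg: "- y \<in> K" if "y \<in> K" for y using that assms by blast
  have "(- x \<in> (\<lambda>y. l *\<^sub>R y) ` K) = (x \<in> (\<lambda>y. l *\<^sub>R y) ` K)" for l
  proof -
    have "- z \<in> (\<lambda>y. l *\<^sub>R y) ` K" if zK: "z \<in> (\<lambda>y. l *\<^sub>R y) ` K" for z
    proof -
      obtain y where "y \<in> K" "z = l *\<^sub>R y" using zK by blast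
      then show ?thesis using neg[of y] by (intro image_eqI[of _ _ "- y"]) auto
    qed
    from this[of x] this[of "- x"] show ?thesis by auto
  qed
  then show ?thesis by (simp add: body_norm_def)
qed

text \<open>The body lies in the parallelogram \<open>\<bar>f \<bullet> x\<bar> \<le> 1\<close>, \<open>\<bar>b \<bullet> x\<bar> \<le> h\<close>. The points \<open>c\<close> and \<open>d\<close> say that the
  body reaches at least as far beyond the other two pairs of sides of the hexagon as it does in the
  direction of \<open>b\<close>, which bounds the norms of the corners by \<open>2 - m\<close> and \<open>1 + m\<close>.\<close>

lemma vein_le_six_hexagon:
  fixes K :: "'a::euclidean_space set"
  assumes K: "symmetric_convex_body K" and e: "e1 \<in> K" "e2 \<in> K" "e2 - e1 \<in> K"
    and basis: "\<And>x. x = (a \<bullet> x) *\<^sub>R e1 + (b \<bullet> x) *\<^sub>R e2"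
    and dual: "a \<bullet> e1 = 1" "a \<bullet> e2 = 0" "b \<bullet> e1 = 0" "b \<bullet> e2 = 1"
    and f: "f \<bullet> e1 = 1" "\<And>x. x \<in> K \<Longrightarrow> f \<bullet> x \<le> 1"
    and h: "\<And>x. x \<in> K \<Longrightarrow> b \<bullet> x \<le> h"
    and c: "c \<in> K" "h \<le> a \<bullet> c + b \<bullet> c" and d: "d \<in> K" "h \<le> - (a \<bullet> d)"
  shows "vein K \<le> 6"
proof -
  have sym: "uminus ` K = K" and cvx: "convex K"
    using K by (auto simp: symmetric_convex_body_def convex_body_def)
  have neg: "- y \<in> K" if "y \<in> K" for y using that sym by blast
  obtain r where r: "0 < r" "cball 0 r \<subseteq> K" using symmetric_convex_body_cball[OF K] .
  have z: "0 \<in> K" using r by auto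
  define m where "m = f \<bullet> e2"
  \<comment> \<open>The bounds come from \<open>e1 - e2\<close> and \<open>e2\<close>, both in the
    body.\<close>
  have m: "0 \<le> m" "m \<le> 1" using f(2)[OF e(2)] f(2)[OF neg[OF e(3)]] f(1) by (auto simp: m_def inner_simps)
  have fx: "f \<bullet> x = a \<bullet> x + m * (b \<bullet> x)" for x
    by (subst (1) basis[of x]) (simp add: inner_add_right f(1) m_def)
  have h1: "1 \<le> h" using h[OF e(2)] dual by simp
  define p q where "p = (1 - m * h) *\<^sub>R e1 + h *\<^sub>R e2" and "q = (- (1 + m * h)) *\<^sub>R e1 + h *\<^sub>R e2"
  have p: "body_norm K p \<le> 2 - m"
    unfolding p_def by (rule body_norm_corner_le[OF cvx z e(1,2) basis dual(1,3) fx f(2) m h1 h c])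
  \<comment> \<open>The linear map taking \<open>e1\<close>, \<open>e2\<close> to
    \<open>- e1\<close>, \<open>e2 - e1\<close> preserves the hexagon and the functional b; it turns
    this corner into the previous situation with - f for f and 1 - m for m.\<close>
  have "body_norm K ((1 - (1 - m) * h) *\<^sub>R (- e1) + h *\<^sub>R (e2 - e1)) \<le> 2 - (1 - m)"
  proof (rule body_norm_corner_le[OF cvx z neg[OF e(1)] e(3), where a = "- (a + b)" and b = b and f = "- f" and ?c0.0 = d])
    show "x = (- (a + b) \<bullet> x) *\<^sub>R - e1 + (b \<bullet> x) *\<^sub>R (e2 - e1)" for x
      by (subst (1) basis[of x]) (simp add: inner_simps algebra_simps)
    show "- f \<bullet> x = - (a + b) \<bullet> x + (1 - m) * (b \<bullet> x)" for x
      by (simp add: fx inner_simps algebra_simps)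
    show "- f \<bullet> x \<le> 1" if "x \<in> K" for x using f(2)[OF neg[OF that]] by simp
  qed (use m h1 h d dual in \<open>auto simp: inner_simps\<close>)
  moreover have "(1 - (1 - m) * h) *\<^sub>R (- e1) + h *\<^sub>R (e2 - e1) = q" by (simp add: q_def algebra_simps)
  ultimately have q: "body_norm K q \<le> 1 + m" by simp
  have "K \<subseteq> convex hull (set [p, - p, q, - q])"
  proof
    fix x assume x: "x \<in> K"
    \<comment> \<open>In the coordinates (F, G) the corners \<open>p\<close> and \<open>q\<close>
      are (1, 1) and (-1, 1), and the parallelogram is the square of side 2 about 0.\<close>
    define F G where "F = f \<bullet> x" and "G = (b \<bullet> x) / h"
    have F: "\<bar>F\<bar> \<le> 1" using f(2)[OF x] f(2)[OF neg[OF x]] by (auto simp: F_def)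
    have "\<bar>b \<bullet> x\<bar> \<le> h" using h[OF x] h[OF neg[OF x]] by auto
    then have G: "\<bar>G\<bar> \<le> 1" using h1 by (simp add: G_def)
    define u where "u i = (if i then p else q)" for i
    define w where "w i = (if i then (F + G) / 2 else (G - F) / 2)" for i
    have "\<bar>(F + G) / 2\<bar> + \<bar>(G - F) / 2\<bar> \<le> 1"
      using F G by (auto simp: abs_if field_simps split: if_splits)
    then have "(\<Sum>i\<in>UNIV. \<bar>w i\<bar>) \<le> 1" by (simp add: UNIV_bool w_def add.commute)
    then have "(\<Sum>i\<in>UNIV. w i *\<^sub>R u i) \<in> convex hull (range u \<union> range (\<lambda>i. - u i))" by (rule abs_sum_le_one_hull)
    moreover have "range u \<union> range (\<lambda>i. - u i) = set [p, - p, q, - q]" by (auto simp: u_def UNIV_bool)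
    moreover have "(\<Sum>i\<in>UNIV. w i *\<^sub>R u i) = x"
    proof -
      have "(\<Sum>i\<in>UNIV. w i *\<^sub>R u i) = ((F + G) / 2) *\<^sub>R p + ((G - F) / 2) *\<^sub>R q" by (simp add: UNIV_bool u_def w_def add.commute)
      also have "\<dots> = ((F + G) / 2 * (1 - m * h) - (G - F) / 2 * (1 + m * h)) *\<^sub>R e1 + ((F + G) / 2 * h + (G - F) / 2 * h) *\<^sub>R e2"
      proof -
        have "s *\<^sub>R (\<alpha> *\<^sub>R e1 + h *\<^sub>R e2) + t *\<^sub>R ((- \<beta>) *\<^sub>R e1 + h *\<^sub>R e2)
            = (s * \<alpha> - t * \<beta>) *\<^sub>R e1 + (s * h + t * h) *\<^sub>R e2" for s t \<alpha> \<beta> :: real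
          by (simp add: algebra_simps)
        then show ?thesis unfolding p_def q_def .
      qed
      also have "(F + G) / 2 * (1 - m * h) - (G - F) / 2 * (1 + m * h) = F - m * (G * h)" by (simp add: field_simps)
      also have "(F + G) / 2 * h + (G - F) / 2 * h = G * h" by (simp add: field_simps)
      also have "G * h = b \<bullet> x" using h1 by (simp add: G_def)
      also have "F - m * (b \<bullet> x) = a \<bullet> x" by (simp add: F_def fx)
      also have "(a \<bullet> x) *\<^sub>R e1 + (b \<bullet> x) *\<^sub>R e2 = x" using basis[of x] by simp
      finally show ?thesis .
    qed
    ultimately show "x \<in> convex hull (set [p, - p, q, - q])" by simp
  qed
  then have "vein K \<le> (\<Sum>p\<leftarrow>[p, - p, q, - q]. body_norm K p)" by (rule vein_le[OF r(2,1)])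
  also have "\<dots> = 2 * body_norm K p + 2 * body_norm K q" by (simp add: body_norm_minus[OF sym])
  finally show ?thesis using p q by linarith
qed

lemma frontier_support:
  fixes K :: "'a::euclidean_space set"
  assumes K: "symmetric_convex_body K" and x: "x \<in> frontier K"
  obtains f where "f \<bullet> x = 1" "\<And>y. y \<in> K \<Longrightarrow> f \<bullet> y \<le> 1"
proof -
  have cvx: "convex K" and int: "interior K \<noteq> {}" and clK: "closed K"
    using K by (auto simp: symmetric_convex_body_def convex_body_def compact_imp_closed)
  obtain r where r: "0 < r" "cball 0 r \<subseteq> K" using symmetric_convex_body_cball[OF K] .
  have "x \<in> K" "x \<notin> rel_interior K" using x int clK by (auto simp: frontier_def rel_interior_nonempty_interior)
  then obtain a where a: "a \<noteq> 0" "\<And>y. y \<in> K \<Longrightarrow> a \<bullet> x \<le> a \<bullet> y"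
    using supporting_hyperplane_rel_boundary[OF cvx] by metis
  have "(- (r / norm a)) *\<^sub>R a \<in> K" using r a(1) by (intro subsetD[OF r(2)]) auto
  then have "a \<bullet> x \<le> a \<bullet> ((- (r / norm a)) *\<^sub>R a)" by (rule a(2))
  also have "\<dots> < 0" using r a(1) by (simp add: mult_less_0_iff)
  finally have neg: "a \<bullet> x < 0" .
  show thesis
  proof (rule that[of "a /\<^sub>R (a \<bullet> x)"])
    show "(a /\<^sub>R (a \<bullet> x)) \<bullet> x = 1" using neg by simp
    fix y assume "y \<in> K"
    then have "a \<bullet> x \<le> a \<bullet> y" by (rule a(2))
    then show "(a /\<^sub>R (a \<bullet> x)) \<bullet> y \<le> 1" using neg by (simp add: divide_inverse[symmetric] field_simps)
  qed
qed

lemma inscribed_hexagon: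
  fixes K :: "'a::euclidean_space set"
  assumes K: "symmetric_convex_body K" and n: "2 \<le> DIM('a)"
  obtains e1 e2 where "e1 \<in> frontier K" "e2 \<in> frontier K" "e2 - e1 \<in> frontier K"
proof -
  have cpt: "compact K" and cvx: "convex K" and sym: "uminus ` K = K"
    using K by (auto simp: symmetric_convex_body_def convex_body_def)
  have clK: "closed K" using cpt by (rule compact_imp_closed)
  obtain r where r: "0 < r" "cball 0 r \<subseteq> K" using symmetric_convex_body_cball[OF K] .
  have z: "0 \<in> interior K" using r by (auto simp: mem_interior_cball)
  have "K \<noteq> UNIV" using cpt not_bounded_UNIV compact_imp_bounded by blast
  then have "frontier K \<noteq> {}" using z interior_subset by (subst frontier_eq_empty) auto
  then obtain e1 where e1: "e1 \<in> frontier K" by blast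
  obtain f where f: "f \<bullet> e1 = 1" "\<And>y. y \<in> K \<Longrightarrow> f \<bullet> y \<le> 1" using frontier_support[OF K e1] by blast
  have e1K: "e1 \<in> K" using e1 clK by (simp add: frontier_def)
  have neg: "- y \<in> K" if "y \<in> K" for y using that sym by blast
  have ne1: "- e1 \<in> frontier K"
  proof -
    have "- e1 \<notin> interior K"
    proof
      assume "- e1 \<in> interior K"
      then have "- (- e1) \<in> uminus ` interior K" by (rule imageI)
      also have "uminus ` interior K = interior (uminus ` K)" by (rule interior_negations[symmetric])
      finally show False using e1 sym by (simp add: frontier_def)
    qed
    then show ?thesis using neg[OF e1K] closure_subset by (auto simp: frontier_def)
  qed
  \<comment> \<open>On the connected frontier, the translate \<open>x - e1\<close> moves from the interior of the body (at \<open>e1\<close>)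
    to its exterior (at \<open>- e1\<close>).\<close>
  have "connected (- K)" using cpt cvx n by (intro connected_complement_bounded_convex compact_imp_bounded)
  then have conn: "connected (frontier K)" using cvx by (intro connected_frontier_simple[OF convex_connected])
  show thesis
  proof (rule ccontr)
    assume no: "\<not> thesis"
    let ?A = "(\<lambda>x. x - e1) -` interior K" and ?B = "(\<lambda>x. x - e1) -` (- K)"
    have "open ?A" "open ?B" using clK by (auto intro!: open_vimage continuous_intros)
    moreover have "?A \<inter> ?B \<inter> frontier K = {}" using interior_subset by auto
    moreover have "frontier K \<subseteq> ?A \<union> ?B"
      using no that[OF e1] clK by (auto simp: frontier_def)
    moreover have "e1 \<in> ?A \<inter> frontier K" using z e1 by simp
    moreover have "- e1 - e1 \<notin> K" using f(2)[OF neg, of "- e1 - e1"] f(1) by (auto simp: inner_simps)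
    then have "- e1 \<in> ?B \<inter> frontier K" using ne1 by simp
    ultimately show False using conn unfolding connected_def by blast
  qed
qed

lemma vein_le_six:
  fixes K :: "(real^2) set"
  assumes K: "symmetric_convex_body K" shows "vein K \<le> 6"
proof -
  have cpt: "compact K" and sym: "uminus ` K = K"
    using K by (auto simp: symmetric_convex_body_def convex_body_def)
  have clK: "closed K" using cpt by (rule compact_imp_closed)
  have neg: "- y \<in> K" if "y \<in> K" for y using that sym by blast
  obtain r where r: "0 < r" "cball 0 r \<subseteq> K" using symmetric_convex_body_cball[OF K] .
  have z: "0 \<in> interior K" using r by (auto simp: mem_interior_cball)
  obtain e1 e2 where e: "e1 \<in> frontier K" "e2 \<in> frontier K" "e2 - e1 \<in> frontier K"
    using inscribed_hexagon[OF K] by auto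
  have eK: "e1 \<in> K" "e2 \<in> K" "e2 - e1 \<in> K" using e clK by (auto simp: frontier_def)
  obtain f1 where f1: "f1 \<bullet> e1 = 1" "\<And>y. y \<in> K \<Longrightarrow> f1 \<bullet> y \<le> 1" using frontier_support[OF K e(1)] by blast
  obtain f2 where f2: "f2 \<bullet> e2 = 1" "\<And>y. y \<in> K \<Longrightarrow> f2 \<bullet> y \<le> 1" using frontier_support[OF K e(2)] by blast
  obtain f3 where f3: "f3 \<bullet> (e2 - e1) = 1" "\<And>y. y \<in> K \<Longrightarrow> f3 \<bullet> y \<le> 1" using frontier_support[OF K e(3)] by blast
  define D where "D = e1 $ 1 * e2 $ 2 - e1 $ 2 * e2 $ 1"
  \<comment> \<open>On a common line the support functionals would force t = 1 and
    \<open>e2 - e1 = 0\<close>, which is not a boundary point.\<close>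
  have ind: "e2 \<noteq> t *\<^sub>R e1" for t
  proof
    assume t: "e2 = t *\<^sub>R e1"
    have "0 \<le> t" using f1(2)[OF neg[OF eK(3)]] f1(1) t by (simp add: inner_simps)
    have "t \<le> 1" using f1(2)[OF eK(2)] f1(1) t by simp
    have "t * (f2 \<bullet> e1) = 1" using f2(1) t by simp
    moreover have "f2 \<bullet> e1 \<le> 1" using f2(2)[OF eK(1)] .
    then have "t * (f2 \<bullet> e1) \<le> t * 1" using \<open>0 \<le> t\<close> by (intro mult_left_mono)
    ultimately have "t = 1" using \<open>t \<le> 1\<close> by simp
    then show False using t f3(1) by simp
  qed
  have D0: "D \<noteq> 0"
  proof
    assume D: "D = 0"
    have "e1 \<noteq> 0" using f1 by auto
    then consider "e1 $ 1 \<noteq> 0" | "e1 $ 2 \<noteq> 0" by (auto simp: vec_eq_iff forall_2)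
    then show False
    proof cases
      case 1
      then have "e2 = (e2 $ 1 / e1 $ 1) *\<^sub>R e1" using D by (auto simp: vec_eq_iff forall_2 D_def field_simps)
      then show False using ind by blast
    next
      case 2
      then have "e2 = (e2 $ 2 / e1 $ 2) *\<^sub>R e1" using D by (auto simp: vec_eq_iff forall_2 D_def field_simps)
      then show False using ind by blast
    qed
  qed
  define a b where "a = (vector [e2 $ 2 / D, - e2 $ 1 / D] :: real^2)" and "b = (vector [- e1 $ 2 / D, e1 $ 1 / D] :: real^2)"
  have ax: "a \<bullet> x = (x $ 1 * e2 $ 2 - x $ 2 * e2 $ 1) / D" "b \<bullet> x = (e1 $ 1 * x $ 2 - e1 $ 2 * x $ 1) / D" for x :: "real^2"
    using D0 by (auto simp: a_def b_def inner_vec_def sum_2 field_simps)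
  have basis: "x = (a \<bullet> x) *\<^sub>R e1 + (b \<bullet> x) *\<^sub>R e2" for x
  proof -
    have "x $ 1 * D = (x $ 1 * e2 $ 2 - x $ 2 * e2 $ 1) * e1 $ 1 + (e1 $ 1 * x $ 2 - e1 $ 2 * x $ 1) * e2 $ 1"
      "x $ 2 * D = (x $ 1 * e2 $ 2 - x $ 2 * e2 $ 1) * e1 $ 2 + (e1 $ 1 * x $ 2 - e1 $ 2 * x $ 1) * e2 $ 2"
      unfolding D_def by (simp_all add: algebra_simps)
    then show ?thesis using D0 by (simp add: vec_eq_iff forall_2 ax add_divide_distrib[symmetric] eq_divide_eq)
  qed
  have dual: "a \<bullet> e1 = 1" "a \<bullet> e2 = 0" "b \<bullet> e1 = 0" "b \<bullet> e2 = 1" using D0 by (auto simp: ax D_def)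
  \<comment> \<open>Choose the pair of sides of the hexagon beyond which the body reaches least far.\<close>
  have max: "\<exists>c\<in>K. \<forall>x\<in>K. w \<bullet> x \<le> w \<bullet> c" for w :: "real^2"
    using eK(1) by (intro continuous_attains_sup[OF cpt]) (auto intro!: continuous_intros)
  obtain c1 where c1: "c1 \<in> K" "\<And>x. x \<in> K \<Longrightarrow> (a + b) \<bullet> x \<le> (a + b) \<bullet> c1" using max[of "a + b"] by blast
  obtain c2 where c2: "c2 \<in> K" "\<And>x. x \<in> K \<Longrightarrow> b \<bullet> x \<le> b \<bullet> c2" using max[of b] by blast
  obtain c3 where c3: "c3 \<in> K" "\<And>x. x \<in> K \<Longrightarrow> (- a) \<bullet> x \<le> (- a) \<bullet> c3" using max[of "- a"] by blast
  consider "b \<bullet> c2 \<le> (a + b) \<bullet> c1" "b \<bullet> c2 \<le> (- a) \<bullet> c3"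
    | "(a + b) \<bullet> c1 \<le> b \<bullet> c2" "(a + b) \<bullet> c1 \<le> (- a) \<bullet> c3"
    | "(- a) \<bullet> c3 \<le> (a + b) \<bullet> c1" "(- a) \<bullet> c3 \<le> b \<bullet> c2" by linarith
  then show ?thesis
  proof cases
    case 1
    show ?thesis
      by (rule vein_le_six_hexagon[OF K eK basis dual f1 c2(2) c1(1) _ c3(1)]) (use 1 in \<open>auto simp: inner_simps\<close>)
  next
    \<comment> \<open>The linear rotation of the hexagon taking \<open>e1\<close>, \<open>e2\<close>
      to \<open>e1 - e2\<close>, \<open>e1\<close> permutes the functionals b, a + b, - a up to sign
      and moves the chosen pair of sides to the direction b. The third case uses the inverse
      rotation.\<close>
    case 2
    show ?thesis
    proof (rule vein_le_six_hexagon[OF K, where ?e1.0 = "e1 - e2" and ?e2.0 = e1 and a = "- b" and b = "a + b" and f = "- f3"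
          and h = "(a + b) \<bullet> c1" and c = "- c3" and d = c2])
      show "e1 - e2 \<in> K" using neg[OF eK(3)] by simp
      show "x = (- b \<bullet> x) *\<^sub>R (e1 - e2) + ((a + b) \<bullet> x) *\<^sub>R e1" for x
        by (subst (1) basis[of x]) (simp add: inner_simps algebra_simps)
      show "- f3 \<bullet> x \<le> 1" if "x \<in> K" for x using f3(2)[OF neg[OF that]] by simp
    qed (use 2 eK c1 c2 neg[OF c3(1)] dual f3(1) in \<open>auto simp: inner_simps\<close>)
  next
    case 3
    show ?thesis
    proof (rule vein_le_six_hexagon[OF K, where ?e1.0 = e2 and ?e2.0 = "e2 - e1" and a = "a + b" and b = "- a" and f = f2
          and h = "(- a) \<bullet> c3" and c = c2 and d = "- c1"])
      show "x = ((a + b) \<bullet> x) *\<^sub>R e2 + (- a \<bullet> x) *\<^sub>R (e2 - e1)" for x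
        by (subst (1) basis[of x]) (simp add: inner_simps algebra_simps)
      show "- a \<bullet> x \<le> - a \<bullet> c3" if "x \<in> K" for x using c3(2)[OF that] .
      show "e2 - e1 - e2 \<in> K" using neg[OF eK(1)] by simp
    qed (use 3 eK c2 neg[OF c1(1)] dual f2 in \<open>auto simp: inner_simps\<close>)
  qed
qed

section \<open>Solid angles\<close>

text \<open>For a cone this is its solid angle as a fraction of the full sphere. The sort of the index type is
  the one demanded by the library's change of variables for orthogonal maps.\<close>

definition ball_frac :: "(real^'n::{finite,wellorder}) set \<Rightarrow> real" where
  "ball_frac S = measure lebesgue (S \<inter> ball 0 1) / measure lebesgue (ball 0 1 :: (real^'n::{finite,wellorder}) set)"

lemma lmeasurable_Int_ball:
  fixes S :: "(real^'n::{finite,wellorder}) set"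
  assumes "closed S" shows "S \<inter> ball 0 1 \<in> lmeasurable"
  using assms by (intro bounded_set_imp_lmeasurable) (auto intro: bounded_subset[OF bounded_ball])

lemma ball_frac_nonneg: "0 \<le> ball_frac S"
  unfolding ball_frac_def by simp

lemma ball_frac_UNIV: "ball_frac (UNIV :: (real^'n::{finite,wellorder}) set) = 1"
  unfolding ball_frac_def using content_ball_pos[of 1 "0::real^'n::_"] by simp

lemma ball_frac_mono:
  assumes "closed S" "closed T" "S \<subseteq> T" shows "ball_frac S \<le> ball_frac T"
  unfolding ball_frac_def using assms lmeasurable_Int_ball
  by (intro divide_right_mono measure_mono_fmeasurable) (auto intro: fmeasurableD)

lemma ball_frac_UN_le:
  assumes "finite I" "\<And>i. i \<in> I \<Longrightarrow> closed (S i)"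
  shows "ball_frac (\<Union>i\<in>I. S i) \<le> (\<Sum>i\<in>I. ball_frac (S i))"
proof -
  have "measure lebesgue (\<Union>i\<in>I. S i \<inter> ball 0 1) \<le> (\<Sum>i\<in>I. measure lebesgue (S i \<inter> ball 0 1))"
    using assms lmeasurable_Int_ball by (intro measure_UNION_le) auto
  then show ?thesis
    unfolding ball_frac_def sum_divide_distrib[symmetric]
    by (intro divide_right_mono) (auto simp: Int_UN_distrib2)
qed

lemma ball_frac_negligible: "negligible S \<Longrightarrow> ball_frac S = 0"
  unfolding ball_frac_def by (metis div_0 inf_le1 negligible_iff_measure negligible_subset)

lemma ball_frac_split:
  fixes S :: "(real^'n::{finite,wellorder}) set"
  assumes "closed S" "c \<noteq> 0"
  shows "ball_frac S = ball_frac (S \<inter> {x. 0 \<le> c \<bullet> x}) + ball_frac (S \<inter> {x. c \<bullet> x \<le> 0})"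
proof -
  let ?A = "S \<inter> {x. 0 \<le> c \<bullet> x} \<inter> ball 0 1" and ?B = "S \<inter> {x. c \<bullet> x \<le> 0} \<inter> ball 0 1"
  have cl: "closed (S \<inter> {x. 0 \<le> c \<bullet> x})" "closed (S \<inter> {x. c \<bullet> x \<le> 0})"
    using assms closed_halfspace_ge[of 0 c] closed_halfspace_le[of c 0] by (auto intro: closed_Int)
  have "negligible (?A \<inter> ?B)"
    using assms(2) by (intro negligible_subset[OF negligible_hyperplane[of c 0]]) auto
  then have "measure lebesgue (?A \<union> ?B) = measure lebesgue ?A + measure lebesgue ?B"
    by (subst measure_Un3) (use cl lmeasurable_Int_ball in \<open>auto dest: negligible_imp_measure0\<close>)
  moreover have "?A \<union> ?B = S \<inter> ball 0 1" by auto
  ultimately show ?thesis unfolding ball_frac_def by (simp add: add_divide_distrib)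
qed

lemma ball_frac_orthogonal:
  fixes f :: "real^'n::{finite,wellorder} \<Rightarrow> real^'n::_"
  assumes "orthogonal_transformation f" "closed S"
  shows "ball_frac (f ` S) = ball_frac S"
proof -
  have "f ` (S \<inter> ball 0 1) = f ` S \<inter> ball 0 1"
    using image_orthogonal_transformation_ball[OF assms(1), of 0 1] image_Int[OF orthogonal_transformation_inj[OF assms(1)]]
      linear_0[OF orthogonal_transformation_linear[OF assms(1)]] by simp
  then show ?thesis unfolding ball_frac_def
    using measure_orthogonal_image[OF assms(1) lmeasurable_Int_ball[OF assms(2)]] by simp
qed

section \<open>Orthogonal maps and the measure of wedges\<close>

lemma orthogonal_transformation_inner:
  "orthogonal_transformation f \<Longrightarrow> f x \<bullet> f y = x \<bullet> y"
  by (simp add: orthogonal_transformation_def)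

text \<open>The Householder reflection in the hyperplane orthogonal to \<open>v\<close>; division by
  zero makes it the identity for v = 0, so \<open>reflect_diff\<close> includes the case a =
  b.\<close>

definition reflect :: "'a::real_inner \<Rightarrow> 'a \<Rightarrow> 'a" where
  "reflect v x = x - (2 * (v \<bullet> x) / (v \<bullet> v)) *\<^sub>R v"

lemma reflect_orthogonal: "orthogonal_transformation (reflect v)"
proof (cases "v = 0")
  case True
  then have "reflect v = (\<lambda>x. x)" by (auto simp: reflect_def)
  then show ?thesis by simp
next
  case False
  then have "v \<bullet> v \<noteq> 0" by simp
  then have "reflect v x \<bullet> reflect v y = x \<bullet> y" for x y
    unfolding reflect_def by (simp add: inner_simps inner_commute field_simps)
  moreover have "linear (reflect v)"
    by (rule linearI) (auto simp: reflect_def algebra_simps add_divide_distrib)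
  ultimately show ?thesis by (simp add: orthogonal_transformation_def)
qed

lemma reflect_diff:
  assumes "norm a = norm b" shows "reflect (a - b) a = b"
proof (cases "a = b")
  case False
  then have "(a - b) \<bullet> (a - b) \<noteq> 0" by simp
  moreover have "2 * ((a - b) \<bullet> a) = (a - b) \<bullet> (a - b)"
    using assms by (simp add: inner_simps inner_commute norm_eq_sqrt_inner)
  ultimately show ?thesis by (simp add: reflect_def)
qed (simp add: reflect_def)

text \<open>A first reflection takes a to a'. The second takes the image of b to b'; its mirror
  normal \<open>g b - b'\<close> is orthogonal to a', because both vectors have the same inner
  product with a', so a' stays fixed.\<close>

lemma orthogonal_pair_exists:
  fixes a b a' b' :: "'a::real_inner"
  assumes "norm a = norm a'" "norm b = norm b'" "a \<bullet> b = a' \<bullet> b'"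
  obtains f where "orthogonal_transformation f" "f a = a'" "f b = b'"
proof -
  define g where "g = reflect (a - a')"
  define h where "h = reflect (g b - b')"
  have g: "orthogonal_transformation g" "g a = a'"
    using reflect_orthogonal reflect_diff assms by (auto simp: g_def)
  have nb: "norm (g b) = norm b'"
    using g assms orthogonal_transformation_norm by metis
  have h: "orthogonal_transformation h" "h (g b) = b'"
    using reflect_orthogonal reflect_diff nb by (auto simp: h_def)
  have "g a \<bullet> g b = a' \<bullet> b'"
    using orthogonal_transformation_inner g assms by metis
  then have "h a' = a'"
    unfolding h_def reflect_def using g by (simp add: inner_simps inner_commute)
  then show ?thesis
    using that[of "h \<circ> g"] orthogonal_transformation_compose[OF h(1) g(1)] g h by auto
qed

definition wedge :: "'a::real_inner \<Rightarrow> 'a \<Rightarrow> 'a set" where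
  "wedge a b = {x. 0 \<le> a \<bullet> x} \<inter> {x. 0 \<le> b \<bullet> x}"

lemma closed_wedge: "closed (wedge a b)"
  unfolding wedge_def using closed_halfspace_ge[of 0 a] closed_halfspace_ge[of 0 b] by (auto intro: closed_Int)

lemma wedge_orthogonal:
  assumes "orthogonal_transformation (f::'a::euclidean_space\<Rightarrow>'a)" shows "f ` wedge a b = wedge (f a) (f b)"
proof -
  have "x \<in> f ` wedge a b" if "x \<in> wedge (f a) (f b)" for x
  proof -
    obtain y where "x = f y" using orthogonal_transformation_surj[OF assms] by (metis surjD)
    then show ?thesis using that assms by (auto simp: wedge_def orthogonal_transformation_inner)
  qed
  then show ?thesis using assms by (auto simp: wedge_def orthogonal_transformation_inner)
qed

lemma ball_frac_wedge_cong:
  fixes a b a' b' :: "real^'n::{finite,wellorder}"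
  assumes "norm a = norm a'" "norm b = norm b'" "a \<bullet> b = a' \<bullet> b'"
  shows "ball_frac (wedge a b) = ball_frac (wedge a' b')"
proof -
  obtain f where "orthogonal_transformation f" "f a = a'" "f b = b'"
    using orthogonal_pair_exists[OF assms] .
  then show ?thesis using ball_frac_orthogonal[OF _ closed_wedge] wedge_orthogonal by metis
qed

text \<open>Cauchy's equation on an interval, with nonnegativity in place of continuity: it makes f
  monotone, and squeezing x between adjacent multiples of a / n leaves an error of at most f a /
  n.\<close>

lemma additive_nonneg_linear:
  fixes f :: "real \<Rightarrow> real"
  assumes a: "a > 0"
    and add: "\<And>x y. x > 0 \<Longrightarrow> y > 0 \<Longrightarrow> x + y \<le> a \<Longrightarrow> f (x + y) = f x + f y"
    and nn: "\<And>x. 0 \<le> f x" and x: "0 < x" "x \<le> a"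
  shows "f x = x * f a / a"
proof -
  have mono: "f u \<le> f v" if "0 < u" "u \<le> v" "v \<le> a" for u v
    using add[of u "v - u"] nn[of "v - u"] that by (cases "u = v") auto
  have mult: "f (real k * t) = real k * f t" if "k \<ge> 1" "t > 0" "real k * t \<le> a" for k t
    using that
  proof (induction k rule: nat_induct_at_least)
    case (Suc k)
    have "k * t \<le> a" "0 < k * t" using Suc by (auto simp: algebra_simps)
    then show ?case using Suc add[of "k * t" t] by (simp add: algebra_simps)
  qed simp
  have bound: "\<bar>f x - x * f a / a\<bar> \<le> f a / real n" if n: "n \<ge> 1" for n :: nat
  proof -
    have fan: "f (a / n) = f a / n" using mult[of n "a / n"] n a by simp
    have fk: "f (k * (a / n)) = k * f a / n" if "k \<ge> 1" "k \<le> n" for k :: nat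
    proof -
      have "real k * (a / n) \<le> n * (a / n)" using that a n by (intro mult_right_mono) auto
      then show ?thesis using mult[of k "a / n"] fan that a n by simp
    qed
    define k where "k = nat \<lfloor>n * x / a\<rfloor>"
    have nx: "0 \<le> n * x / a" using a x n by simp
    have k: "real k \<le> n * x / a" "n * x / a < real k + 1"
      using nx unfolding k_def by linarith+
    have kx: "k * (a / n) \<le> x" "x < (k + 1) * (a / n)"
      using k n a by (auto simp: field_simps)
    have "n * x / a \<le> n" using x a n by (simp add: field_simps)
    then have kn: "k \<le> n" using k(1) by linarith
    have "k * f a / n \<le> f x"
    proof (cases "k = 0")
      case False
      then show ?thesis using fk[of k] mono[of "k * (a / n)" x] kx x a n kn by simp
    qed (use nn in simp)
    moreover have "f x \<le> (k + 1) * f a / n"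
    proof (cases "k = n")
      case True
      then show ?thesis using kx x mono[of x a] n a nn[of a]
        by (simp add: divide_right_mono field_simps)
    next
      case False
      then have "real (k+1) * (a / n) \<le> n * (a / n)" using kn a n by (intro mult_right_mono) auto
      then show ?thesis using fk[of "k+1"] mono[of x "(k+1) * (a / n)"] kx x a n kn False by simp
    qed
    moreover have "k * f a / n \<le> x * f a / a" "x * f a / a \<le> (k + 1) * f a / n"
      using mult_right_mono[OF k(1) nn[of a]] mult_right_mono[OF less_imp_le[OF k(2)] nn[of a]] a n
      by (auto simp: field_simps)
    ultimately show ?thesis by (auto simp: abs_le_iff add_divide_distrib distrib_right)
  qed
  have "(\<lambda>n. f a / real n) \<longlonglongrightarrow> 0" by (rule lim_const_over_n)
  then have "\<bar>f x - x * f a / a\<bar> \<le> 0"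
    by (rule Lim_bounded2[where N=1]) (use bound in auto)
  then show ?thesis by simp
qed

lemma ball_frac_halfspace:
  fixes a :: "real^'n::{finite,wellorder}" assumes "a \<noteq> 0"
  shows "ball_frac {x. 0 \<le> a \<bullet> x} = 1/2"
proof -
  have "ball_frac ((\<lambda>x. - x) ` {x. 0 \<le> a \<bullet> x}) = ball_frac {x. 0 \<le> a \<bullet> x}"
    by (intro ball_frac_orthogonal) (auto intro: closed_halfspace_ge simp: linear_iff orthogonal_transformation_def)
  moreover have "(\<lambda>x. - x) ` {x. 0 \<le> a \<bullet> x} = {x. a \<bullet> x \<le> 0}"
    by (auto simp: image_iff) (metis add.inverse_inverse inner_minus_right neg_0_le_iff_le)
  ultimately show ?thesis using ball_frac_split[of UNIV a] assms ball_frac_UNIV[where ?'n = 'n] by simp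
qed

text \<open>The measure of a wedge is a nonnegative additive function of its angle, hence linear.\<close>

lemma ball_frac_wedge:
  fixes a b :: "real^'n::{finite,wellorder}"
  assumes "norm a = 1" "norm b = 1" "CARD('n) \<ge> 2"
  shows "ball_frac (wedge a b) = (pi - arccos (a \<bullet> b)) / (2 * pi)"
proof -
  obtain i j :: "'n::_" where ij: "i \<noteq> j"
    using assms(3) card_le_Suc0_iff_eq[of "UNIV :: 'n::_ set"] by fastforce
  define e f :: "real^'n::_" where "e = axis i 1" and "f = axis j 1"
  have ef: "e \<bullet> e = 1" "f \<bullet> f = 1" "e \<bullet> f = 0" "f \<bullet> e = 0"
    using ij by (auto simp: e_def f_def inner_axis_axis)
  \<comment> \<open>\<open>N t\<close> is the normal for which the wedge of \<open>- N 0\<close> and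
    \<open>N t\<close> consists, in the plane of e and f, of the directions with angle between 0 and
    t.\<close>
  define N where "N t = (sin t) *\<^sub>R e - (cos t) *\<^sub>R f" for t
  have NN: "N s \<bullet> N t = cos (s - t)" for s t
    by (simp add: N_def inner_simps ef cos_diff algebra_simps)
  have nN: "norm (N t) = 1" for t by (simp add: norm_eq_sqrt_inner NN)
  define g where "g t = ball_frac (wedge (- N 0) (N t))" for t
  have g0: "ball_frac (wedge (- N s) (N t)) = g (t - s)" for s t
    unfolding g_def by (rule ball_frac_wedge_cong) (simp_all add: nN NN cos_diff)
  have gadd: "g (s + t) = g s + g t" if "0 < s" "0 < t" "s + t \<le> pi" for s t
  proof -
    have id: "sin s * (N (s + t) \<bullet> x) = sin (s + t) * (N s \<bullet> x) - sin t * (N 0 \<bullet> x)" for x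
    proof -
      have *: "sin s * sin (s+t) = sin (s+t) * sin s" "sin s * cos (s+t) = sin (s+t) * cos s - sin t"
      proof -
        have "sin t = sin ((s+t) - s)" by simp
        then show "sin s * cos (s+t) = sin (s+t) * cos s - sin t"
          by (simp only: sin_diff) (simp add: algebra_simps)
      qed simp
      have "sin s * (N (s + t) \<bullet> x) = (sin s * sin (s+t)) * (e \<bullet> x) - (sin s * cos (s+t)) * (f \<bullet> x)"
        by (simp add: N_def inner_simps algebra_simps)
      also have "\<dots> = sin (s + t) * (N s \<bullet> x) - sin t * (N 0 \<bullet> x)"
        unfolding * by (simp add: N_def inner_simps algebra_simps)
      finally show ?thesis .
    qed
    have pos: "sin s > 0" "sin t > 0" "sin (s+t) \<ge> 0"
      using that by (auto intro!: sin_gt_zero sin_ge_zero)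
    have "wedge (- N 0) (N (s+t)) \<inter> {x. 0 \<le> N s \<bullet> x} = wedge (- N 0) (N s)"
    proof -
      have "0 \<le> N (s+t) \<bullet> x" if "N 0 \<bullet> x \<le> 0" "0 \<le> N s \<bullet> x" for x
      proof -
        have "0 \<le> sin s * (N (s + t) \<bullet> x)" unfolding id using pos that
          by (smt (verit) mult_nonneg_nonneg mult_nonneg_nonpos)
        then show ?thesis using pos by (simp add: zero_le_mult_iff)
      qed
      then show ?thesis by (auto simp: wedge_def)
    qed
    moreover have "wedge (- N 0) (N (s+t)) \<inter> {x. N s \<bullet> x \<le> 0} = wedge (- N s) (N (s+t))"
    proof -
      have "N 0 \<bullet> x \<le> 0" if "N s \<bullet> x \<le> 0" "0 \<le> N (s+t) \<bullet> x" for x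
      proof -
        have "sin t * (N 0 \<bullet> x) \<le> 0" using id[of x] pos that
          by (smt (verit) mult_nonneg_nonneg mult_nonneg_nonpos)
        then show ?thesis using pos by (simp add: mult_le_0_iff)
      qed
      then show ?thesis by (auto simp: wedge_def)
    qed
    moreover have "N s \<noteq> 0" using nN[of s] by auto
    ultimately show ?thesis
      using ball_frac_split[OF closed_wedge, of "N s" "- N 0" "N (s+t)"] g0[of s "s+t"] g_def by simp
  qed
  have gpi: "g pi = 1/2"
  proof -
    have "- N 0 = N pi" by (simp add: N_def)
    moreover have "N pi \<noteq> 0" using nN[of pi] by auto
    ultimately show ?thesis unfolding g_def wedge_def by (simp add: ball_frac_halfspace)
  qed
  have g: "g t = t / (2 * pi)" if "0 < t" "t \<le> pi" for t
  proof -
    have "g t = t * g pi / pi"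
      by (rule additive_nonneg_linear[OF pi_gt_zero gadd _ that]) (auto simp: g_def ball_frac_nonneg)
    then show ?thesis by (simp add: gpi)
  qed
  have ab: "\<bar>a \<bullet> b\<bar> \<le> 1" using Cauchy_Schwarz_ineq2[of a b] assms by simp
  show ?thesis
  \<comment> \<open>For opposite normals the wedge collapses into a hyperplane; its angle 0 is
    outside the range in which g was determined.\<close>
  proof (cases "a \<bullet> b = -1")
    case True
    then have "(a + b) \<bullet> (a + b) = 0" using assms
      by (simp add: inner_simps inner_commute norm_eq_1)
    then have "b = - a" by (simp add: add_eq_0_iff)
    then have "wedge a b \<subseteq> {x. a \<bullet> x = 0}" by (auto simp: wedge_def)
    moreover have "a \<noteq> 0" using assms by auto
    ultimately have "negligible (wedge a b)" using negligible_hyperplane[of a 0] negligible_subset by blast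
    then show ?thesis using True by (simp add: ball_frac_negligible)
  next
    case False
    define t where "t = pi - arccos (a \<bullet> b)"
    have "arccos (a \<bullet> b) < pi"
    proof -
      have "arccos (a \<bullet> b) < arccos (-1)" using ab False by (subst arccos_less_mono) auto
      then show ?thesis by simp
    qed
    then have t: "0 < t" "t \<le> pi" using ab arccos_lbound[of "a \<bullet> b"] by (auto simp: t_def)
    have "ball_frac (wedge a b) = g t"
      unfolding g_def by (rule ball_frac_wedge_cong) (use ab in \<open>auto simp: nN NN assms t_def\<close>)
    then show ?thesis using g[OF t] by (simp add: t_def)
  qed
qed

text \<open>Girard's formula, by inclusion-exclusion and central symmetry.\<close>

lemma ball_frac_triple:
  fixes a b c :: "real^'n::{finite,wellorder}"
  assumes "a \<noteq> 0" "b \<noteq> 0" "c \<noteq> 0"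
  shows "2 * ball_frac (wedge a b \<inter> {x. 0 \<le> c \<bullet> x}) =
    ball_frac (wedge a b) + ball_frac (wedge b c) + ball_frac (wedge a c) - 1/2"
proof -
  let ?H = "\<lambda>v. {x. 0 \<le> v \<bullet> x}" and ?G = "\<lambda>v. {x. v \<bullet> x \<le> 0}"
  have cl: "closed (?H v)" "closed (?G v)" for v :: "real^'n::_"
    by (auto intro: closed_halfspace_ge closed_halfspace_le)
  have neg: "ball_frac (?H a \<inter> ?G b \<inter> ?G c) = ball_frac (?G a \<inter> ?H b \<inter> ?H c)"
  proof -
    have "orthogonal_transformation (\<lambda>x::real^'n::_. - x)" by (auto simp: linear_iff orthogonal_transformation_def)
    moreover have "uminus ` (?H a \<inter> ?G b \<inter> ?G c) = ?G a \<inter> ?H b \<inter> ?H c"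
    proof (intro equalityI subsetI)
      fix x assume "x \<in> ?G a \<inter> ?H b \<inter> ?H c"
      then show "x \<in> uminus ` (?H a \<inter> ?G b \<inter> ?G c)" by (intro image_eqI[of _ _ "- x"]) auto
    qed auto
    ultimately show ?thesis
      by (metis ball_frac_orthogonal cl closed_Int)
  qed
  have "ball_frac (?H a) = ball_frac (?H a \<inter> ?H b) + ball_frac (?H a \<inter> ?G b)"
    using assms cl by (intro ball_frac_split) auto
  moreover have "ball_frac (?H a \<inter> ?G b) = ball_frac (?H a \<inter> ?G b \<inter> ?H c) + ball_frac (?H a \<inter> ?G b \<inter> ?G c)"
    using assms cl by (intro ball_frac_split) auto
  moreover have "ball_frac (?H b \<inter> ?H c) = ball_frac (?H b \<inter> ?H c \<inter> ?H a) + ball_frac (?H b \<inter> ?H c \<inter> ?G a)"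
    using assms cl by (intro ball_frac_split) auto
  moreover have "ball_frac (?H a \<inter> ?H c) = ball_frac (?H a \<inter> ?H c \<inter> ?H b) + ball_frac (?H a \<inter> ?H c \<inter> ?G b)"
    using assms cl by (intro ball_frac_split) auto
  moreover have "?H b \<inter> ?H c \<inter> ?H a = ?H a \<inter> ?H b \<inter> ?H c" "?H b \<inter> ?H c \<inter> ?G a = ?G a \<inter> ?H b \<inter> ?H c"
    "?H a \<inter> ?H c \<inter> ?H b = ?H a \<inter> ?H b \<inter> ?H c" "?H a \<inter> ?H c \<inter> ?G b = ?H a \<inter> ?G b \<inter> ?H c" by auto
  ultimately show ?thesis
    unfolding wedge_def using neg ball_frac_halfspace[OF assms(1)] by simp
qed

section \<open>Spherical triangles and polyhedral cones in space\<close>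

unbundle cross3_syntax

lemma orthogonal_to_pair:
  fixes x m a :: "real^3"
  assumes "x \<bullet> m = 0" "x \<bullet> a = 0" "m \<times> a \<noteq> 0"
  obtains c where "x = c *\<^sub>R (m \<times> a)"
proof -
  have "x \<times> (m \<times> a) = 0" using assms Lagrange[of x m a] by simp
  then have "collinear {0, m \<times> a, x}" by (metis cross_eq_0 cross_skew neg_0_equal_iff_equal)
  then show ?thesis using that assms(3) by (auto simp: collinear_lemma)
qed

lemma orthonormal_expansion:
  fixes m e f x :: "real^3"
  assumes "norm m = 1" "norm e = 1" "norm f = 1" "m \<bullet> e = 0" "m \<bullet> f = 0" "e \<bullet> f = 0"
  shows "x = (m \<bullet> x) *\<^sub>R m + (e \<bullet> x) *\<^sub>R e + (f \<bullet> x) *\<^sub>R f"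
proof -
  have u: "m \<bullet> m = 1" "e \<bullet> e = 1" "f \<bullet> f = 1" using assms by (auto simp: norm_eq_1)
  have "(norm (m \<times> e))\<^sup>2 = 1" using norm_cross[of m e] assms by simp
  then have ne: "m \<times> e \<noteq> 0" by auto
  define x' where "x' = x - ((m \<bullet> x) *\<^sub>R m + (e \<bullet> x) *\<^sub>R e + (f \<bullet> x) *\<^sub>R f)"
  have x': "x' \<bullet> m = 0" "x' \<bullet> e = 0" "x' \<bullet> f = 0"
    using assms u by (auto simp: x'_def inner_simps inner_commute)
  obtain c where c: "x' = c *\<^sub>R (m \<times> e)" using orthogonal_to_pair x' ne by metis
  obtain d where d: "f = d *\<^sub>R (m \<times> e)" using orthogonal_to_pair[of f m e] assms ne by (metis inner_commute)
  have "d \<noteq> 0" using d assms by auto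
  then have "x' = (c / d) *\<^sub>R f" using c d by simp
  then have "c / d = 0" using x' u by auto
  then have "x' = 0" using \<open>x' = (c / d) *\<^sub>R f\<close> by simp
  then show ?thesis by (simp add: x'_def)
qed

text \<open>Area of a right spherical triangle with hypotenuse arccos (1 / R) and one angle \<eta>:
  by Napier's rule the other oblique angle is pi/2 - arctan (tan \<eta> / R), so this is the amount
  by which the angle sum exceeds pi.\<close>

definition excess :: "real \<Rightarrow> real \<Rightarrow> real" where
  "excess R \<eta> = \<eta> - arctan (tan \<eta> / R)"

text \<open>The second set is an isosceles spherical triangle with apex \<open>m\<close> and apex angle \<open>2 * \<eta>\<close> whose other
  two vertices are at angular distance \<open>arccos (1 / R)\<close> from \<open>m\<close>; its area on the unit sphere is
  \<open>2 * excess R \<eta>\<close>.\<close>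

lemma ball_frac_isosceles:
  fixes m e f :: "real^3"
  assumes on: "norm m = 1" "norm e = 1" "norm f = 1" "m \<bullet> e = 0" "m \<bullet> f = 0" "e \<bullet> f = 0"
    and eta: "0 < \<eta>" "\<eta> < pi/2" and rho: "R \<ge> 1"
  shows "ball_frac (wedge (sin \<eta> *\<^sub>R e + cos \<eta> *\<^sub>R f) (sin \<eta> *\<^sub>R e - cos \<eta> *\<^sub>R f)) = \<eta> / pi"
    and "ball_frac (wedge (sin \<eta> *\<^sub>R e + cos \<eta> *\<^sub>R f) (sin \<eta> *\<^sub>R e - cos \<eta> *\<^sub>R f)
      \<inter> {x. 0 \<le> ((sqrt (R\<^sup>2 - 1) * cos \<eta>) *\<^sub>R m - e) \<bullet> x}) = excess R \<eta> / (2 * pi)"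
proof -
  define r where "r = sqrt (R\<^sup>2 - 1)"
  have r: "r\<^sup>2 = R\<^sup>2 - 1" using rho by (simp add: r_def)
  have u: "m \<bullet> m = 1" "e \<bullet> e = 1" "f \<bullet> f = 1" "e \<bullet> m = 0" "f \<bullet> m = 0" "f \<bullet> e = 0"
    using on by (auto simp: norm_eq_1 inner_commute)
  define D where "D = sqrt (1 + r\<^sup>2 * (cos \<eta>)\<^sup>2)"
  have D0: "D > 0" by (simp add: D_def add_pos_nonneg)
  have D2: "D\<^sup>2 = 1 + r\<^sup>2 * (cos \<eta>)\<^sup>2" by (simp add: D_def)
  \<comment> \<open>\<open>?N1\<close> and \<open>?N2\<close> are the inner normals of the sides
    through \<open>m\<close>. \<open>?M\<close> is orthogonal to the base vertices m + r (cos \<eta>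
    e + sin \<eta> f) and m + r (cos \<eta> e - sin \<eta> f), both of norm R.\<close>
  let ?N1 = "sin \<eta> *\<^sub>R e + cos \<eta> *\<^sub>R f" and ?N2 = "sin \<eta> *\<^sub>R e - cos \<eta> *\<^sub>R f"
    and ?M = "(r * cos \<eta>) *\<^sub>R m - e"
  define N3 where "N3 = (1 / D) *\<^sub>R ?M"
  have sc: "sin \<eta> > 0" "cos \<eta> > 0" using eta by (auto intro: sin_gt_zero2 cos_gt_zero)
  have n: "norm ?N1 = 1" "norm ?N2 = 1" "norm N3 = 1"
  proof -
    have "?N1 \<bullet> ?N1 = (sin \<eta>)\<^sup>2 + (cos \<eta>)\<^sup>2" "?N2 \<bullet> ?N2 = (sin \<eta>)\<^sup>2 + (cos \<eta>)\<^sup>2"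
      by (auto simp: inner_simps u on power2_eq_square)
    then show "norm ?N1 = 1" "norm ?N2 = 1" by (simp_all add: norm_eq_1)
    have "N3 \<bullet> N3 = (1 + r\<^sup>2 * (cos \<eta>)\<^sup>2) / D\<^sup>2"
      using D0 by (simp add: N3_def inner_simps u on field_simps power2_eq_square)
    then have "N3 \<bullet> N3 = 1" unfolding D2[symmetric] using D0 by simp
    then show "norm N3 = 1" by (simp add: norm_eq_1)
  qed
  have ip: "?N1 \<bullet> ?N2 = - cos (2 * \<eta>)" "?N1 \<bullet> N3 = - (sin \<eta> / D)" "?N2 \<bullet> N3 = - (sin \<eta> / D)"
    by (auto simp: N3_def inner_simps u on cos_double power2_eq_square)
  have sD: "0 \<le> sin \<eta> / D" "sin \<eta> / D \<le> 1"
  proof -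
    have "(sin \<eta>)\<^sup>2 \<le> D\<^sup>2" unfolding D2 using sin_le_one[of \<eta>] sc by (simp add: power_le_one add_increasing2)
    then have "sin \<eta> \<le> D" using D0 by (auto intro: power2_le_imp_le)
    then show "sin \<eta> / D \<le> 1" using D0 by simp
  qed (use D0 sc in simp)
  have beta: "arccos (sin \<eta> / D) = pi/2 - arctan (tan \<eta> / R)"
  proof -
    define t where "t = arctan (tan \<eta> / R)"
    have tn: "tan \<eta> > 0" using eta by (rule tan_gt_zero)
    have t: "0 < t" "t < pi/2" using tn rho arctan_ubound by (auto simp: t_def zero_less_arctan_iff)
    have "sin t = (tan \<eta> / R) / sqrt (1 + (tan \<eta> / R)\<^sup>2)" unfolding t_def by (rule sin_arctan)
    also have "sqrt (1 + (tan \<eta> / R)\<^sup>2) = D / (R * cos \<eta>)"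
    proof (rule real_sqrt_unique)
      have "(sin \<eta>)\<^sup>2 = 1 - (cos \<eta>)\<^sup>2" by (simp add: sin_squared_eq)
      then show "(D / (R * cos \<eta>))\<^sup>2 = 1 + (tan \<eta> / R)\<^sup>2"
        using sc rho unfolding power_divide D2 r tan_def
        by (simp add: field_simps power_mult_distrib)
    qed (use D0 sc rho in simp)
    also have "(tan \<eta> / R) / (D / (R * cos \<eta>)) = sin \<eta> / D"
      using sc rho D0 by (simp add: tan_def)
    finally have "sin \<eta> / D = cos (pi/2 - t)" by (simp add: cos_diff)
    moreover have "arccos (cos (pi/2 - t)) = pi/2 - t" using t by (intro arccos_cos) linarith+
    ultimately show ?thesis by (simp add: t_def)
  qed
  have w3: "ball_frac (wedge v N3) = (pi/2 - arctan (tan \<eta> / R)) / (2 * pi)"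
    if "norm v = 1" "v \<bullet> N3 = - (sin \<eta> / D)" for v
    using that n sD by (simp add: ball_frac_wedge arccos_minus beta)
  have "arccos (- cos (2 * \<eta>)) = pi - 2 * \<eta>" using eta by (simp add: arccos_minus arccos_cos)
  then have w2: "ball_frac (wedge ?N1 ?N2) = \<eta> / pi"
    using n ip by (simp add: ball_frac_wedge)
  then show "ball_frac (wedge ?N1 ?N2) = \<eta> / pi" .
  have "{x. 0 \<le> ?M \<bullet> x} = {x. 0 \<le> N3 \<bullet> x}"
    using D0 by (auto simp: N3_def zero_le_divide_iff)
  moreover have "2 * ball_frac (wedge ?N1 ?N2 \<inter> {x. 0 \<le> N3 \<bullet> x}) = \<eta> / pi + (pi/2 - arctan (tan \<eta> / R)) / pi - 1/2"
    using n w2 w3 ip by (subst ball_frac_triple) (auto simp: norm_zero)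
  ultimately show "ball_frac (wedge ?N1 ?N2 \<inter> {x. 0 \<le> ((sqrt (R\<^sup>2 - 1) * cos \<eta>) *\<^sub>R m - e) \<bullet> x})
      = excess R \<eta> / (2 * pi)"
    unfolding r_def[symmetric] by (simp add: excess_def field_simps)
qed

text \<open>The slice of the planar cone by \<open>x \<bullet> a = -1\<close> is a compact segment
  on a line of direction \<open>m \<times> a\<close>; its end points generate the cone.\<close>

lemma planar_cone_generators:
  fixes m a :: "real^3"
  assumes cl: "closed V" and add: "\<And>x y. x \<in> V \<Longrightarrow> y \<in> V \<Longrightarrow> x + y \<in> V"
    and sc: "\<And>x c. x \<in> V \<Longrightarrow> 0 \<le> c \<Longrightarrow> c *\<^sub>R x \<in> V"
    and orth: "\<And>x. x \<in> V \<Longrightarrow> x \<bullet> m = 0"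
    and neg: "\<And>x. x \<in> V \<Longrightarrow> x \<noteq> 0 \<Longrightarrow> x \<bullet> a < 0"
    and bd: "\<And>x. x \<in> V \<Longrightarrow> x \<bullet> a = -1 \<Longrightarrow> norm x \<le> r"
    and ne: "v \<in> V" "v \<noteq> 0" and m: "norm m = 1"
  obtains y1 y2 where "y1 \<in> V" "y2 \<in> V" "y1 \<bullet> a = -1" "y2 \<bullet> a = -1"
    "\<And>x. x \<in> V \<Longrightarrow> \<exists>b c. 0 \<le> b \<and> 0 \<le> c \<and> x = b *\<^sub>R y1 + c *\<^sub>R y2"
proof -
  have norma: "(- 1 / (x \<bullet> a)) *\<^sub>R x \<in> V \<and> ((- 1 / (x \<bullet> a)) *\<^sub>R x) \<bullet> a = -1" if "x \<in> V" "x \<noteq> 0" for x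
    using sc[OF that(1), of "- 1 / (x \<bullet> a)"] neg[OF that] by (simp add: divide_nonpos_neg)
  define y0 where "y0 = (- 1 / (v \<bullet> a)) *\<^sub>R v"
  have y0: "y0 \<in> V" "y0 \<bullet> a = -1" using norma[OF ne] by (auto simp: y0_def)
  define d where "d = m \<times> a"
  have d0: "d \<noteq> 0"
  proof
    assume "d = 0"
    then have "collinear {0, m, a}" by (simp add: d_def cross_eq_0)
    then obtain c where "a = c *\<^sub>R m"
      using m by (metis collinear_lemma norm_zero scaleR_zero_left zero_neq_one)
    then show False using y0 orth[of y0] by simp
  qed
  have dm: "d \<bullet> m = 0" "d \<bullet> a = 0" by (simp_all add: d_def dot_cross_self)
  define I where "I = {s. y0 + s *\<^sub>R d \<in> V}"
  have "closed I"
  proof -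
    have "I = (\<lambda>s. y0 + s *\<^sub>R d) -` V" by (auto simp: I_def)
    then show ?thesis using cl by (auto intro!: continuous_closed_vimage continuous_intros)
  qed
  moreover have "convex I"
  proof -
    have "u * s + w * t \<in> I" if "s \<in> I" "t \<in> I" "0 \<le> u" "0 \<le> w" "u + w = 1" for s t u w
    proof -
      have "u *\<^sub>R (y0 + s *\<^sub>R d) + w *\<^sub>R (y0 + t *\<^sub>R d) \<in> V" using that add sc by (simp add: I_def)
      also have "u *\<^sub>R (y0 + s *\<^sub>R d) + w *\<^sub>R (y0 + t *\<^sub>R d) = (u + w) *\<^sub>R y0 + (u * s + w * t) *\<^sub>R d"
        by (simp add: algebra_simps)
      finally show ?thesis using that by (simp add: I_def)
    qed
    then show ?thesis by (auto simp: convex_def)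
  qed
  moreover have "bounded I"
  proof -
    have "\<bar>s\<bar> \<le> (r + norm y0) / norm d" if "s \<in> I" for s
    proof -
      have "norm (y0 + s *\<^sub>R d) \<le> r" using that y0 dm by (intro bd) (auto simp: I_def inner_simps)
      then have "norm (s *\<^sub>R d) \<le> r + norm y0" using norm_triangle_ineq4[of "y0 + s *\<^sub>R d" y0] by simp
      then show ?thesis using d0 by (simp add: field_simps)
    qed
    then show ?thesis by (auto simp: bounded_iff)
  qed
  ultimately obtain s1 s2 where "I = {s1..s2}"
    using connected_compact_interval_1[of I] compact_eq_bounded_closed convex_connected by metis
  moreover have "0 \<in> I" using y0 by (simp add: I_def)
  ultimately have s: "s1 \<in> I" "s2 \<in> I" "\<And>s. s \<in> I \<Longrightarrow> s1 \<le> s \<and> s \<le> s2" by auto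
  show ?thesis
  proof (rule that[of "y0 + s1 *\<^sub>R d" "y0 + s2 *\<^sub>R d"])
    fix x assume x: "x \<in> V"
    show "\<exists>b c. 0 \<le> b \<and> 0 \<le> c \<and> x = b *\<^sub>R (y0 + s1 *\<^sub>R d) + c *\<^sub>R (y0 + s2 *\<^sub>R d)"
    proof (cases "x = 0")
      case True
      then show ?thesis by (intro exI[of _ 0]) auto
    next
      case False
      define l where "l = - (x \<bullet> a)"
      have l: "l > 0" using neg[OF x False] by (simp add: l_def)
      define x' where "x' = (1 / l) *\<^sub>R x"
      have x': "x' \<in> V" "x' \<bullet> a = -1" using norma[OF x False] by (auto simp: x'_def l_def)
      have "(x' - y0) \<bullet> m = 0" "(x' - y0) \<bullet> a = 0" using x' y0 orth by (auto simp: inner_simps)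
      then obtain t where "x' - y0 = t *\<^sub>R d" using orthogonal_to_pair d0 unfolding d_def by metis
      then have t: "x' = y0 + t *\<^sub>R d" by (simp add: algebra_simps)
      then have "t \<in> I" using x' by (simp add: I_def)
      then have "t \<in> closed_segment s1 s2" using s(3)[of t] by (simp add: closed_segment_eq_real_ivl)
      then obtain u where u: "0 \<le> u" "u \<le> 1" "t = (1 - u) * s1 + u * s2" by (auto simp: closed_segment_def)
      have "x = l *\<^sub>R x'" using l by (simp add: x'_def)
      also have "\<dots> = (l * (1 - u)) *\<^sub>R (y0 + s1 *\<^sub>R d) + (l * u) *\<^sub>R (y0 + s2 *\<^sub>R d)"
        unfolding t u(3) by (simp add: algebra_simps)
      finally have "x = (l * (1 - u)) *\<^sub>R (y0 + s1 *\<^sub>R d) + (l * u) *\<^sub>R (y0 + s2 *\<^sub>R d)" .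
      moreover have "0 \<le> l * (1 - u)" "0 \<le> l * u" using u l by auto
      ultimately show ?thesis by blast
    qed
  qed (use s y0 dm in \<open>auto simp: I_def inner_simps\<close>)
qed

text \<open>A wedge \<open>W\<close> with edge line \<open>m\<close>, cut off by a plane within the circular cone of angular radius
  \<open>arccos (1 / R)\<close>, has at most the area of the isosceles triangle with the same apex angle.\<close>

lemma sector_bound:
  fixes m a :: "real^3"
  assumes m: "norm m = 1" and rho: "R \<ge> 1" and am: "a \<bullet> m = 1"
    and cl: "closed W" and add: "\<And>x y. x \<in> W \<Longrightarrow> y \<in> W \<Longrightarrow> x + y \<in> W"
    and sc: "\<And>x c. x \<in> W \<Longrightarrow> 0 \<le> c \<Longrightarrow> c *\<^sub>R x \<in> W" and line: "\<And>t. t *\<^sub>R m \<in> W"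
    and cap: "\<And>x. x \<in> W \<Longrightarrow> 0 \<le> a \<bullet> x \<Longrightarrow> norm x \<le> R * (m \<bullet> x)"
  obtains \<eta> where "0 \<le> \<eta>" "\<eta> < pi/2" "ball_frac W = \<eta> / pi"
    "ball_frac (W \<inter> {x. 0 \<le> a \<bullet> x}) \<le> excess R \<eta> / (2 * pi)"
proof -
  note result = that
  define V where "V = W \<inter> {x. m \<bullet> x = 0}"
  have mm: "m \<bullet> m = 1" using m by (simp add: norm_eq_1)
  have proj: "x - (m \<bullet> x) *\<^sub>R m \<in> V" if "x \<in> W" for x
    using add[OF that line[of "- (m \<bullet> x)"]] by (simp add: V_def inner_simps mm)
  have unproj: "x \<in> W" if "x - (m \<bullet> x) *\<^sub>R m \<in> V" for x
    using add[OF _ line[of "m \<bullet> x"], of "x - (m \<bullet> x) *\<^sub>R m"] that by (simp add: V_def)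
  define r where "r = sqrt (R\<^sup>2 - 1)"
  have r: "r\<^sup>2 = R\<^sup>2 - 1" "r \<ge> 0" using rho by (auto simp: r_def)
  have neg: "x \<bullet> a < 0" if "x \<in> V" "x \<noteq> 0" for x
  proof (rule ccontr)
    assume "\<not> x \<bullet> a < 0"
    then have "norm x \<le> R * (m \<bullet> x)" using that by (intro cap) (auto simp: V_def inner_commute)
    then show False using that by (simp add: V_def)
  qed
  have bd: "norm x \<le> r" if "x \<in> V" "x \<bullet> a = -1" for x
  proof -
    have mx: "m \<bullet> x = 0" "x \<bullet> m = 0" using that by (auto simp: V_def inner_commute)
    \<comment> \<open>The point m + x lies on the cutting plane, so the cap condition applies to
      it.\<close>
    have "norm (m + x) \<le> R * (m \<bullet> (m + x))"
      using that am line[of 1] by (intro cap add) (auto simp: V_def inner_simps inner_commute)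
    then have "(norm (m + x))\<^sup>2 \<le> R\<^sup>2" using mx mm by (simp add: inner_simps power_mono)
    moreover have "(norm (m + x))\<^sup>2 = 1 + (norm x)\<^sup>2"
      using mx mm by (simp add: power2_norm_eq_inner inner_simps)
    ultimately have "(norm x)\<^sup>2 \<le> r\<^sup>2" using r by simp
    then show ?thesis using r(2) by (rule power2_le_imp_le)
  qed
  have clT: "closed (W \<inter> {x. 0 \<le> a \<bullet> x})" using cl closed_halfspace_ge[of 0 a] by (simp add: closed_Int)
  \<comment> \<open>If \<open>W\<close> lies in a plane, both measures vanish and \<eta> = 0
    serves.\<close>
  have degenerate: thesis if "u \<noteq> 0" "\<And>x. x \<in> W \<Longrightarrow> u \<bullet> x = 0" for u
  proof (rule result[of 0])
    have n: "negligible W" using that negligible_subset[OF negligible_hyperplane[of u 0]] by auto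
    then show "ball_frac W = 0 / pi" by (simp add: ball_frac_negligible)
    have "negligible (W \<inter> {x. 0 \<le> a \<bullet> x})" using n negligible_subset by blast
    then show "ball_frac (W \<inter> {x. 0 \<le> a \<bullet> x}) \<le> excess R 0 / (2 * pi)"
      by (simp add: ball_frac_negligible excess_def)
  qed auto
  show thesis
  proof (cases "V \<subseteq> {0}")
    case True
    obtain u where u: "u \<noteq> 0" "orthogonal m u"
      using orthogonal_to_vector_exists[of m] by auto
    have "u \<bullet> x = 0" if "x \<in> W" for x
    proof -
      have "x = (m \<bullet> x) *\<^sub>R m" using proj[OF that] True by auto
      then show ?thesis using u by (metis inner_commute inner_scaleR_right mult_zero_right orthogonal_def)
    qed
    then show thesis using degenerate u by blast
  next
    case False
    then obtain v where v: "v \<in> V" "v \<noteq> 0" by auto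
    have clV: "closed V" unfolding V_def using cl closed_hyperplane[of m 0] by (simp add: closed_Int)
    obtain y1 y2 where y: "y1 \<in> V" "y2 \<in> V" "y1 \<bullet> a = -1" "y2 \<bullet> a = -1"
      and gen: "\<And>x. x \<in> V \<Longrightarrow> \<exists>b c. 0 \<le> b \<and> 0 \<le> c \<and> x = b *\<^sub>R y1 + c *\<^sub>R y2"
    proof (rule planar_cone_generators[of V m a r v])
      show "x \<bullet> m = 0" if "x \<in> V" for x using that by (simp add: V_def inner_commute)
    qed (use clV add sc neg bd v m in \<open>auto simp: V_def inner_simps\<close>)
    have ym: "m \<bullet> y1 = 0" "m \<bullet> y2 = 0" using y by (auto simp: V_def)
    have y0: "y1 \<noteq> 0" "y2 \<noteq> 0" using y by auto
    define z1 z2 where "z1 = y1 /\<^sub>R norm y1" and "z2 = y2 /\<^sub>R norm y2"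
    have z: "norm z1 = 1" "norm z2 = 1" "y1 = norm y1 *\<^sub>R z1" "y2 = norm y2 *\<^sub>R z2"
      using y0 by (auto simp: z1_def z2_def)
    have yz: "k *\<^sub>R y1 = (k * norm y1) *\<^sub>R z1" "k *\<^sub>R y2 = (k * norm y2) *\<^sub>R z2" for k
      using y0 by (auto simp: z1_def z2_def)
    have zz: "z1 \<bullet> z1 = 1" "z2 \<bullet> z2 = 1" using z by (auto simp: norm_eq_1)
    have zm: "m \<bullet> z1 = 0" "m \<bullet> z2 = 0" using ym by (auto simp: z1_def z2_def)
    have za: "z1 \<bullet> a < 0" "z2 \<bullet> a < 0" using y y0 by (auto simp: z1_def z2_def)
    show thesis
    proof (cases "z1 = z2")
      case True
      have "m \<times> z1 \<noteq> 0" using norm_cross[of m z1] zm z m by auto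
      moreover have "(m \<times> z1) \<bullet> x = 0" if x: "x \<in> W" for x
      proof -
        obtain b c where "x - (m \<bullet> x) *\<^sub>R m = b *\<^sub>R y1 + c *\<^sub>R y2" using gen[OF proj[OF x]] by auto
        then have "x = (m \<bullet> x) *\<^sub>R m + b *\<^sub>R y1 + c *\<^sub>R y2" by (simp add: algebra_simps)
        also have "\<dots> = (m \<bullet> x) *\<^sub>R m + (b * norm y1 + c * norm y2) *\<^sub>R z1"
          using True by (simp add: yz scaleR_left_distrib)
        finally have "x = (m \<bullet> x) *\<^sub>R m + (b * norm y1 + c * norm y2) *\<^sub>R z1" .
        then have "(m \<times> z1) \<bullet> x = (m \<times> z1) \<bullet> ((m \<bullet> x) *\<^sub>R m + (b * norm y1 + c * norm y2) *\<^sub>R z1)" by simp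
        then show ?thesis by (simp add: inner_simps dot_cross_self)
      qed
      ultimately show thesis using degenerate by blast
    next
      case False
      \<comment> \<open>\<eta> will be half the angle between the unit generators, so the sum and
        the difference of \<open>z1\<close> and \<open>z2\<close> have norms 2 cos \<eta> and 2 sin
        \<eta>; e and f are their directions.\<close>
      define s t where "s = norm (z1 + z2)" and "t = norm (z2 - z1)"
      have "z1 + z2 \<noteq> 0" using za by (metis add_neg_neg inner_add_left inner_zero_left less_irrefl)
      then have s0: "s > 0" by (simp add: s_def)
      have t0: "t > 0" using False by (simp add: t_def)
      have st: "s\<^sup>2 = 2 + 2 * (z1 \<bullet> z2)" "t\<^sup>2 = 2 - 2 * (z1 \<bullet> z2)"
        unfolding s_def t_def power2_norm_eq_inner by (simp_all add: inner_simps inner_commute zz)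
      then have "(s/2)\<^sup>2 + (t/2)\<^sup>2 = 1" by (simp add: power_divide field_simps)
      then obtain \<eta> where \<eta>: "0 \<le> \<eta>" "\<eta> \<le> pi/2" "s/2 = cos \<eta>" "t/2 = sin \<eta>"
        using sincos_total_pi_half[of "s/2" "t/2"] s0 t0 by auto
      have cs: "cos \<eta> > 0" "sin \<eta> > 0" using \<eta>(3,4) s0 t0 by linarith+
      then have "\<eta> \<noteq> 0" "\<eta> \<noteq> pi/2" using cos_pi_half sin_zero by (metis less_irrefl)+
      then have eta: "0 < \<eta>" "\<eta> < pi/2" using \<eta>(1,2) by linarith+
      define e f where "e = (1/s) *\<^sub>R (z1 + z2)" and "f = (1/t) *\<^sub>R (z2 - z1)"
      have on: "norm e = 1" "norm f = 1" "m \<bullet> e = 0" "m \<bullet> f = 0" "e \<bullet> f = 0"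
        using s0 t0 zm zz by (auto simp: e_def f_def s_def t_def inner_simps inner_commute)
      have uu: "e \<bullet> e = 1" "f \<bullet> f = 1" "e \<bullet> m = 0" "f \<bullet> m = 0" "f \<bullet> e = 0"
        using on by (auto simp: norm_eq_1 inner_commute)
      have ef: "cos \<eta> *\<^sub>R e = (1/2) *\<^sub>R (z1 + z2)" "sin \<eta> *\<^sub>R f = (1/2) *\<^sub>R (z2 - z1)"
        unfolding \<eta>(3,4)[symmetric] e_def f_def using s0 t0 by auto
      have zef: "z1 = cos \<eta> *\<^sub>R e - sin \<eta> *\<^sub>R f" "z2 = cos \<eta> *\<^sub>R e + sin \<eta> *\<^sub>R f"
        unfolding ef by (simp_all add: vec_eq_iff field_simps)
      define N1 N2 where "N1 = sin \<eta> *\<^sub>R e + cos \<eta> *\<^sub>R f" and "N2 = sin \<eta> *\<^sub>R e - cos \<eta> *\<^sub>R f"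
      have N: "N1 \<bullet> m = 0" "N2 \<bullet> m = 0" "N1 \<bullet> z1 = 0" "N2 \<bullet> z2 = 0"
        "N1 \<bullet> z2 = 2 * (sin \<eta> * cos \<eta>)" "N2 \<bullet> z1 = 2 * (sin \<eta> * cos \<eta>)" "e \<bullet> z1 = cos \<eta>" "e \<bullet> z2 = cos \<eta>"
        using on uu by (auto simp: N1_def N2_def zef inner_simps)
      have expand: "\<exists>b c. 0 \<le> b \<and> 0 \<le> c \<and> x = (m \<bullet> x) *\<^sub>R m + b *\<^sub>R y1 + c *\<^sub>R y2" if "x \<in> W" for x
        using gen[OF proj[OF that]] by (simp add: diff_eq_eq add.assoc add.left_commute add.commute)
      have W: "W = wedge N1 N2"
      proof (intro equalityI subsetI)
        fix x assume "x \<in> W"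
        then obtain b c where bc: "0 \<le> b" "0 \<le> c" "x = (m \<bullet> x) *\<^sub>R m + b *\<^sub>R y1 + c *\<^sub>R y2" using expand by blast
        then have x: "x = (m \<bullet> x) *\<^sub>R m + (b * norm y1) *\<^sub>R z1 + (c * norm y2) *\<^sub>R z2"
          by (simp add: yz)
        have "N1 \<bullet> x = (c * norm y2) * (2 * (sin \<eta> * cos \<eta>))" by (subst x) (simp add: inner_simps N)
        moreover have "N2 \<bullet> x = (b * norm y1) * (2 * (sin \<eta> * cos \<eta>))" by (subst x) (simp add: inner_simps N)
        ultimately show "x \<in> wedge N1 N2" using bc cs by (simp add: wedge_def)
      next
        fix x assume "x \<in> wedge N1 N2"
        then have w: "0 \<le> sin \<eta> * (e \<bullet> x) + cos \<eta> * (f \<bullet> x)" "0 \<le> sin \<eta> * (e \<bullet> x) - cos \<eta> * (f \<bullet> x)"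
          by (auto simp: wedge_def N1_def N2_def inner_simps)
        define b c where "b = (e \<bullet> x) / (2 * cos \<eta>) - (f \<bullet> x) / (2 * sin \<eta>)"
          and "c = (e \<bullet> x) / (2 * cos \<eta>) + (f \<bullet> x) / (2 * sin \<eta>)"
        have bc: "0 \<le> b" "0 \<le> c" using w cs by (auto simp: b_def c_def field_simps)
        have "b *\<^sub>R z1 + c *\<^sub>R z2 = ((b + c) * cos \<eta>) *\<^sub>R e + ((c - b) * sin \<eta>) *\<^sub>R f"
          by (simp add: zef algebra_simps)
        also have "\<dots> = (e \<bullet> x) *\<^sub>R e + (f \<bullet> x) *\<^sub>R f" using cs by (simp add: b_def c_def)
        also have "\<dots> = x - (m \<bullet> x) *\<^sub>R m"
          using orthonormal_expansion[OF m on, of x] by (simp add: algebra_simps)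
        finally have "x - (m \<bullet> x) *\<^sub>R m = b *\<^sub>R z1 + c *\<^sub>R z2" by simp
        moreover have "z1 \<in> W" "z2 \<in> W" "m \<bullet> z1 = 0" "m \<bullet> z2 = 0"
          using y sc zm by (auto simp: V_def z1_def z2_def)
        then have "b *\<^sub>R z1 + c *\<^sub>R z2 \<in> V" using bc sc add by (simp add: V_def inner_simps)
        ultimately show "x \<in> W" using unproj by simp
      qed
      \<comment> \<open>Lengthening the generators \<open>y1\<close>, \<open>y2\<close> to the
        maximal length r only moves the base away from \<open>m\<close>, and the result is the
        isosceles triangle.\<close>
      have "W \<inter> {x. 0 \<le> a \<bullet> x} \<subseteq> wedge N1 N2 \<inter> {x. 0 \<le> ((sqrt (R\<^sup>2 - 1) * cos \<eta>) *\<^sub>R m - e) \<bullet> x}"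
      proof (rule subsetI)
        fix x assume x: "x \<in> W \<inter> {x. 0 \<le> a \<bullet> x}"
        then obtain b c where bc: "0 \<le> b" "0 \<le> c" "x = (m \<bullet> x) *\<^sub>R m + b *\<^sub>R y1 + c *\<^sub>R y2" using expand by blast
        have "a \<bullet> x = m \<bullet> x - b - c" by (subst bc(3)) (use am y in \<open>simp add: inner_simps inner_commute\<close>)
        then have bcm: "b + c \<le> m \<bullet> x" using x by simp
        have "e \<bullet> y1 = norm y1 * cos \<eta>" "e \<bullet> y2 = norm y2 * cos \<eta>"
          using z(3,4) N by (metis inner_scaleR_right)+
        then have "e \<bullet> x = (b * norm y1 + c * norm y2) * cos \<eta>"
          by (subst bc(3)) (simp add: inner_simps uu algebra_simps)
        also have "\<dots> \<le> (b * r + c * r) * cos \<eta>"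
          using bd[OF y(1,3)] bd[OF y(2,4)] bc cs by (intro mult_right_mono add_mono mult_left_mono) (auto simp: less_imp_le)
        also have "\<dots> = (r * cos \<eta>) * (b + c)" by (simp add: algebra_simps)
        also have "\<dots> \<le> (r * cos \<eta>) * (m \<bullet> x)" using bcm r cs by (intro mult_left_mono) auto
        finally have "0 \<le> ((r * cos \<eta>) *\<^sub>R m - e) \<bullet> x" by (simp add: inner_simps)
        then show "x \<in> wedge N1 N2 \<inter> {x. 0 \<le> ((sqrt (R\<^sup>2 - 1) * cos \<eta>) *\<^sub>R m - e) \<bullet> x}"
          using x W by (simp add: r_def)
      qed
      then have "ball_frac (W \<inter> {x. 0 \<le> a \<bullet> x}) \<le> ball_frac (wedge N1 N2 \<inter> {x. 0 \<le> ((sqrt (R\<^sup>2 - 1) * cos \<eta>) *\<^sub>R m - e) \<bullet> x})"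
        by (intro ball_frac_mono clT closed_Int closed_wedge closed_halfspace_ge)
      then show thesis
        using result[of \<eta>] ball_frac_isosceles[OF m on eta rho] eta W by (simp add: N1_def N2_def)
    qed
  qed
qed

text \<open>\<open>W j\<close> is the region where \<open>a j\<close> is the smallest of the
  functionals. All of them are 1 at \<open>m\<close>, so their differences vanish on its line and
  each \<open>W j\<close> is a wedge about that line; these wedges tile space, hence the half angles
  add up to pi. The last conclusion is what later identifies the indices in K as edges.\<close>

lemma polyhedral_cone_bound:
  fixes a :: "'i \<Rightarrow> real^3" and m :: "real^3"
  assumes J: "finite J" "J \<noteq> {}" and m: "norm m = 1" and rho: "R \<ge> 1"
    and am: "\<And>j. j \<in> J \<Longrightarrow> a j \<bullet> m = 1" and inj: "inj_on a J"
    and cap: "\<And>x. (\<And>j. j \<in> J \<Longrightarrow> 0 \<le> a j \<bullet> x) \<Longrightarrow> norm x \<le> R * (m \<bullet> x)"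
  obtains K \<eta> where "K \<subseteq> J" "\<And>j. j \<in> K \<Longrightarrow> 0 < \<eta> j \<and> \<eta> j < pi/2" "(\<Sum>j\<in>K. \<eta> j) = pi"
    "ball_frac {x. \<forall>j\<in>J. 0 \<le> a j \<bullet> x} \<le> (\<Sum>j\<in>K. excess R (\<eta> j) / (2 * pi))"
    "\<And>j. j \<in> K \<Longrightarrow> \<exists>u. a j \<bullet> u = 0 \<and> (\<forall>l\<in>J - {j}. 0 < a l \<bullet> u)"
proof -
  note result = that
  define W where "W j = (\<Inter>l\<in>J. {x. 0 \<le> (a l - a j) \<bullet> x})" for j
  have WI: "x \<in> W j \<longleftrightarrow> (\<forall>l\<in>J. a j \<bullet> x \<le> a l \<bullet> x)" for x j
    by (auto simp: W_def inner_diff_left)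
  have clW: "closed (W j)" for j
    unfolding W_def by (intro closed_INT ballI closed_halfspace_ge)
  have min: "\<exists>j\<in>J. x \<in> W j" for x
  proof -
    obtain j where "j \<in> J" "\<forall>l\<in>J. a j \<bullet> x \<le> a l \<bullet> x"
      using J finite_has_minimal[of "(\<lambda>l. a l \<bullet> x) ` J"] by (metis (no_types, lifting) arg_min_if_finite(1) arg_min_least)
    then show ?thesis by (auto simp: WI)
  qed
  have ex: "\<exists>\<eta>. 0 \<le> \<eta> \<and> \<eta> < pi/2 \<and> ball_frac (W j) = \<eta> / pi \<and>
      ball_frac (W j \<inter> {x. 0 \<le> a j \<bullet> x}) \<le> excess R \<eta> / (2 * pi)" if j: "j \<in> J" for j
  proof (rule sector_bound[OF m rho am[OF j] clW[of j]])
    show "x + y \<in> W j" if "x \<in> W j" "y \<in> W j" for x y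
      using that by (auto simp: WI inner_add_right intro: add_mono)
    show "c *\<^sub>R x \<in> W j" if "x \<in> W j" "0 \<le> c" for x c
      using that by (auto simp: WI intro: mult_left_mono)
    show "t *\<^sub>R m \<in> W j" for t using am j by (auto simp: WI)
    show "norm x \<le> R * (m \<bullet> x)" if "x \<in> W j" "0 \<le> a j \<bullet> x" for x
      using that by (intro cap) (auto simp: WI)
  qed auto
  then obtain \<eta> where \<eta>: "\<And>j. j \<in> J \<Longrightarrow> 0 \<le> \<eta> j \<and> \<eta> j < pi/2 \<and> ball_frac (W j) = \<eta> j / pi \<and>
      ball_frac (W j \<inter> {x. 0 \<le> a j \<bullet> x}) \<le> excess R (\<eta> j) / (2 * pi)" by metis
  define K where "K = {j\<in>J. \<eta> j > 0}"
  have KJ: "K \<subseteq> J" by (auto simp: K_def)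
  have disj: "negligible (W j \<inter> W l)" if "j \<in> J" "l \<in> J" "j \<noteq> l" for j l
  proof (rule negligible_subset)
    have "a l - a j \<noteq> 0" using inj that by (auto simp: inj_on_def)
    then show "negligible {x. (a l - a j) \<bullet> x = 0}" by (intro negligible_hyperplane) auto
    show "W j \<inter> W l \<subseteq> {x. (a l - a j) \<bullet> x = 0}" using that by (auto simp: WI inner_diff_left intro: antisym)
  qed
  have "measure lebesgue (\<Union>j\<in>J. W j \<inter> ball 0 1) = (\<Sum>j\<in>J. measure lebesgue (W j \<inter> ball 0 1))"
  proof (rule measure_negligible_finite_Union_image)
    show "pairwise (\<lambda>x y. negligible (W x \<inter> ball 0 1 \<inter> (W y \<inter> ball 0 1))) J"
      unfolding pairwise_def using disj by (blast intro: negligible_subset)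
  qed (use J lmeasurable_Int_ball clW in auto)
  moreover have "(\<Union>j\<in>J. W j \<inter> ball 0 1) = UNIV \<inter> ball 0 1" using min by auto
  ultimately have c: "(\<Sum>j\<in>J. measure lebesgue (W j \<inter> ball 0 1)) = measure lebesgue (ball (0::real^3) 1)" by simp
  have "(\<Sum>j\<in>J. ball_frac (W j)) = 1"
    unfolding ball_frac_def sum_divide_distrib[symmetric] c using content_ball_pos[of 1 "0::real^3"] by simp
  then have "(\<Sum>j\<in>J. \<eta> j) / pi = 1" using \<eta> by (simp add: sum_divide_distrib)
  then have sumJ: "(\<Sum>j\<in>J. \<eta> j) = pi" by (simp add: field_simps)
  have zero: "\<eta> j = 0" if "j \<in> J - K" for j using \<eta>[of j] that by (auto simp: K_def)
  have sumK: "(\<Sum>j\<in>K. \<eta> j) = pi"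
    using sumJ sum.mono_neutral_right[OF J(1) KJ, of \<eta>] zero by simp
  have "{x. \<forall>j\<in>J. 0 \<le> a j \<bullet> x} \<subseteq> (\<Union>j\<in>J. W j \<inter> {x. 0 \<le> a j \<bullet> x})"
    using min by fastforce
  moreover have "closed {x. \<forall>j\<in>J. 0 \<le> a j \<bullet> x}"
  proof -
    have "{x. \<forall>j\<in>J. 0 \<le> a j \<bullet> x} = (\<Inter>j\<in>J. {x. 0 \<le> a j \<bullet> x})" by auto
    then show ?thesis by (auto intro!: closed_halfspace_ge)
  qed
  moreover have cl2: "closed (W j \<inter> {x. 0 \<le> a j \<bullet> x})" for j
    using clW closed_halfspace_ge[of 0 "a j"] by (intro closed_Int) auto
  ultimately have "ball_frac {x. \<forall>j\<in>J. 0 \<le> a j \<bullet> x} \<le> ball_frac (\<Union>j\<in>J. W j \<inter> {x. 0 \<le> a j \<bullet> x})"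
    using J by (intro ball_frac_mono closed_UN) auto
  also have "\<dots> \<le> (\<Sum>j\<in>J. ball_frac (W j \<inter> {x. 0 \<le> a j \<bullet> x}))"
    using J cl2 by (intro ball_frac_UN_le) auto
  also have "\<dots> \<le> (\<Sum>j\<in>J. excess R (\<eta> j) / (2 * pi))"
    using \<eta> by (intro sum_mono) auto
  also have "\<dots> = (\<Sum>j\<in>K. excess R (\<eta> j) / (2 * pi))"
    using zero by (intro sum.mono_neutral_right[OF J(1) KJ]) (auto simp: excess_def)
  finally have bound: "ball_frac {x. \<forall>j\<in>J. 0 \<le> a j \<bullet> x} \<le> (\<Sum>j\<in>K. excess R (\<eta> j) / (2 * pi))" .
  show thesis
  proof (rule result[of K \<eta>, OF _ _ sumK bound])
    fix j assume j: "j \<in> K"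
    then have jJ: "j \<in> J" and "ball_frac (W j) > 0" using \<eta>[of j] by (auto simp: K_def)
    then have "\<not> negligible (W j)" using ball_frac_negligible[of "W j"] by auto
    moreover have "negligible (\<Union>l\<in>J-{j}. {x. (a l - a j) \<bullet> x = 0})"
    proof (rule negligible_Union)
      show "negligible t" if "t \<in> (\<lambda>l. {x. (a l - a j) \<bullet> x = 0}) ` (J - {j})" for t
        using that inj jJ by (auto simp: inj_on_def intro!: negligible_hyperplane)
    qed (use J in auto)
    ultimately obtain x where x: "x \<in> W j" "x \<notin> (\<Union>l\<in>J-{j}. {x. (a l - a j) \<bullet> x = 0})"
      using negligible_subset by blast
    have lt: "a j \<bullet> x < a l \<bullet> x" if "l \<in> J - {j}" for l
    proof -
      have "a j \<bullet> x \<le> a l \<bullet> x" "a l \<bullet> x \<noteq> a j \<bullet> x" using x that by (auto simp: WI inner_diff_left)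
      then show ?thesis by simp
    qed
    \<comment> \<open>Sliding x along \<open>m\<close> changes all functionals by the same amount
      and brings \<open>a j\<close> to 0.\<close>
    show "\<exists>u. a j \<bullet> u = 0 \<and> (\<forall>l\<in>J - {j}. 0 < a l \<bullet> u)"
      by (rule exI[of _ "x - (a j \<bullet> x) *\<^sub>R m"]) (use am jJ lt in \<open>auto simp: inner_diff_right\<close>)
  qed (use \<eta> in \<open>auto simp: K_def\<close>)
qed

section \<open>Normal cones of a polytope\<close>

definition exposed_edge :: "'a::real_inner set \<Rightarrow> 'a \<Rightarrow> 'a \<Rightarrow> bool" where
  "exposed_edge X p q \<longleftrightarrow>
    p \<in> X \<and> q \<in> X \<and> p \<noteq> q \<and> (\<exists>u. u \<bullet> p = u \<bullet> q \<and> (\<forall>r\<in>X - {p, q}. u \<bullet> r < u \<bullet> p))"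

lemma exposed_edge_sym: "exposed_edge X p q \<Longrightarrow> exposed_edge X q p"
  unfolding exposed_edge_def by (metis insert_commute)

definition vertex_config :: "'a::euclidean_space set \<Rightarrow> bool" where
  "vertex_config X \<longleftrightarrow> finite X \<and> (\<forall>p\<in>X. p \<notin> convex hull (X - {p})) \<and> cball 0 1 \<subseteq> convex hull X"

text \<open>The normal cone of \<open>convex hull X\<close> at \<open>p\<close>.\<close>

definition cell :: "'a::real_inner set \<Rightarrow> 'a \<Rightarrow> 'a set" where
  "cell X p = {x. \<forall>q\<in>X. 0 \<le> (p - q) \<bullet> x}"

lemma closed_cell: "closed (cell X p)"
proof -
  have "cell X p = (\<Inter>q\<in>X. {x. 0 \<le> (p - q) \<bullet> x})" by (auto simp: cell_def)
  then show ?thesis by (auto intro!: closed_halfspace_ge)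
qed

lemma UN_cell:
  assumes "finite X" "X \<noteq> {}" shows "(\<Union>p\<in>X. cell X p) = UNIV"
proof -
  have "\<exists>p\<in>X. x \<in> cell X p" for x
  proof -
    obtain p where "p \<in> X" "\<forall>q\<in>X. q \<bullet> x \<le> p \<bullet> x"
      using Max_in[of "(\<lambda>p. p \<bullet> x) ` X"] Max_ge[of "(\<lambda>p. p \<bullet> x) ` X"] assms by fastforce
    then show ?thesis by (auto simp: cell_def inner_diff_left)
  qed
  then show ?thesis by auto
qed

lemma inner_le_hull_max:
  assumes "y \<in> convex hull X" "\<And>q. q \<in> X \<Longrightarrow> x \<bullet> q \<le> c"
  shows "x \<bullet> y \<le> (c::real)"
proof -
  have "convex hull X \<subseteq> {y. x \<bullet> y \<le> c}"
    using assms(2) by (intro hull_minimal) (auto simp: convex_halfspace_le)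
  then show ?thesis using assms(1) by auto
qed

text \<open>On its cell p attains the support function of the hull, and the norm is the support
  function of the ball.\<close>

lemma norm_le_cell:
  assumes "cball 0 1 \<subseteq> convex hull X" "x \<in> cell X p"
  shows "norm x \<le> p \<bullet> x"
proof (cases "x = 0")
  case False
  have "x /\<^sub>R norm x \<in> convex hull X" using assms(1) False by (intro subsetD[OF assms(1)]) auto
  then have "x \<bullet> (x /\<^sub>R norm x) \<le> x \<bullet> p"
  proof (rule inner_le_hull_max)
    fix q assume "q \<in> X"
    then have "q \<bullet> x \<le> p \<bullet> x" using assms(2) by (auto simp: cell_def inner_diff_left)
    then show "x \<bullet> q \<le> x \<bullet> p" by (simp add: inner_commute)
  qed
  moreover have "x \<bullet> (x /\<^sub>R norm x) = norm x" using False by (simp add: power2_norm_eq_inner[symmetric] power2_eq_square)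
  ultimately show ?thesis by (simp add: inner_commute)
qed simp

lemma cell_bound:
  fixes X :: "(real^3) set"
  assumes X: "vertex_config X" and p: "p \<in> X" and rho: "norm p < R"
  obtains K \<eta> where "K \<subseteq> {q. exposed_edge X p q}" "\<forall>j\<in>K. 0 < \<eta> j \<and> \<eta> j < pi/2" "(\<Sum>j\<in>K. \<eta> j) = pi"
    "ball_frac (cell X p) \<le> (\<Sum>j\<in>K. excess R (\<eta> j) / (2 * pi))" "1 \<le> R"
proof -
  note result = that
  have fin: "finite X" and vert: "\<And>p. p \<in> X \<Longrightarrow> p \<notin> convex hull (X - {p})" and sub: "cball 0 1 \<subseteq> convex hull X"
    using X by (auto simp: vertex_config_def)
  have ne: "X - {p} \<noteq> {}"
  proof
    assume "X - {p} = {}"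
    then have "X = {p}" using p by auto
    then have "cball (0::real^3) 1 \<subseteq> {p}" using sub by simp
    moreover have "axis 1 1 \<in> cball (0::real^3) 1" "(0::real^3) \<in> cball 0 1" by auto
    ultimately have "axis 1 1 = (0::real^3)" by blast
    then show False by (simp add: axis_eq_0_iff)
  qed
  \<comment> \<open>Strict separation of the vertex from the other points gives a direction in the
    interior of the cell.\<close>
  have "\<exists>d b. d \<bullet> p < b \<and> (\<forall>x\<in>convex hull (X - {p}). b < d \<bullet> x)"
    using fin vert[OF p] by (intro separating_hyperplane_closed_point) (auto intro: compact_imp_closed finite_imp_compact_convex_hull)
  then obtain d' b where d': "d' \<bullet> p < b" "\<And>x. x \<in> convex hull (X - {p}) \<Longrightarrow> b < d' \<bullet> x" by blast
  define d where "d = - d'"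
  have d: "0 < (p - q) \<bullet> d" if "q \<in> X - {p}" for q
    using d'(1) d'(2)[of q] hull_inc[OF that, of convex] by (simp add: d_def inner_diff_left inner_diff_right inner_commute)
  have d0: "d \<noteq> 0" using d ne by force
  have dC: "d \<in> cell X p" using d by (fastforce simp: cell_def)
  have cap: "norm x \<le> p \<bullet> x" if "x \<in> cell X p" for x using norm_le_cell[OF sub that] .
  have "norm d \<le> norm p * norm d" using cap[OF dC] norm_cauchy_schwarz[of p d] by linarith
  then have p1: "1 \<le> norm p" using d0 by simp
  define w where "w = closest_point (cell X p) p"
  have cone: "c *\<^sub>R x \<in> cell X p" if "x \<in> cell X p" "0 \<le> c" for x c using that by (auto simp: cell_def)
  have conv: "convex (cell X p)"
  proof -
    have "cell X p = (\<Inter>q\<in>X. {x. 0 \<le> (p - q) \<bullet> x})" by (auto simp: cell_def)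
    then show ?thesis by (auto intro!: convex_INT convex_halfspace_ge)
  qed
  have wC: "w \<in> cell X p" unfolding w_def using dC closed_cell by (intro closest_point_in_set) auto
  have dot: "(p - w) \<bullet> (x - w) \<le> 0" if "x \<in> cell X p" for x
    unfolding w_def by (rule closest_point_dot[OF conv closed_cell that])
  \<comment> \<open>Testing with 0 and 2 w, both in the cone, gives orthogonality; so p - w lies in
    the polar cone, and on the cell the functional of w dominates that of p.\<close>
  have "(p - w) \<bullet> w = 0" using dot[OF cone[OF wC, of 0]] dot[OF cone[OF wC, of 2]] by (simp add: algebra_simps)
  then have wp: "p \<bullet> x \<le> w \<bullet> x" if "x \<in> cell X p" for x using dot[OF that] by (simp add: inner_simps)
  have "w \<bullet> w = p \<bullet> w" using \<open>(p - w) \<bullet> w = 0\<close> by (simp add: inner_simps)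
  then have "norm w * norm w \<le> norm p * norm w" using norm_cauchy_schwarz[of p w] by (simp add: power2_norm_eq_inner[symmetric] power2_eq_square)
  then have wn: "norm w \<le> norm p" by (cases "w = 0") auto
  \<comment> \<open>Small enough for the perturbed axis \<open>v\<close> to have norm at most
    \<open>R\<close>.\<close>
  define e where "e = (R - norm p) / ((norm p + 1) * (norm d + 1))"
  have e0: "e > 0" unfolding e_def using rho p1 by (intro divide_pos_pos mult_pos_pos) (auto simp: add_nonneg_pos)
  \<comment> \<open>The axis of the cone is the projection of \<open>p\<close> to the cell, pushed into the interior of the cell so
    that all facets are at positive distance; this is why \<open>R\<close> has to exceed \<open>norm p\<close>.\<close>
  define v where "v = (1 + e * norm d) *\<^sub>R w + e *\<^sub>R d"
  have vn: "norm v \<le> R"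
  proof -
    have "norm v \<le> (1 + e * norm d) * norm w + e * norm d"
      unfolding v_def using e0 by (intro norm_triangle_le) (simp add: abs_of_nonneg)
    also have "\<dots> \<le> (1 + e * norm d) * norm p + e * norm d" using wn e0 by (intro add_right_mono mult_left_mono) auto
    also have "\<dots> = norm p + e * ((norm p + 1) * norm d)" by (simp add: algebra_simps)
    also have "\<dots> \<le> norm p + e * ((norm p + 1) * (norm d + 1))" using e0 by (intro add_left_mono mult_left_mono) auto
    also have "\<dots> = R" unfolding e_def using p1 by (simp add: field_simps add_nonneg_eq_0_iff)
    finally show ?thesis .
  qed
  \<comment> \<open>The factor \<open>1 + e * norm d\<close> makes up for the summand e d, whose
    contribution may be as low as - e |d| |x|.\<close>
  have vx: "norm x \<le> v \<bullet> x" if "x \<in> cell X p" for x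
  proof -
    have "norm x \<le> w \<bullet> x" using cap[OF that] wp[OF that] by linarith
    then have "(1 + e * norm d) * norm x \<le> (1 + e * norm d) * (w \<bullet> x)" using e0 by (intro mult_left_mono) auto
    moreover have "e * (norm d * norm x) \<ge> e * (- (d \<bullet> x))"
      using e0 norm_cauchy_schwarz[of "- d" x] by (intro mult_left_mono) auto
    ultimately show ?thesis by (simp add: v_def inner_simps algebra_simps)
  qed
  have vq: "0 < (p - q) \<bullet> v" if "q \<in> X - {p}" for q
  proof -
    have "0 \<le> (p - q) \<bullet> w" using wC that by (auto simp: cell_def)
    then have "0 \<le> (1 + e * norm d) * ((p - q) \<bullet> w)" using e0 by simp
    moreover have "0 < e * ((p - q) \<bullet> d)" using e0 d[OF that] by simp
    ultimately show ?thesis by (simp add: v_def inner_add_right)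
  qed
  have v0: "v \<noteq> 0" using vq ne by force
  define m where "m = v /\<^sub>R norm v"
  have m1: "norm m = 1" using v0 by (simp add: m_def)
  have mq: "0 < (p - q) \<bullet> m" if "q \<in> X - {p}" for q using vq[OF that] v0 by (simp add: m_def)
  define a where "a q = (p - q) /\<^sub>R ((p - q) \<bullet> m)" for q
  have am: "a q \<bullet> m = 1" if "q \<in> X - {p}" for q using mq[OF that] by (simp add: a_def)
  have aC: "0 \<le> a q \<bullet> x \<longleftrightarrow> 0 \<le> (p - q) \<bullet> x" "0 < a q \<bullet> x \<longleftrightarrow> 0 < (p - q) \<bullet> x"
    "a q \<bullet> x = 0 \<longleftrightarrow> (p - q) \<bullet> x = 0"
    if "q \<in> X - {p}" for q x
    using mq[OF that] by (auto simp: a_def zero_le_mult_iff zero_less_mult_iff inverse_nonnegative_iff_nonnegative)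
  have C: "cell X p = {x. \<forall>j\<in>X-{p}. 0 \<le> a j \<bullet> x}"
  proof -
    have "x \<in> cell X p \<longleftrightarrow> (\<forall>j\<in>X-{p}. 0 \<le> (p - j) \<bullet> x)" for x
      by (auto simp: cell_def)
    then show ?thesis using aC(1) by auto
  qed
  have inj: "inj_on a (X - {p})"
  proof -
    \<comment> \<open>Equal normalised differences put q and r on one ray from p; the nearer one
      then lies between two other points of X, against convex position.\<close>
    have *: False if qr: "q \<in> X - {p}" "r \<in> X - {p}" "q \<noteq> r" "a q = a r" "(p - q) \<bullet> m \<le> (p - r) \<bullet> m" for q r
    proof -
      define s where "s = ((p - q) \<bullet> m) / ((p - r) \<bullet> m)"
      have s: "0 \<le> s" "s \<le> 1" using mq[OF qr(1)] mq[OF qr(2)] qr(5) by (auto simp: s_def)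
      have "p - q = ((p - q) \<bullet> m) *\<^sub>R a q" using mq[OF qr(1)] by (simp add: a_def)
      also have "\<dots> = s *\<^sub>R (p - r)" unfolding qr(4) by (simp add: a_def s_def divide_inverse)
      finally have "q = (1 - s) *\<^sub>R p + s *\<^sub>R r" by (simp add: algebra_simps)
      then have "q \<in> closed_segment p r" using s by (auto simp: closed_segment_def)
      also have "closed_segment p r = convex hull {p, r}" by (rule segment_convex_hull)
      also have "\<dots> \<subseteq> convex hull (X - {q})" using qr p by (intro hull_mono) auto
      finally show False using vert[of q] qr by auto
    qed
    then show ?thesis by (metis inj_onI linear)
  qed
  have cap': "norm x \<le> R * (m \<bullet> x)" if "\<And>j. j \<in> X - {p} \<Longrightarrow> 0 \<le> a j \<bullet> x" for x
  proof -
    have "norm x \<le> v \<bullet> x" using that C by (intro vx) auto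
    also have "\<dots> = norm v * (m \<bullet> x)" using v0 by (simp add: m_def)
    finally have *: "norm x \<le> norm v * (m \<bullet> x)" .
    then have "0 \<le> norm v * (m \<bullet> x)" using norm_ge_zero[of x] by linarith
    then have "0 \<le> m \<bullet> x" using v0 by (simp add: zero_le_mult_iff)
    then have "norm v * (m \<bullet> x) \<le> R * (m \<bullet> x)" using vn by (intro mult_right_mono) auto
    then show ?thesis using * by linarith
  qed
  show thesis
  proof (rule polyhedral_cone_bound[of "X - {p}" m R a])
    fix K :: "(real^3) set" and \<eta> :: "real^3 \<Rightarrow> real"
    assume K: "K \<subseteq> X - {p}" "\<And>j. j \<in> K \<Longrightarrow> 0 < \<eta> j \<and> \<eta> j < pi / 2" "sum \<eta> K = pi"
      "ball_frac {x. \<forall>j\<in>X - {p}. 0 \<le> a j \<bullet> x} \<le> (\<Sum>j\<in>K. excess R (\<eta> j) / (2 * pi))"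
      "\<And>j. j \<in> K \<Longrightarrow> \<exists>u. a j \<bullet> u = 0 \<and> (\<forall>l\<in>X - {p} - {j}. 0 < a l \<bullet> u)"
    show thesis
    proof (rule result[of K \<eta>])
      show "K \<subseteq> {q. exposed_edge X p q}"
      proof
        fix q assume q: "q \<in> K"
        then obtain u where "a q \<bullet> u = 0" "\<forall>l\<in>X - {p} - {q}. 0 < a l \<bullet> u" using K(5) by blast
        moreover have "q \<in> X - {p}" using K(1) q by auto
        ultimately have u: "(p - q) \<bullet> u = 0" "\<And>l. l \<in> X - {p, q} \<Longrightarrow> 0 < (p - l) \<bullet> u"
          using aC(2)[of _ u] aC(3)[of q u] by auto
        have "u \<bullet> p = u \<bullet> q" using u(1) by (simp add: inner_diff_right inner_commute)
        moreover have "u \<bullet> r < u \<bullet> p" if "r \<in> X - {p, q}" for r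
          using u(2)[OF that] by (simp add: inner_diff_right inner_commute)
        ultimately have "\<exists>u. u \<bullet> p = u \<bullet> q \<and> (\<forall>r\<in>X - {p, q}. u \<bullet> r < u \<bullet> p)" by blast
        then show "q \<in> {q. exposed_edge X p q}"
          unfolding exposed_edge_def using K(1) q p by auto
      qed
    qed (use K C p1 rho in auto)
  qed (use fin ne m1 p1 rho mq inj cap' am in auto)
qed

text \<open>The cells cover the sphere of area 4 pi and \<open>H\<close> bounds the area of each.
  Since \<open>cell_bound\<close> asks for R > norm p, a slack r proportional to e is added to the
  norms. Monotonicity of v is used because the triangles at p may be fewer than its edges.\<close>

lemma config_angle_bound:
  fixes X :: "(real^3) set" and y :: real and v :: "nat \<Rightarrow> real"
  assumes X: "vertex_config X" and y: "0 \<le> y" and mono: "mono v"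
    and H: "\<And>K \<eta> R. finite K \<Longrightarrow> card K < card X \<Longrightarrow>
      (\<And>j. j \<in> K \<Longrightarrow> 0 < \<eta> j \<and> \<eta> j < pi/2) \<Longrightarrow> (\<Sum>j\<in>K. \<eta> j) = pi \<Longrightarrow> 1 \<le> R \<Longrightarrow>
      (\<Sum>j\<in>K. 2 * excess R (\<eta> j)) \<le> y * R + v (card (K :: (real^3) set))"
  shows "4 * pi \<le> y * (\<Sum>p\<in>X. norm p) + (\<Sum>p\<in>X. v (card {q. exposed_edge X p q}))"
proof (rule field_le_epsilon)
  fix e :: real assume e: "e > 0"
  have fin: "finite X" using X by (simp add: vertex_config_def)
  have ne: "X \<noteq> {}" using X by (auto simp: vertex_config_def)
  define r where "r = e / ((y + 1) * card X)"
  have r: "r > 0" unfolding r_def using e y fin ne by (intro divide_pos_pos mult_pos_pos) (auto simp: card_gt_0_iff)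
  have each: "4 * pi * ball_frac (cell X p) \<le> y * (norm p + r) + v (card {q. exposed_edge X p q})" if p: "p \<in> X" for p
  proof -
    have "norm p < norm p + r" using r by simp
    then obtain K \<eta> where K: "K \<subseteq> {q. exposed_edge X p q}"
      "\<forall>j\<in>K. 0 < \<eta> j \<and> \<eta> j < pi/2" "(\<Sum>j\<in>K. \<eta> j) = pi"
      "ball_frac (cell X p) \<le> (\<Sum>j\<in>K. excess (norm p + r) (\<eta> j) / (2 * pi))" "1 \<le> norm p + r"
      using cell_bound[OF X p] by blast
    have sub: "{q. exposed_edge X p q} \<subseteq> X - {p}" by (auto simp: exposed_edge_def)
    then have fE: "finite {q. exposed_edge X p q}" using fin finite_subset by blast
    have fK: "finite K" using K(1) fE finite_subset by blast
    have "card K \<le> card (X - {p})" using K(1) sub fin by (intro card_mono) auto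
    also have "\<dots> < card X" using fin p by (intro card_Diff1_less)
    finally have cK: "card K < card X" .
    have "4 * pi * ball_frac (cell X p) \<le> 4 * pi * (\<Sum>j\<in>K. excess (norm p + r) (\<eta> j) / (2 * pi))"
      using K(4) by (intro mult_left_mono) auto
    also have "\<dots> = (\<Sum>j\<in>K. 2 * excess (norm p + r) (\<eta> j))"
      unfolding sum_distrib_left by (rule sum.cong) (simp_all add: field_simps)
    also have "\<dots> \<le> y * (norm p + r) + v (card K)" using fK cK K(2,3,5) by (intro H) auto
    also have "\<dots> \<le> y * (norm p + r) + v (card {q. exposed_edge X p q})"
      using monoD[OF mono card_mono[OF fE K(1)]] by simp
    finally show ?thesis .
  qed
  have "1 \<le> (\<Sum>p\<in>X. ball_frac (cell X p))"
    using ball_frac_UN_le[OF fin, of "cell X"] closed_cell UN_cell[OF fin ne] ball_frac_UNIV[where ?'n = 3] by metis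
  then have "4 * pi \<le> 4 * pi * (\<Sum>p\<in>X. ball_frac (cell X p))" by simp
  also have "\<dots> = (\<Sum>p\<in>X. 4 * pi * ball_frac (cell X p))" by (simp add: sum_distrib_left)
  also have "\<dots> \<le> (\<Sum>p\<in>X. y * (norm p + r) + v (card {q. exposed_edge X p q}))" by (rule sum_mono) (rule each)
  also have "\<dots> = y * (\<Sum>p\<in>X. norm p) + (\<Sum>p\<in>X. v (card {q. exposed_edge X p q})) + y * (card X * r)"
    by (simp add: sum.distrib sum_distrib_left distrib_left)
  also have "y * (card X * r) \<le> e"
  proof -
    have "card X * r = e / (y + 1)" using fin ne by (simp add: r_def)
    then have "y * (card X * r) = (y / (y + 1)) * e" by simp
    also have "\<dots> \<le> 1 * e" using y e by (intro mult_right_mono) auto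
    finally show ?thesis by simp
  qed
  finally show "4 * pi \<le> y * (\<Sum>p\<in>X. norm p) + (\<Sum>p\<in>X. v (card {q. exposed_edge X p q})) + e" by simp
qed

section \<open>Estimates for the excess\<close>

lemma has_derivative_tangent_le:
  fixes f f' :: "real \<Rightarrow> real"
  assumes d: "\<And>x. x \<in> {a<..<b} \<Longrightarrow> (f has_real_derivative f' x) (at x)"
    and m: "\<And>x y. x \<in> {a<..<b} \<Longrightarrow> y \<in> {a<..<b} \<Longrightarrow> x \<le> y \<Longrightarrow> f' x \<le> f' y"
    and xc: "x \<in> {a<..<b}" "c \<in> {a<..<b}"
  shows "f c + f' c * (x - c) \<le> f x"
proof -
  have "convex_on {a<..<b} f" using d m by (intro convex_on_realI[of _ _ f']) auto
  then have "f x - f c \<ge> f' c * (x - c)"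
    using xc d[OF xc(2)]
    by (intro convex_on_imp_above_tangent[where A="{a<..<b}"]) (auto simp: interior_open has_field_derivative_at_within)
  then show ?thesis by simp
qed

lemma has_derivative_arctan_inverse:
  assumes x: "x > 0"
  shows "((\<lambda>R. arctan (t / R)) has_real_derivative - (t / (x\<^sup>2 + t\<^sup>2))) (at x)"
proof -
  have "((\<lambda>R. arctan (t / R)) has_real_derivative inverse (1 + (t / x)\<^sup>2) * (- t / x\<^sup>2)) (at x)"
    using x by (auto intro!: derivative_eq_intros simp: power2_eq_square)
  moreover have "inverse (1 + (t / x)\<^sup>2) * (- t / x\<^sup>2) = - (t / (x\<^sup>2 + t\<^sup>2))"
  proof -
    have "x\<^sup>2 + t\<^sup>2 \<noteq> 0" using x by (simp add: sum_power2_eq_zero_iff)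
    moreover have "1 + (t / x)\<^sup>2 = (x\<^sup>2 + t\<^sup>2) / x\<^sup>2" using x by (simp add: field_simps)
    ultimately show ?thesis using x by (simp add: field_simps)
  qed
  ultimately show ?thesis by simp
qed

lemma arctan_inverse_tangent:
  assumes "t > 0" "r > 0" "R > 0"
  shows "arctan (t / r) - t / (r\<^sup>2 + t\<^sup>2) * (R - r) \<le> arctan (t / R)"
proof -
  define b where "b = max r R + 1"
  have "arctan (t / r) + (- (t / (r\<^sup>2 + t\<^sup>2))) * (R - r) \<le> arctan (t / R)"
  proof (rule has_derivative_tangent_le[where a=0 and b=b and f="\<lambda>R. arctan (t / R)" and f'="\<lambda>R. - (t / (R\<^sup>2 + t\<^sup>2))"])
    fix x assume "x \<in> {0<..<b}"
    then have x: "x > 0" by simp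
    show "((\<lambda>R. arctan (t / R)) has_real_derivative - (t / (x\<^sup>2 + t\<^sup>2))) (at x)"
      by (rule has_derivative_arctan_inverse[OF x])
  next
    fix x y assume "x \<in> {0<..<b}" "y \<in> {0<..<b}" "x \<le> y"
    then show "- (t / (x\<^sup>2 + t\<^sup>2)) \<le> - (t / (y\<^sup>2 + t\<^sup>2))"
      using assms by (auto intro!: divide_left_mono mult_pos_pos add_pos_pos power_mono)
  qed (use assms in \<open>auto simp: b_def\<close>)
  then show ?thesis by simp
qed

text \<open>\<open>excess R\<close> is concave in the angle, since its slope 1 - R / D falls as the
  denominator D decreases; the right side is the tangent at c.\<close>

lemma excess_tangent:
  assumes rho: "1 \<le> R" and eta: "\<eta> \<in> {0<..<pi/2}" "c \<in> {0<..<pi/2}"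
  shows "excess R \<eta> \<le> excess R c + (1 - R / (R\<^sup>2 - (R\<^sup>2 - 1) * (sin c)\<^sup>2)) * (\<eta> - c)"
proof -
  let ?D = "\<lambda>x. R\<^sup>2 - (R\<^sup>2 - 1) * (sin x)\<^sup>2"
  have D: "?D x = R\<^sup>2 * (cos x)\<^sup>2 + (sin x)\<^sup>2" for x
    by (simp add: cos_squared_eq algebra_simps)
  have D0: "?D x > 0" if "x \<in> {0<..<pi/2}" for x
    unfolding D using that rho cos_gt_zero[of x] by (intro add_pos_nonneg mult_pos_pos) auto
  have "- excess R c + (R / ?D c - 1) * (\<eta> - c) \<le> - excess R \<eta>"
  proof (rule has_derivative_tangent_le[where a=0 and b="pi/2" and f="\<lambda>x. - excess R x" and f'="\<lambda>x. R / ?D x - 1"])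
    fix x assume x: "x \<in> {0<..<pi/2}"
    then have c: "cos x > 0" using cos_gt_zero[of x] by simp
    have "((\<lambda>x. - excess R x) has_real_derivative (inverse ((cos x)\<^sup>2) / R) * inverse (1 + (tan x / R)\<^sup>2) - 1) (at x)"
      unfolding excess_def using c rho by (auto intro!: derivative_eq_intros simp: field_simps)
    moreover have "(inverse ((cos x)\<^sup>2) / R) * inverse (1 + (tan x / R)\<^sup>2) = R / ?D x"
    proof -
      have "1 + (tan x / R)\<^sup>2 = ?D x / (R * cos x)\<^sup>2"
        unfolding D using c rho by (simp add: tan_def field_simps)
      moreover define E where "E = ?D x"
      ultimately have "inverse (1 + (tan x / R)\<^sup>2) = (R * cos x)\<^sup>2 / E" by simp
      note inv = this
      show ?thesis unfolding E_def[symmetric] inv using c rho by (simp add: power2_eq_square field_simps)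
    qed
    ultimately show "((\<lambda>x. - excess R x) has_real_derivative R / ?D x - 1) (at x)" by simp
  next
    fix x y assume xy: "x \<in> {0<..<pi/2}" "y \<in> {0<..<pi/2}" "x \<le> y"
    then have "sin x \<le> sin y" "0 \<le> sin x" using sin_mono_le_eq[of x y] sin_gt_zero[of x] by auto
    then have "(sin x)\<^sup>2 \<le> (sin y)\<^sup>2" by (intro power_mono) auto
    moreover have "0 \<le> R\<^sup>2 - 1" using rho by simp
    ultimately have "?D y \<le> ?D x" by (intro diff_left_mono mult_left_mono)
    then show "R / ?D x - 1 \<le> R / ?D y - 1" using D0[OF xy(1)] D0[OF xy(2)] rho
      by (intro diff_right_mono divide_left_mono mult_pos_pos) auto
  qed (use eta in auto)
  then show ?thesis by (simp add: algebra_simps)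
qed

text \<open>Jensen's inequality by way of the tangent at c. With c left free, an angle with an
  elementary tangent can stand in for pi/5.\<close>

lemma sum_excess_le:
  fixes c :: real
  assumes K: "finite K" "\<And>j. j \<in> K \<Longrightarrow> 0 < \<eta> j \<and> \<eta> j < pi/2" "(\<Sum>j\<in>K. \<eta> j) = pi"
    and rho: "1 \<le> R" and c: "c \<in> {0<..<pi/2}"
  shows "(\<Sum>j\<in>K. 2 * excess R (\<eta> j)) \<le>
    2 * real (card K) * excess R c + 2 * (1 - R / (R\<^sup>2 - (R\<^sup>2 - 1) * (sin c)\<^sup>2)) * (pi - real (card K) * c)"
proof -
  define s where "s = 1 - R / (R\<^sup>2 - (R\<^sup>2 - 1) * (sin c)\<^sup>2)"
  have "(\<Sum>j\<in>K. 2 * excess R (\<eta> j)) \<le> (\<Sum>j\<in>K. 2 * (excess R c + s * (\<eta> j - c)))"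
    using excess_tangent[OF rho _ c] K(2) unfolding s_def by (intro sum_mono mult_left_mono) auto
  also have "\<dots> = 2 * real (card K) * excess R c + 2 * s * ((\<Sum>j\<in>K. \<eta> j) - real (card K) * c)"
  proof -
    have eq: "2 * (excess R c + s * (\<eta> j - c)) = (2 * excess R c - 2 * s * c) + (2 * s) * \<eta> j" for j
      by (simp add: algebra_simps)
    have "(\<Sum>j\<in>K. 2 * (excess R c + s * (\<eta> j - c))) = (\<Sum>j\<in>K. (2 * excess R c - 2 * s * c) + (2 * s) * \<eta> j)"
      by (simp only: eq)
    also have "\<dots> = real (card K) * (2 * excess R c - 2 * s * c) + (2 * s) * (\<Sum>j\<in>K. \<eta> j)"
      by (simp only: sum.distrib sum_distrib_left[symmetric] sum_constant)
    finally show ?thesis by (simp add: algebra_simps)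
  qed
  finally show ?thesis using K(3) by (simp add: s_def)
qed

text \<open>The tangent of the concave function \<open>excess R\<close> at 0. Summed over all
  triangles it gives the area 2 pi (1 - 1 / R) of the whole circular cap.\<close>

lemma excess_le_linear:
  assumes rho: "1 \<le> R" and eta: "0 < \<eta>" "\<eta> < pi/2"
  shows "excess R \<eta> \<le> (1 - 1 / R) * \<eta>"
proof -
  have "(\<lambda>x. arctan (tan x / R) - x / R) 0 \<le> (\<lambda>x. arctan (tan x / R) - x / R) \<eta>"
  proof (rule DERIV_nonneg_imp_nondecreasing[OF less_imp_le[OF eta(1)]])
    fix x assume "0 \<le> x" "x \<le> \<eta>"
    then have c: "cos x > 0" using eta by (intro cos_gt_zero_pi) auto
    have p: "1 + (tan x / R)\<^sup>2 > 0" by (simp add: add_pos_nonneg)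
    have "((\<lambda>x. arctan (tan x / R) - x / R) has_real_derivative
        inverse (1 + (tan x / R)\<^sup>2) * ((1 + (tan x)\<^sup>2) / R) - 1 / R) (at x)"
      using c rho by (auto intro!: derivative_eq_intros simp: tan_sec power_inverse)
    moreover have "inverse (1 + (tan x / R)\<^sup>2) * ((1 + (tan x)\<^sup>2) / R) - 1 / R \<ge> 0"
    proof -
      have "(tan x / R)\<^sup>2 \<le> (tan x)\<^sup>2" using rho by (simp add: power_divide divide_le_eq mult_le_cancel_left1)
      then have "1 \<le> inverse (1 + (tan x / R)\<^sup>2) * (1 + (tan x)\<^sup>2)" using p by (simp add: field_simps)
      then show ?thesis using rho by (simp add: divide_right_mono)
    qed
    ultimately show "\<exists>d. ((\<lambda>x. arctan (tan x / R) - x / R) has_real_derivative d) (at x) \<and> 0 \<le> d" by blast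
  qed
  then show ?thesis by (simp add: excess_def algebra_simps)
qed

text \<open>Passing to a steeper slope costs only \<open>(y - q) * (r - 1)\<close>, because R is at
  least 1.\<close>

lemma slope_change:
  fixes q :: real
  assumes "q \<le> y" "1 \<le> R" shows "q * (R - r) \<le> y * (R - r) + (y - q) * (r - 1)"
proof -
  have "0 \<le> (y - q) * (R - 1)" using assms by simp
  then show ?thesis by (simp add: algebra_simps)
qed

lemma three_le_card:
  assumes "finite K" "\<And>j. j \<in> K \<Longrightarrow> 0 < \<eta> j \<and> \<eta> j < pi/2" "(\<Sum>j\<in>K. \<eta> j) = pi"
  shows "3 \<le> card K"
proof -
  have "K \<noteq> {}" using assms(3) by auto
  then have "(\<Sum>j\<in>K. \<eta> j) < (\<Sum>j\<in>K. pi/2)" using assms by (intro sum_strict_mono) auto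
  then have "2 < real (card K)" using assms(3) by simp
  then show ?thesis by simp
qed

section \<open>Numerical bounds for the arctangent, pi and sqrt 3\<close>

lemma arctan_le_poly:
  assumes "0 \<le> (x::real)" shows "arctan x \<le> x - x^3/3 + x^5/5"
proof -
  have "0 - arctan 0 \<le> x - x^3/3 + x^5/5 - arctan x"
  proof -
    have "(\<lambda>x. x - x^3/3 + x^5/5 - arctan x) 0 \<le> (\<lambda>x. x - x^3/3 + x^5/5 - arctan x) x"
    proof (rule DERIV_nonneg_imp_nondecreasing[OF assms])
      fix y :: real
      have "((\<lambda>x. x - x^3/3 + x^5/5 - arctan x) has_real_derivative 1 - y^2 + y^4 - inverse (1 + y\<^sup>2)) (at y)"
        by (auto intro!: derivative_eq_intros)
      moreover have "1 - y^2 + y^4 - inverse (1 + y\<^sup>2) = y^6 / (1 + y\<^sup>2)"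
      proof -
        have "1 + y\<^sup>2 \<noteq> 0" by (metis add_pos_nonneg less_irrefl zero_le_power2 zero_less_one)
        moreover have "(1 - y^2 + y^4) * (1 + y\<^sup>2) = 1 + y^6" by algebra
        ultimately have "1 - y^2 + y^4 = (1 + y^6) / (1 + y\<^sup>2)" by (simp add: eq_divide_eq)
        then show ?thesis by (simp add: add_divide_distrib inverse_eq_divide)
      qed
      moreover have "0 \<le> y^6 / (1 + y\<^sup>2)" by simp
      ultimately show "\<exists>d. ((\<lambda>x. x - x^3/3 + x^5/5 - arctan x) has_real_derivative d) (at y) \<and> 0 \<le> d" by auto
    qed
    then show ?thesis by simp
  qed
  then show ?thesis by simp
qed

lemma arctan_ge_poly:
  assumes "0 \<le> (x::real)" shows "x - x^3/3 + x^5/5 - x^7/7 \<le> arctan x"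
proof -
  have "(\<lambda>x. arctan x - (x - x^3/3 + x^5/5 - x^7/7)) 0 \<le> (\<lambda>x. arctan x - (x - x^3/3 + x^5/5 - x^7/7)) x"
  proof (rule DERIV_nonneg_imp_nondecreasing[OF assms])
    fix y :: real
    have "((\<lambda>x. arctan x - (x - x^3/3 + x^5/5 - x^7/7)) has_real_derivative inverse (1 + y\<^sup>2) - (1 - y^2 + y^4 - y^6)) (at y)"
      by (auto intro!: derivative_eq_intros)
    moreover have "inverse (1 + y\<^sup>2) - (1 - y^2 + y^4 - y^6) = y^8 / (1 + y\<^sup>2)"
    proof -
      have "1 + y\<^sup>2 \<noteq> 0" by (metis add_pos_nonneg less_irrefl zero_le_power2 zero_less_one)
      moreover have "(1 - y^2 + y^4 - y^6) * (1 + y\<^sup>2) = 1 - y^8" by algebra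
      ultimately have "1 - y^2 + y^4 - y^6 = (1 - y^8) / (1 + y\<^sup>2)" by (simp add: eq_divide_eq)
      then show ?thesis by (simp add: diff_divide_distrib inverse_eq_divide)
    qed
    moreover have "0 \<le> y^8 / (1 + y\<^sup>2)" by simp
    ultimately show "\<exists>d. ((\<lambda>x. arctan x - (x - x^3/3 + x^5/5 - x^7/7)) has_real_derivative d) (at y) \<and> 0 \<le> d" by auto
  qed
  then show ?thesis by simp
qed

lemma pi_bounds: "31415/10000 \<le> pi" "pi \<le> 31417/10000"
  using machin arctan_le_poly[of "1/5"] arctan_ge_poly[of "1/5"] arctan_le_poly[of "1/239"] arctan_ge_poly[of "1/239"]
  by (simp_all add: power_divide power_numeral_reduce)

lemma sqrt3_bounds: "173205/100000 \<le> sqrt 3" "sqrt 3 \<le> 173206/100000"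
  by (rule real_le_rsqrt, simp add: power2_eq_square, rule real_le_lsqrt) (simp_all add: power2_eq_square)

lemma sqrt3_fraction: "(1 / sqrt 3) / (x\<^sup>2 + (1 / sqrt 3)\<^sup>2) = sqrt 3 / (3 * x\<^sup>2 + 1)"
proof -
  have "x\<^sup>2 + (1 / sqrt 3)\<^sup>2 = (3 * x\<^sup>2 + 1) / 3" by (simp add: power_divide)
  note eq = this
  have "(1 / sqrt 3) / (x\<^sup>2 + (1 / sqrt 3)\<^sup>2) = (3 / sqrt 3) / (3 * x\<^sup>2 + 1)" unfolding eq by simp
  then show ?thesis by (simp only: real_div_sqrt[of 3, simplified])
qed

section \<open>Affine bounds for the total area of the triangles at one vertex\<close>

context
  fixes K :: "'i set" and \<eta> :: "'i \<Rightarrow> real" and R :: real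
  assumes K: "finite K" "\<And>j. j \<in> K \<Longrightarrow> 0 < \<eta> j \<and> \<eta> j < pi/2" "(\<Sum>j\<in>K. \<eta> j) = pi" and rho: "1 \<le> R"
begin

abbreviation "total_excess \<equiv> (\<Sum>j\<in>K. 2 * excess R (\<eta> j))"

text \<open>Equal angles are the worst case: at c = pi / k the linear term of
  \<open>sum_excess_le\<close> vanishes.\<close>

lemma sum_excess_regular:
  assumes "card K = k"
  shows "total_excess \<le> 2 * pi - 2 * k * arctan (tan (pi / k) / R)"
proof -
  have "3 \<le> k" using three_le_card[OF K] assms by simp
  then have c: "pi / k \<in> {0<..<pi/2}" by (auto simp: field_simps)
  show ?thesis using sum_excess_le[OF K rho c] \<open>3 \<le> k\<close> assms by (simp add: excess_def algebra_simps)
qed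

text \<open>arctan (t / R) is convex in R, so the bound for k equal angles lies below its tangent at
  each r. The cases k = 3, 4, 6 are those in which tan (pi / k) is simple.\<close>

lemma sum_excess_3_tangent:
  assumes "card K = 3" and r: "r > 0"
  shows "total_excess \<le> 2 * pi - 6 * arctan (sqrt 3 / r) + 6 * sqrt 3 / (r\<^sup>2 + 3) * (R - r)"
proof -
  have "6 * sqrt 3 / (r\<^sup>2 + 3) * (R - r) = 6 * (sqrt 3 / (r\<^sup>2 + 3) * (R - r))" by simp
  then show ?thesis
    using sum_excess_regular[OF assms(1)] arctan_inverse_tangent[of "sqrt 3" r R] r rho by (simp add: tan_60)
qed

lemma sum_excess_4_tangent:
  assumes "card K = 4" and r: "r > 0"
  shows "total_excess \<le> 2 * pi - 8 * arctan (1 / r) + 8 / (r\<^sup>2 + 1) * (R - r)"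
proof -
  have "8 / (r\<^sup>2 + 1) * (R - r) = 8 * (1 / (r\<^sup>2 + 1) * (R - r))" by simp
  moreover have "arctan (1 / r) - 1 / (r\<^sup>2 + 1) * (R - r) \<le> arctan (1 / R)"
    using arctan_inverse_tangent[of 1 r R] r rho by simp
  moreover have "total_excess \<le> 2 * pi - 8 * arctan (1 / R)"
    using sum_excess_regular[OF assms(1)] by (simp add: tan_45)
  ultimately show ?thesis by linarith
qed

lemma sum_excess_6_tangent:
  assumes "card K = 6" and r: "r > 0"
  shows "total_excess \<le> 2 * pi - 12 * arctan (1 / (sqrt 3 * r)) + 12 * sqrt 3 / (3 * r\<^sup>2 + 1) * (R - r)"
proof -
  have "arctan (1 / (sqrt 3 * r)) - sqrt 3 / (3 * r\<^sup>2 + 1) * (R - r) \<le> arctan (1 / (sqrt 3 * R))"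
    using arctan_inverse_tangent[of "1 / sqrt 3" r R] r rho unfolding sqrt3_fraction by simp
  moreover have "12 * sqrt 3 / (3 * r\<^sup>2 + 1) * (R - r) = 12 * (sqrt 3 / (3 * r\<^sup>2 + 1) * (R - r))" by simp
  moreover have "total_excess \<le> 2 * pi - 12 * arctan (1 / (sqrt 3 * R))"
    using sum_excess_regular[OF assms(1)] by (simp add: tan_30)
  ultimately show ?thesis by linarith
qed

text \<open>The coefficient of \<open>R\<close> is the slope of the tangent for four triangles at \<open>R = 19/10\<close>.\<close>

lemma sum_excess_le_5:
  assumes "card K < 5"
  shows "total_excess \<le> 800/461 * R + (544/1000 * card K - 3061/1000)"
proof -
  consider "card K = 3" | "card K = 4" using assms three_le_card[OF K] by linarith
  then show ?thesis
  proof cases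
    case 1
    \<comment> \<open>At r = sqrt 3 the slope is sqrt 3, just below 800/461, and the arctangent is
      pi/4.\<close>
    have "total_excess \<le> sqrt 3 * R + pi/2 - 3"
      using sum_excess_3_tangent[OF 1, of "sqrt 3"] by (simp add: algebra_simps)
    moreover have "sqrt 3 * R \<le> 800/461 * R" using rho sqrt3_bounds by (intro mult_right_mono) auto
    ultimately show ?thesis using 1 pi_bounds by simp
  next
    case 2
    have "484/1000 \<le> arctan (10/19)" using arctan_ge_poly[of "10/19"] by (simp add: power_divide power_numeral_reduce)
    then show ?thesis using sum_excess_4_tangent[OF 2, of "19/10"] pi_bounds 2 by (simp add: power_divide field_simps)
  qed
qed

text \<open>Equality holds for \<open>card K = 4\<close> and \<open>R = sqrt 3\<close>, the regular octahedron.\<close>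

lemma sum_excess_le_6:
  assumes "card K < 6"
  shows "total_excess \<le> 2 * R + (2 * pi / 3 - 2 * sqrt 3 + 4/10 * (real (card K) - 4))"
proof -
  \<comment> \<open>The increment 4/10 lies in the window left by the estimates below: three
    triangles allow at most about 0.48, five require at least about 0.36.\<close>
  consider "card K = 3" | "card K = 4" | "card K = 5" using assms three_le_card[OF K] by linarith
  then show ?thesis
  proof cases
    case 1
    \<comment> \<open>149/100 is close to where the tangent for three triangles has slope 2. The
      arctangent is taken at a point above 1, where the Taylor bound is poor; hence the addition
      formula.\<close>
    have "arctan 1 + arctan (75/1000) = arctan ((1 + 75/1000) / (1 - 1 * (75/1000)))" by (rule arctan_add) auto
    also have "\<dots> \<le> arctan (sqrt 3 / (149/100))" using sqrt3_bounds by (intro arctan_monotone') simp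
    finally have "pi / 4 + 748/10000 \<le> arctan (sqrt 3 / (149/100))" using arctan_ge_poly[of "75/1000"]
      by (simp add: arctan_one power_divide power_numeral_reduce)
    moreover have "6 * sqrt 3 / ((149/100)\<^sup>2 + 3) * (R - 149/100) \<le> 2 * (R - 149/100) + 5/1000"
    proof -
      define q where "q = 6 * sqrt 3 / ((149/100)\<^sup>2 + 3)"
      have q: "19908/10000 \<le> q" "q \<le> 2" using sqrt3_bounds by (auto simp: q_def power2_eq_square)
      have "q * (R - 149/100) \<le> 2 * (R - 149/100) + (2 - q) * (149/100 - 1)"
        using q rho by (intro slope_change) auto
      also have "\<dots> \<le> 2 * (R - 149/100) + 5/1000" using q by (simp add: field_simps)
      finally show ?thesis unfolding q_def .
    qed
    ultimately show ?thesis using sum_excess_3_tangent[OF 1, of "149/100"] 1 pi_bounds sqrt3_bounds by simp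
  next
    case 2
    have "arctan (1 / sqrt 3) = pi / 6" using arctan_unique[of "pi/6" "1 / sqrt 3"] tan_30 by simp
    then show ?thesis using sum_excess_4_tangent[OF 2, of "sqrt 3"] 2 by (simp add: algebra_simps)
  next
    case 3
    \<comment> \<open>For five triangles the tangent at c = pi/4 replaces the one at pi/5. It gives
      the bound 2 R + 2 pi - f R with f convex; 9/5 is close to the minimum of f, so the tangent of
      f there loses little.\<close>
    define f where "f x = 2 * x + 10 * arctan (1 / x) - pi * (x / (x\<^sup>2 + 1))" for x
    define f' where "f' x = 2 - (10 - pi) / (x\<^sup>2 + 1) - 2 * pi / (x\<^sup>2 + 1)\<^sup>2" for x
    have "f (9/5) + f' (9/5) * (R - 9/5) \<le> f R"
    proof (rule has_derivative_tangent_le[where a=0 and b="R + 2"])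
      fix x assume "x \<in> {0<..<R + 2}"
      then have x: "x > 0" by simp
      have w: "x\<^sup>2 + 1 \<noteq> 0" by (metis add_nonneg_pos less_irrefl zero_le_power2 zero_less_one)
      define g where "g x = arctan (1 / x)" for x :: real
      have dg: "(g has_real_derivative - (1 / (x\<^sup>2 + 1))) (at x)"
        using has_derivative_arctan_inverse[OF x, of 1] by (simp add: g_def[abs_def])
      define h where "h x = x / (x\<^sup>2 + 1)" for x :: real
      have dh: "(h has_real_derivative ((x\<^sup>2 + 1) - x * (2 * x)) / (x\<^sup>2 + 1)\<^sup>2) (at x)"
        unfolding h_def using w by (auto intro!: derivative_eq_intros simp: power2_eq_square)
      have "(f has_real_derivative 2 + 10 * (- (1 / (x\<^sup>2 + 1))) - pi * (((x\<^sup>2 + 1) - x * (2 * x)) / (x\<^sup>2 + 1)\<^sup>2)) (at x)"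
        unfolding f_def g_def[symmetric] h_def[symmetric]
        by (rule derivative_eq_intros dg dh refl)+ simp
      moreover have "2 + 10 * (- (1 / (x\<^sup>2 + 1))) - pi * (((x\<^sup>2 + 1) - x * (2 * x)) / (x\<^sup>2 + 1)\<^sup>2) = f' x"
        unfolding f'_def using w by (simp add: power2_eq_square divide_simps) algebra
      ultimately show "(f has_real_derivative f' x) (at x)" by simp
    next
      fix x y :: real assume "x \<in> {0<..<R + 2}" "y \<in> {0<..<R + 2}" "x \<le> y"
      then have "x\<^sup>2 + 1 \<le> y\<^sup>2 + 1" "x\<^sup>2 + 1 > 0" by (auto intro: power_mono simp: add_nonneg_pos)
      then show "f' x \<le> f' y" unfolding f'_def using pi_less_4
        by (intro diff_mono divide_left_mono mult_pos_pos power_mono zero_less_power) auto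
    qed (use rho in auto)
    moreover have "0 \<le> f' (9/5)" "f' (9/5) \<le> 4/100" using pi_bounds by (simp_all add: f'_def power2_eq_square field_simps)
    then have "f' (9/5) * (R - 9/5) \<ge> - 4/100"
    proof -
      have "f' (9/5) * (R - 9/5) \<ge> f' (9/5) * (- 1)" using rho \<open>0 \<le> f' (9/5)\<close> by (intro mult_left_mono) auto
      then show ?thesis using \<open>f' (9/5) \<le> 4/100\<close> by simp
    qed
    moreover have "733/100 \<le> f (9/5)"
      using arctan_ge_poly[of "5/9"] pi_bounds by (simp add: f_def power_divide power_numeral_reduce)
    ultimately have "729/100 \<le> f R" by simp
    moreover have "total_excess \<le> 2 * R + 2 * pi - f R"
    proof -
      have d: "R\<^sup>2 - (R\<^sup>2 - 1) * (sin (pi/4))\<^sup>2 = (R\<^sup>2 + 1) / 2" by (simp add: sin_45 power_divide field_simps)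
      have "total_excess \<le> 10 * excess R (pi/4) + 2 * (1 - R / ((R\<^sup>2 + 1) / 2)) * (pi - 5 * (pi/4))"
        using sum_excess_le[OF K rho, of "pi/4"] 3 unfolding d by simp
      also have "\<dots> = 2 * R + 2 * pi - f R" by (simp add: excess_def f_def tan_45 algebra_simps)
      finally show ?thesis .
    qed
    ultimately show ?thesis using 3 pi_bounds sqrt3_bounds by simp
  qed
qed

text \<open>The coefficient of \<open>R\<close> is slightly above the slope of the tangent for six triangles at \<open>R = 38/25\<close>.\<close>

lemma sum_excess_le_7:
  assumes "card K < 7"
  shows "total_excess \<le> 265/100 * R + (9/100 * card K - 261/100)"
proof -
  consider "card K = 3" | "card K = 4" | "card K = 5" | "card K = 6" using assms three_le_card[OF K] by linarith
  then show ?thesis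
  proof cases
    case 1
    have "total_excess \<le> sqrt 3 * R + pi/2 - 3"
      using sum_excess_3_tangent[OF 1, of "sqrt 3"] by (simp add: algebra_simps)
    moreover have "(265/100 - sqrt 3) * 1 \<le> (265/100 - sqrt 3) * R" using rho sqrt3_bounds by (intro mult_left_mono) auto
    ultimately show ?thesis using 1 pi_bounds sqrt3_bounds by (simp add: left_diff_distrib)
  next
    case 2
    have "5858/10000 \<le> arctan (2/3)" using arctan_ge_poly[of "2/3"] by (simp add: power_divide power_numeral_reduce)
    then show ?thesis using sum_excess_4_tangent[OF 2, of "3/2"] pi_bounds 2 rho by (simp add: power_divide field_simps)
  next
    case 3
    \<comment> \<open>As for five triangles in \<open>sum_excess_le_6\<close>, now with c = pi/6 and
      3/2 close to the minimum.\<close>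
    define f where "f x = 265/100 * x + 10 * arctan ((1 / sqrt 3) / x) + (4 * pi / 3) * (x / (3 * x\<^sup>2 + 1))" for x
    define f' where "f' x = 265/100 - (10 * sqrt 3 + 4 * pi / 3) / (3 * x\<^sup>2 + 1) + (8 * pi / 3) / (3 * x\<^sup>2 + 1)\<^sup>2" for x
    have "f (3/2) + f' (3/2) * (R - 3/2) \<le> f R"
    proof (rule has_derivative_tangent_le[where a=0 and b="R + 2"])
      fix x assume "x \<in> {0<..<R + 2}"
      then have x: "x > 0" by simp
      have w: "3 * x\<^sup>2 + 1 \<noteq> 0" using zero_le_power2[of x] by linarith
      define g where "g x = arctan ((1 / sqrt 3) / x)" for x
      have dg: "(g has_real_derivative - (sqrt 3 / (3 * x\<^sup>2 + 1))) (at x)"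
        using has_derivative_arctan_inverse[OF x, of "1 / sqrt 3"] unfolding sqrt3_fraction by (simp only: g_def[abs_def])
      define h where "h x = x / (3 * x\<^sup>2 + 1)" for x :: real
      have dh: "(h has_real_derivative ((3 * x\<^sup>2 + 1) - x * (6 * x)) / (3 * x\<^sup>2 + 1)\<^sup>2) (at x)"
        unfolding h_def using w by (auto intro!: derivative_eq_intros simp: power2_eq_square)
      have "(f has_real_derivative 265/100 + 10 * (- (sqrt 3 / (3 * x\<^sup>2 + 1))) + (4 * pi / 3) * (((3 * x\<^sup>2 + 1) - x * (6 * x)) / (3 * x\<^sup>2 + 1)\<^sup>2)) (at x)"
        unfolding f_def g_def[symmetric] h_def[symmetric]
        by (rule derivative_eq_intros dg dh refl)+ (simp add: ac_simps)
      moreover have "265/100 + 10 * (- (sqrt 3 / (3 * x\<^sup>2 + 1))) + (4 * pi / 3) * (((3 * x\<^sup>2 + 1) - x * (6 * x)) / (3 * x\<^sup>2 + 1)\<^sup>2) = f' x"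
        unfolding f'_def using w by (simp add: power2_eq_square divide_simps) algebra
      ultimately show "(f has_real_derivative f' x) (at x)" by simp
    next
      fix x y :: real assume xy: "x \<in> {0<..<R + 2}" "y \<in> {0<..<R + 2}" "x \<le> y"
      \<comment> \<open>In s = 1 / (3 x^2 + 1) the derivative is the quadratic 265/100 - A s + B
        s^2, which decreases on [0, 1] since A exceeds 2 B; and s itself decreases in x.\<close>
      define s t where "s = 1 / (3 * x\<^sup>2 + 1)" and "t = 1 / (3 * y\<^sup>2 + 1)"
      have "3 * x\<^sup>2 + 1 \<le> 3 * y\<^sup>2 + 1" "1 \<le> 3 * x\<^sup>2 + 1" using xy by (auto intro: power_mono)
      then have "0 < 3 * x\<^sup>2 + 1" "0 < 3 * y\<^sup>2 + 1" by linarith+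
      then have st: "t \<le> s" "s \<le> 1" "0 \<le> t"
        using \<open>3 * x\<^sup>2 + 1 \<le> 3 * y\<^sup>2 + 1\<close> by (auto simp: s_def t_def divide_le_eq_1 intro!: frac_le)
      have "(8 * pi / 3) * (s + t) \<le> (8 * pi / 3) * 2" using st by (intro mult_left_mono) auto
      then have "0 \<le> (10 * sqrt 3 + 4 * pi / 3) - (8 * pi / 3) * (s + t)" using pi_bounds sqrt3_bounds by linarith
      then have "0 \<le> (s - t) * ((10 * sqrt 3 + 4 * pi / 3) - (8 * pi / 3) * (s + t))" using st by simp
      moreover have "f' y - f' x = (s - t) * ((10 * sqrt 3 + 4 * pi / 3) - (8 * pi / 3) * (s + t))"
      proof -
        define A B where "A = 10 * sqrt 3 + 4 * pi / 3" and "B = 8 * pi / 3"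
        have "f' x = 265/100 - A * s + B * s\<^sup>2" "f' y = 265/100 - A * t + B * t\<^sup>2"
          by (simp_all add: f'_def s_def t_def A_def B_def power_divide)
        then show ?thesis unfolding A_def[symmetric] B_def[symmetric] by (simp add: power2_eq_square algebra_simps)
      qed
      ultimately show "f' x \<le> f' y" by simp
    qed (use rho in auto)
    moreover have f': "0 \<le> f' (3/2)" "f' (3/2) \<le> 145/10000" using pi_bounds sqrt3_bounds by (simp_all add: f'_def power2_eq_square field_simps)
    then have "f' (3/2) * (R - 3/2) \<ge> - 73/10000"
    proof -
      have "f' (3/2) * (R - 3/2) \<ge> f' (3/2) * (- (1/2))" using rho f' by (intro mult_left_mono) auto
      then show ?thesis using f' by simp
    qed
    moreover have "84585/10000 \<le> f (3/2)"
    proof -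
      have "38489/100000 \<le> (1 / sqrt 3) / (3/2)" using sqrt3_bounds by (simp add: field_simps)
      then have "arctan (38489/100000) \<le> arctan ((1 / sqrt 3) / (3/2))" by (rule arctan_monotone')
      moreover have "36738/100000 \<le> arctan (38489/100000)"
        by (rule order_trans[OF _ arctan_ge_poly]) (simp_all add: power_divide power_numeral_reduce)
      ultimately show ?thesis using pi_bounds by (simp add: f_def power2_eq_square)
    qed
    ultimately have "8451/1000 \<le> f R" by simp
    moreover have "total_excess \<le> 265/100 * R + 2 * pi - f R"
    proof -
      have d: "R\<^sup>2 - (R\<^sup>2 - 1) * (sin (pi/6))\<^sup>2 = (3 * R\<^sup>2 + 1) / 4" by (simp add: sin_30 power_divide field_simps)
      have "total_excess \<le> 10 * excess R (pi/6) + 2 * (1 - R / ((3 * R\<^sup>2 + 1) / 4)) * (pi - 5 * (pi/6))"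
        using sum_excess_le[OF K rho, of "pi/6"] 3 unfolding d by simp
      also have "\<dots> = 265/100 * R + 2 * pi - f R" by (simp add: excess_def f_def tan_30 algebra_simps)
      finally show ?thesis .
    qed
    ultimately show ?thesis using 3 pi_bounds by simp
  next
    case 4
    have "3798/10000 \<le> 1 / (sqrt 3 * (38/25))" using sqrt3_bounds by (simp add: field_simps)
    then have "arctan (3798/10000) \<le> arctan (1 / (sqrt 3 * (38/25)))" by (rule arctan_monotone')
    moreover have "3629/10000 \<le> arctan (3798/10000)"
      by (rule order_trans[OF _ arctan_ge_poly]) (simp_all add: power_divide power_numeral_reduce)
    moreover define q where "q = 12 * sqrt 3 / (3 * (38/25)\<^sup>2 + 1)"
    have q: "26205/10000 \<le> q" "q \<le> 265/100" using sqrt3_bounds by (auto simp: q_def power2_eq_square)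
    have "q * (R - 38/25) \<le> 265/100 * (R - 38/25) + (265/100 - q) * (38/25 - 1)"
      using q rho by (intro slope_change) auto
    moreover have "265/100 * (R - 38/25) + (265/100 - q) * (38/25 - 1) \<le> 265/100 * R - 4012/1000"
      using q by (simp add: field_simps)
    moreover have "total_excess \<le> 2 * pi - 12 * arctan (1 / (sqrt 3 * (38/25))) + q * (R - 38/25)"
      using sum_excess_6_tangent[OF 4, of "38/25"] unfolding q_def by simp
    ultimately have "total_excess \<le> 265/100 * R - 207/100" using pi_bounds by linarith
    then show ?thesis using 4 by simp
  qed
qed

text \<open>The tangent at R = 4/3 to the concave cap area 2 pi (1 - 1 / R). There the cap has area
  pi/2, an eighth of the sphere, which makes the bound best for eight points.\<close>

lemma sum_excess_le_general:
  "total_excess \<le> 9 * pi / 8 * R - pi"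
proof -
  have "total_excess \<le> (\<Sum>j\<in>K. 2 * ((1 - 1 / R) * \<eta> j))"
    using excess_le_linear[OF rho] K(2) by (intro sum_mono mult_left_mono) auto
  also have "\<dots> = 2 * pi * (1 - 1 / R)" using K(3) by (simp add: sum_distrib_left[symmetric])
  also have "\<dots> \<le> 2 * pi * (9 / 16 * R - 1 / 2)"
  proof (rule mult_left_mono)
    have "0 \<le> (3 / 4 * R - 1)\<^sup>2 / R" using rho by simp
    also have "\<dots> = (9 / 16 * R - 1 / 2) - (1 - 1 / R)" using rho by (simp add: power2_eq_square field_simps)
    finally show "1 - 1 / R \<le> 9 / 16 * R - 1 / 2" by simp
  qed simp
  also have "\<dots> = 9 * pi / 8 * R - pi" by (simp add: algebra_simps)
  finally show ?thesis .
qed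

end

section \<open>Counting edges\<close>

lemma exposed_edge_hull_disjoint:
  assumes e: "exposed_edge X a b" and N: "N \<subseteq> X - {a, b}"
  shows "convex hull {a, b} \<inter> convex hull N = {}"
proof -
  obtain u where u: "u \<bullet> a = u \<bullet> b" "\<And>r. r \<in> X - {a, b} \<Longrightarrow> u \<bullet> r < u \<bullet> a"
    using e by (auto simp: exposed_edge_def)
  have "convex hull {a, b} \<subseteq> {x. u \<bullet> x \<ge> u \<bullet> a}"
    using u(1) by (intro hull_minimal) (auto simp: convex_halfspace_ge)
  moreover have "convex hull N \<subseteq> {x. u \<bullet> x < u \<bullet> a}"
    using u(2) N by (intro hull_minimal) (auto simp: convex_halfspace_lt)
  ultimately show ?thesis by fastforce
qed

text \<open>Five points of space have a Radon partition, whose smaller part has at most two points;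
  a single point is excluded by convex position.\<close>

lemma radon_pair:
  fixes X :: "(real^3) set"
  assumes X: "vertex_config X" and S: "S \<subseteq> X" "card S = 5"
  obtains a b N where "a \<in> S" "b \<in> S" "a \<noteq> b" "N \<subseteq> S - {a, b}" "convex hull {a, b} \<inter> convex hull N \<noteq> {}"
proof -
  note result = that
  have fS: "finite S" using S(2) by (metis card.infinite zero_neq_numeral)
  have "affine_dependent S" using fS S(2) by (intro affine_dependent_biggerset) auto
  then obtain M P where MP: "M \<subseteq> S" "P \<subseteq> S" "M \<inter> P = {}" "convex hull M \<inter> convex hull P \<noteq> {}"
    by (rule Radon)
  have *: thesis if MP: "M \<subseteq> S" "P \<subseteq> S" "M \<inter> P = {}" "convex hull M \<inter> convex hull P \<noteq> {}" and c: "card M \<le> 2" for M P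
  proof -
    have fM: "finite M" using fS MP(1) finite_subset by blast
    have "M \<noteq> {}" using MP(4) by auto
    then have "card M = 1 \<or> card M = 2" using c fM by (metis One_nat_def Suc_1 card_gt_0_iff le_Suc_eq le_zero_eq less_numeral_extra(3))
    then show thesis
    proof
      assume "card M = 1"
      then obtain p where p: "M = {p}" by (rule card_1_singletonE)
      then have "p \<in> convex hull P" using MP(4) by auto
      also have "\<dots> \<subseteq> convex hull (X - {p})" using MP p S(1) by (intro hull_mono) auto
      finally show thesis using X MP(1) p S(1) by (auto simp: vertex_config_def)
    next
      assume "card M = 2"
      then obtain a b where "M = {a, b}" "a \<noteq> b" by (auto simp: card_2_iff)
      then show thesis using result[of a b P] MP by auto
    qed
  qed
  have "card M + card P \<le> 5"
    using MP(1,2,3) S(2) fS by (metis card_Un_disjoint card_mono finite_subset le_sup_iff)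
  then have "card M \<le> 2 \<or> card P \<le> 2" by linarith
  then show thesis using *[OF MP] *[of P M] MP by blast
qed

lemma radon_nonedge:
  fixes X :: "(real^3) set"
  assumes X: "vertex_config X" and S: "S \<subseteq> X" "5 \<le> card S"
  obtains a b where "a \<in> S" "b \<in> S" "a \<noteq> b" "\<not> exposed_edge X a b"
proof -
  obtain T where T: "T \<subseteq> S" "card T = 5" using S(2) by (metis obtain_subset_with_card_n)
  then have "T \<subseteq> X" using S by auto
  from X this T(2) obtain a b N where ab: "a \<in> T" "b \<in> T" "a \<noteq> b" "N \<subseteq> T - {a, b}" "convex hull {a, b} \<inter> convex hull N \<noteq> {}"
    by (rule radon_pair)
  have "N \<subseteq> X - {a, b}" using ab(4) \<open>T \<subseteq> X\<close> by auto
  then have "\<not> exposed_edge X a b" using exposed_edge_hull_disjoint ab(5) by blast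
  then show thesis using that ab T by blast
qed

text \<open>Both sides count ordered pairs, so an unordered pair that is not an edge contributes two
  elements to N.\<close>

lemma sum_degree_le:
  assumes X: "finite X" and N: "N \<subseteq> {(p, q). p \<in> X \<and> q \<in> X \<and> p \<noteq> q \<and> \<not> exposed_edge X p q}"
  shows "(\<Sum>p\<in>X. card {q. exposed_edge X p q}) + card N \<le> card X * (card X - 1)"
proof -
  let ?E = "Sigma X (\<lambda>p. {q. exposed_edge X p q})" and ?A = "Sigma X (\<lambda>p. X - {p})"
  have fin: "finite {q. exposed_edge X p q}" for p
    using X by (rule finite_subset[rotated]) (auto simp: exposed_edge_def)
  have fA: "finite ?A" using X by auto
  have sub: "?E \<union> N \<subseteq> ?A" using N by (auto simp: exposed_edge_def)
  have "?E \<inter> N = {}" using N by auto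
  moreover have "finite ?E" "finite N" using finite_subset[OF sub fA] by auto
  ultimately have "card ?E + card N = card (?E \<union> N)" by (simp add: card_Un_disjoint)
  also have "\<dots> \<le> card ?A" using card_mono[OF fA sub] .
  also have "\<dots> = (\<Sum>p\<in>X. card X - 1)" using X by (simp add: card_SigmaI)
  finally show ?thesis using X fin by (simp add: card_SigmaI)
qed

lemma ball_not_in_hyperplane:
  assumes "cball 0 1 \<subseteq> convex hull X" "\<And>x. x \<in> X \<Longrightarrow> w \<bullet> x = (c::real)" shows "w = 0"
proof (rule ccontr)
  assume w: "w \<noteq> 0"
  have "convex hull X \<subseteq> {x. w \<bullet> x = c}" using assms(2) by (intro hull_minimal) (auto simp: convex_hyperplane)
  then have *: "w \<bullet> x = c" if "norm x \<le> 1" for x using assms(1) that by auto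
  have "w \<bullet> (w /\<^sub>R norm w) = c" "w \<bullet> 0 = c" using w by (intro *; simp)+
  then show False using w by simp
qed

text \<open>The quotients are slopes seen from the common image of e and f in the (u, v) plane. A
  common point of the segment and the triangle has the slope of b, and its slope is also an average
  of those of c and d, with weights proportional to s (M - u c) and t (M - u d).\<close>

lemma hull_pair_triple_ratio:
  fixes u v :: "'a::real_inner"
  assumes hull: "convex hull {c, d} \<inter> convex hull {b, e, f} \<noteq> {}"
    and cd: "c \<notin> convex hull {b, e, f}" "d \<notin> convex hull {b, e, f}"
    and u: "u \<bullet> e = M" "u \<bullet> f = M" "u \<bullet> b < M" "u \<bullet> c < M" "u \<bullet> d < M"
    and v: "v \<bullet> e = w" "v \<bullet> f = w"
  obtains l where "0 < l" "l < 1"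
    "(v \<bullet> b - w) / (M - u \<bullet> b) = l * ((v \<bullet> c - w) / (M - u \<bullet> c)) + (1 - l) * ((v \<bullet> d - w) / (M - u \<bullet> d))"
proof -
  obtain z where z: "z \<in> convex hull {c, d}" "z \<in> convex hull {b, e, f}" using hull by blast
  obtain s t where s: "0 \<le> s" "0 \<le> t" "s + t = 1" "z = s *\<^sub>R c + t *\<^sub>R d"
    using z(1) by (auto simp: convex_hull_2)
  obtain \<alpha> \<beta> \<gamma> where a: "0 \<le> \<alpha>" "0 \<le> \<beta>" "0 \<le> \<gamma>" "\<alpha> + \<beta> + \<gamma> = 1" "z = \<alpha> *\<^sub>R b + \<beta> *\<^sub>R e + \<gamma> *\<^sub>R f"
    using z(2) unfolding convex_hull_3 by blast
  have "s \<noteq> 0" using s z(2) cd(2) by auto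
  moreover have "t \<noteq> 0" using s z(2) cd(1) by auto
  ultimately have st: "0 < s" "0 < t" using s by auto
  have "u \<bullet> z = s * (u \<bullet> c) + t * (u \<bullet> d)" by (simp add: s(4) inner_add_right)
  moreover have "u \<bullet> z = \<alpha> * (u \<bullet> b) + \<beta> * M + \<gamma> * M" by (simp add: a(5) u inner_add_right)
  moreover have "M = s * M + t * M" "M = \<alpha> * M + \<beta> * M + \<gamma> * M"
    using s(3) a(4) by (metis distrib_right mult_1)+
  ultimately have U: "s * (M - u \<bullet> c) + t * (M - u \<bullet> d) = \<alpha> * (M - u \<bullet> b)"
    by (simp add: right_diff_distrib)
  have "v \<bullet> z = s * (v \<bullet> c) + t * (v \<bullet> d)" by (simp add: s(4) inner_add_right)
  moreover have "v \<bullet> z = \<alpha> * (v \<bullet> b) + \<beta> * w + \<gamma> * w" by (simp add: a(5) v inner_add_right)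
  moreover have "w = s * w + t * w" "w = \<alpha> * w + \<beta> * w + \<gamma> * w"
    using s(3) a(4) by (metis distrib_right mult_1)+
  ultimately have V: "s * (v \<bullet> c - w) + t * (v \<bullet> d - w) = \<alpha> * (v \<bullet> b - w)"
    by (simp add: right_diff_distrib)
  define B C D where "B = M - u \<bullet> b" and "C = M - u \<bullet> c" and "D = M - u \<bullet> d"
  have pos: "B > 0" "C > 0" "D > 0" using u by (auto simp: B_def C_def D_def)
  have U': "s * C + t * D = \<alpha> * B" using U by (simp add: B_def C_def D_def)
  have sC: "s * C > 0" "t * D > 0" using st pos by auto
  then have aB: "\<alpha> * B > 0" using U' by linarith
  then have a0: "\<alpha> > 0" using pos by (simp add: zero_less_mult_iff)
  define l where "l = s * C / (\<alpha> * B)"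
  have l1: "1 - l = t * D / (\<alpha> * B)"
  proof -
    have "1 = (s * C + t * D) / (\<alpha> * B)" unfolding U' using aB by (metis divide_self less_irrefl)
    then show ?thesis by (simp add: l_def add_divide_distrib)
  qed
  have "0 < 1 - l" unfolding l1 using sC aB by (intro divide_pos_pos)
  moreover have "0 < l" unfolding l_def using sC aB by (intro divide_pos_pos)
  ultimately have l: "0 < l" "l < 1" by auto
  have "l * ((v \<bullet> c - w) / C) + (1 - l) * ((v \<bullet> d - w) / D) = (s * (v \<bullet> c - w) + t * (v \<bullet> d - w)) / (\<alpha> * B)"
    unfolding l1 unfolding l_def using pos by (simp add: add_divide_distrib)
  also have "\<dots> = (v \<bullet> b - w) / B" unfolding V using a0 by simp
  finally show thesis using that l by (simp add: B_def C_def D_def)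
qed

text \<open>If c and d differ, |a - b| is strictly smaller than |c - d|, while |c - d| is at most |a
  - b|.\<close>

lemma mutual_strict_averages:
  fixes a b c d :: real
  assumes "0 < i" "i < 1" "a = i * c + (1 - i) * d" "0 < j" "j < 1" "b = j * c + (1 - j) * d"
    "0 < k" "k < 1" "c = k * a + (1 - k) * b" "0 < l" "l < 1" "d = l * a + (1 - l) * b"
  shows "a = d \<and> b = d \<and> c = d"
proof -
  have 1: "a - b = (i - j) * (c - d)" using assms(3,6) by (simp add: algebra_simps)
  have 2: "c - d = (k - l) * (a - b)" using assms(9,12) by (simp add: algebra_simps)
  have "c = d"
  proof (rule ccontr)
    assume "c \<noteq> d"
    then have "\<bar>i - j\<bar> * \<bar>c - d\<bar> < 1 * \<bar>c - d\<bar>"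
      using assms(1,2,4,5) by (intro mult_strict_right_mono) auto
    then have "\<bar>a - b\<bar> < \<bar>c - d\<bar>" using 1 by (simp add: abs_mult)
    moreover have "\<bar>k - l\<bar> * \<bar>a - b\<bar> \<le> 1 * \<bar>a - b\<bar>"
      using assms(7,8,10,11) by (intro mult_right_mono) auto
    then have "\<bar>c - d\<bar> \<le> \<bar>a - b\<bar>" using 2 by (simp add: abs_mult)
    ultimately show False by simp
  qed
  then show ?thesis using assms(3,6) by (simp add: algebra_simps)
qed

text \<open>The claim amounts to three unordered pairs without an edge, as 30 - 6 = 24. Radon's
  theorem supplies two, and the proof refutes that they are the only ones.\<close>

lemma sum_degree_six:
  fixes X :: "(real^3) set"
  assumes X: "vertex_config X" and c6: "card X = 6"
  shows "(\<Sum>p\<in>X. card {q. exposed_edge X p q}) \<le> 24"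
proof (rule ccontr)
  assume neg: "\<not> (\<Sum>p\<in>X. card {q. exposed_edge X p q}) \<le> 24"
  have fin: "finite X" and sub: "cball 0 1 \<subseteq> convex hull X"
    and vert: "\<And>p. p \<in> X \<Longrightarrow> p \<notin> convex hull (X - {p})" using X by (auto simp: vertex_config_def)
  define NE where "NE = {(p, q). p \<in> X \<and> q \<in> X \<and> p \<noteq> q \<and> \<not> exposed_edge X p q}"
  have few: "card N < 6" if "N \<subseteq> NE" for N
    using sum_degree_le[OF fin that[unfolded NE_def]] c6 neg by simp
  have sym: "(q, p) \<in> NE" if "(p, q) \<in> NE" for p q using that exposed_edge_sym by (auto simp: NE_def)
  obtain a b where ab: "a \<in> X" "b \<in> X" "a \<noteq> b" "\<not> exposed_edge X a b"
    using radon_nonedge[OF X, of X] c6 by auto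
  have c5: "5 \<le> card (X - {x})" for x using c6 fin by (simp add: card_Diff_singleton_if)
  obtain c d where cd: "c \<in> X - {a}" "d \<in> X - {a}" "c \<noteq> d" "\<not> exposed_edge X c d"
    by (rule radon_nonedge[OF X _ c5[of a]]) auto
  have only: "{x, y} = {a, b} \<or> {x, y} = {c, d}" if "x \<in> X" "y \<in> X" "x \<noteq> y" "\<not> exposed_edge X x y" for x y
  proof (rule ccontr)
    assume *: "\<not> ({x, y} = {a, b} \<or> {x, y} = {c, d})"
    let ?N = "{(a, b), (b, a), (c, d), (d, c), (x, y), (y, x)}"
    have "(a, b) \<in> NE" "(c, d) \<in> NE" "(x, y) \<in> NE" using ab cd that by (auto simp: NE_def)
    then have "?N \<subseteq> NE" using sym[of a b] sym[of c d] sym[of x y] by simp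
    moreover have "distinct [(a, b), (b, a), (c, d), (d, c), (x, y), (y, x)]"
      using *[unfolded doubleton_eq_iff] ab(3) cd(1-3) that(3) by auto
    then have "card ?N = 6" using distinct_card by fastforce
    ultimately show False using few[of ?N] by simp
  qed
  \<comment> \<open>If the two pairs shared b, deleting b would leave five points whose Radon
    partition gives a third pair.\<close>
  have bcd: "b \<notin> {c, d}"
  proof
    assume b: "b \<in> {c, d}"
    obtain x y where "x \<in> X - {b}" "y \<in> X - {b}" "x \<noteq> y" "\<not> exposed_edge X x y"
      by (rule radon_nonedge[OF X _ c5[of b]]) auto
    then show False using only[of x y] b by (auto simp: doubleton_eq_iff)
  qed
  have "card (X - {a, b, c, d}) = 2" using ab cd bcd c6 fin by (subst card_Diff_subset) (auto simp: card_insert_if)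
  then obtain e f where ef: "X - {a, b, c, d} = {e, f}" "e \<noteq> f" by (auto simp: card_2_iff)
  have Xeq: "X = {a, b, c, d, e, f}" using ef(1) ab cd by auto
  have dist: "a \<noteq> c" "a \<noteq> d" "b \<noteq> c" "b \<noteq> d" "e \<noteq> a" "e \<noteq> b" "e \<noteq> c" "e \<noteq> d" "f \<noteq> a" "f \<noteq> b" "f \<noteq> c" "f \<noteq> d"
    using ef cd bcd by auto
  \<comment> \<open>After deleting r, the pair given by Radon's theorem is a non-edge avoiding r, so
    it can only be {p, q}; it crosses the triangle of the remaining points.\<close>
  have meet: "convex hull {p, q} \<inter> convex hull (X - {r, p, q}) \<noteq> {}"
    if "{p, q} \<in> {{a, b}, {c, d}}" "r \<in> X" "r \<notin> {p, q}"
      "\<And>x y. {x, y} \<in> {{a, b}, {c, d}} \<Longrightarrow> r \<notin> {x, y} \<Longrightarrow> {x, y} = {p, q}" for p q r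
  proof -
    have "card (X - {r}) = 5" using c6 that fin by simp
    with X _ obtain x y N where xy: "x \<in> X - {r}" "y \<in> X - {r}" "x \<noteq> y" "N \<subseteq> X - {r} - {x, y}"
      "convex hull {x, y} \<inter> convex hull N \<noteq> {}" by (rule radon_pair) auto
    have "N \<subseteq> X - {x, y}" using xy(4) by auto
    then have "\<not> exposed_edge X x y" using exposed_edge_hull_disjoint xy(5) by blast
    then have "{x, y} \<in> {{a, b}, {c, d}}" using only xy by auto
    then have "{x, y} = {p, q}" using that(4) xy(1,2) by auto
    moreover have "N \<subseteq> X - {r, p, q}" using xy(4) calculation by auto
    then have "convex hull N \<subseteq> convex hull (X - {r, p, q})" by (rule hull_mono)
    ultimately show ?thesis using xy(5) by auto
  qed
  have rest: "X - {a, c, d} = {b, e, f}" "X - {b, c, d} = {a, e, f}" "X - {c, a, b} = {d, e, f}" "X - {d, a, b} = {c, e, f}"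
    using Xeq dist ab cd by auto
  have m1: "convex hull {c, d} \<inter> convex hull {b, e, f} \<noteq> {}"
    unfolding rest(1)[symmetric] using dist ab by (intro meet) (auto simp: doubleton_eq_iff)
  have m2: "convex hull {c, d} \<inter> convex hull {a, e, f} \<noteq> {}"
    unfolding rest(2)[symmetric] using dist ab by (intro meet) (auto simp: doubleton_eq_iff)
  have m3: "convex hull {a, b} \<inter> convex hull {d, e, f} \<noteq> {}"
    unfolding rest(3)[symmetric] using dist cd by (intro meet) (auto simp: doubleton_eq_iff)
  have m4: "convex hull {a, b} \<inter> convex hull {c, e, f} \<noteq> {}"
    unfolding rest(4)[symmetric] using dist cd by (intro meet) (auto simp: doubleton_eq_iff)
  have "exposed_edge X e f" using only[of e f] ef dist Xeq by (auto simp: doubleton_eq_iff)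
  then obtain u where u: "u \<bullet> e = u \<bullet> f" "\<And>r. r \<in> X - {e, f} \<Longrightarrow> u \<bullet> r < u \<bullet> e"
    by (auto simp: exposed_edge_def)
  have ul: "u \<bullet> a < u \<bullet> e" "u \<bullet> b < u \<bullet> e" "u \<bullet> c < u \<bullet> e" "u \<bullet> d < u \<bullet> e" using u(2) dist ab cd by auto
  \<comment> \<open>u and v span the plane orthogonal to the edge, so their values are coordinates
    of the projection along it.\<close>
  define v where "v = u \<times> (e - f)"
  have "u \<noteq> 0" using ul by auto
  moreover have "u \<bullet> (e - f) = 0" using u by (simp add: inner_diff_right)
  ultimately have v0: "v \<noteq> 0" using norm_cross[of u "e - f"] ef(2) by (auto simp: v_def)
  have "(e - f) \<bullet> v = 0" "v \<bullet> u = 0" by (simp_all add: v_def dot_cross_self)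
  then have vu: "v \<bullet> u = 0" "v \<bullet> f = v \<bullet> e" by (simp_all add: inner_diff_left inner_diff_right inner_commute)
  \<comment> \<open>The only non-edges are \<open>{a, b}\<close> and \<open>{c, d}\<close>. In the projection along the edge \<open>{e, f}\<close>, the slopes \<open>t\<close>
    of \<open>a\<close> and \<open>b\<close> are strict averages of those of \<open>c\<close> and \<open>d\<close> and conversely, so all four agree
    and the six points lie in a plane.\<close>
  define t where "t x = (v \<bullet> x - v \<bullet> e) / (u \<bullet> e - u \<bullet> x)" for x
  have nin: "x \<notin> convex hull {p, e, f}" if "x \<in> X" "x \<notin> {p, e, f}" "p \<in> X" for x p
  proof -
    have "convex hull {p, e, f} \<subseteq> convex hull (X - {x})" using that Xeq by (intro hull_mono) auto
    then show ?thesis using vert that by blast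
  qed
  have X': "a \<in> X" "b \<in> X" "c \<in> X" "d \<in> X" using ab cd by auto
  obtain i where i: "0 < i" "i < 1" "t a = i * t c + (1 - i) * t d"
    unfolding t_def by (rule hull_pair_triple_ratio[OF m2, of u "u \<bullet> e" v "v \<bullet> e"]) (use nin X' dist u(1) ul vu in auto)
  obtain j where j: "0 < j" "j < 1" "t b = j * t c + (1 - j) * t d"
    unfolding t_def by (rule hull_pair_triple_ratio[OF m1, of u "u \<bullet> e" v "v \<bullet> e"]) (use nin X' dist u(1) ul vu in auto)
  obtain k where k: "0 < k" "k < 1" "t c = k * t a + (1 - k) * t b"
    unfolding t_def by (rule hull_pair_triple_ratio[OF m4, of u "u \<bullet> e" v "v \<bullet> e"]) (use nin X' dist u(1) ul vu in auto)
  obtain l where l: "0 < l" "l < 1" "t d = l * t a + (1 - l) * t b"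
    unfolding t_def by (rule hull_pair_triple_ratio[OF m3, of u "u \<bullet> e" v "v \<bullet> e"]) (use nin X' dist u(1) ul vu in auto)
  have eq: "t a = t d \<and> t b = t d \<and> t c = t d" by (rule mutual_strict_averages[OF i j k l])
  have "v \<bullet> x - v \<bullet> e = t d * (u \<bullet> e - u \<bullet> x)" if "x \<in> X" for x
  proof -
    have "v \<bullet> x - v \<bullet> e = t x * (u \<bullet> e - u \<bullet> x)" if "u \<bullet> x < u \<bullet> e" for x using that by (simp add: t_def)
    then show ?thesis using that Xeq eq ul u(1) vu by auto
  qed
  then have "(v + t d *\<^sub>R u) \<bullet> x = v \<bullet> e + t d * (u \<bullet> e)" if "x \<in> X" for x
    using that by (simp add: inner_add_left algebra_simps)
  then have "v + t d *\<^sub>R u = 0" by (rule ball_not_in_hyperplane[OF sub])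
  then have "v \<bullet> (v + t d *\<^sub>R u) = 0" by simp
  then show False using vu v0 by (simp add: inner_add_right)
qed

section \<open>Polytopes containing the ball\<close>

lemma vertex_config_card:
  fixes X :: "(real^3) set"
  assumes X: "vertex_config X" shows "4 \<le> card X"
proof (rule ccontr)
  assume "\<not> 4 \<le> card X"
  have fin: "finite X" and sub: "cball 0 1 \<subseteq> convex hull X" using X by (auto simp: vertex_config_def)
  have "interior (cball (0::real^3) 1) \<subseteq> interior (convex hull X)" using sub by (rule interior_mono)
  then have "interior (convex hull X) \<noteq> {}" by auto
  moreover have "interior (convex hull X) = {}" using fin \<open>\<not> 4 \<le> card X\<close> by (intro empty_interior_convex_hull) auto
  ultimately show False by simp
qed

lemma vertex_config_norm_sum:
  fixes X :: "(real^3) set"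
  assumes X: "vertex_config X" shows "6 * sqrt 3 \<le> (\<Sum>p\<in>X. norm p)"
proof -
  let ?d = "\<lambda>p. card {q. exposed_edge X p q}" and ?S = "\<Sum>p\<in>X. norm p"
  have fin: "finite X" using X by (simp add: vertex_config_def)
  have sumd: "(\<Sum>p\<in>X. c * real (?d p) + k) = c * real (\<Sum>p\<in>X. ?d p) + k * real (card X)" for c k
    by (simp add: sum.distrib sum_distrib_left)
  consider "card X = 4" | "card X = 5" | "card X = 6" | "card X = 7" | "8 \<le> card X"
    using vertex_config_card[OF X] by linarith
  then show ?thesis
  proof cases
    case 1
    have "4 * pi \<le> 800/461 * ?S + (\<Sum>p\<in>X. 544/1000 * real (?d p) + (- 3061/1000))"
      by (rule config_angle_bound[OF X]) (use 1 in \<open>auto simp: mono_def intro!: order_trans[OF sum_excess_le_5]\<close>)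
    moreover have "(\<Sum>p\<in>X. ?d p) \<le> 12" using sum_degree_le[OF fin, of "{}"] 1 by simp
    then have "real (\<Sum>p\<in>X. ?d p) \<le> 12" by (metis of_nat_le_iff of_nat_numeral)
    ultimately show ?thesis using 1 pi_bounds sqrt3_bounds unfolding sumd by simp
  next
    case 2
    have "4 * pi \<le> 800/461 * ?S + (\<Sum>p\<in>X. 544/1000 * real (?d p) + (- 3061/1000))"
      by (rule config_angle_bound[OF X]) (use 2 in \<open>auto simp: mono_def intro!: order_trans[OF sum_excess_le_5]\<close>)
    moreover obtain a b where ab: "a \<in> X" "b \<in> X" "a \<noteq> b" "\<not> exposed_edge X a b"
      using radon_nonedge[OF X, of X] 2 by auto
    have "(\<Sum>p\<in>X. ?d p) + card {(a, b), (b, a)} \<le> 20"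
      using sum_degree_le[OF fin, of "{(a, b), (b, a)}"] ab exposed_edge_sym 2 by auto
    then have "(\<Sum>p\<in>X. ?d p) \<le> 18" using ab by simp
    then have "real (\<Sum>p\<in>X. ?d p) \<le> 18" by (metis of_nat_le_iff of_nat_numeral)
    ultimately show ?thesis using 2 pi_bounds sqrt3_bounds unfolding sumd by simp
  next
    case 3
    have "4 * pi \<le> 2 * ?S + (\<Sum>p\<in>X. 4/10 * real (?d p) + (2 * pi / 3 - 2 * sqrt 3 - 16/10))"
      by (rule config_angle_bound[OF X]) (use 3 in \<open>auto simp: mono_def intro!: order_trans[OF sum_excess_le_6]\<close>)
    moreover have "real (\<Sum>p\<in>X. ?d p) \<le> 24" using sum_degree_six[OF X 3] by (metis of_nat_le_iff of_nat_numeral)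
    ultimately show ?thesis using 3 unfolding sumd by simp
  next
    case 4
    have "4 * pi \<le> 265/100 * ?S + (\<Sum>p\<in>X. 9/100 * real (?d p) + (- 261/100))"
      by (rule config_angle_bound[OF X]) (use 4 in \<open>auto simp: mono_def intro!: order_trans[OF sum_excess_le_7]\<close>)
    moreover have "(\<Sum>p\<in>X. ?d p) \<le> 36"
    proof -
      obtain a b where ab: "a \<in> X" "b \<in> X" "a \<noteq> b" "\<not> exposed_edge X a b"
        using radon_nonedge[OF X, of X] 4 by auto
      \<comment> \<open>Deleting a and then c leaves enough points for Radon's theorem and makes the
        three pairs distinct: the second avoids a, the third avoids a and c.\<close>
      have "5 \<le> card (X - {a})" using 4 fin ab by simp
      then obtain c d where cd: "c \<in> X - {a}" "d \<in> X - {a}" "c \<noteq> d" "\<not> exposed_edge X c d"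
        using radon_nonedge[OF X, of "X - {a}"] by auto
      have "card (X - {a, c}) = 5" using 4 fin ab cd by (subst card_Diff_subset) auto
      then obtain e f where ef: "e \<in> X - {a, c}" "f \<in> X - {a, c}" "e \<noteq> f" "\<not> exposed_edge X e f"
        using radon_nonedge[OF X, of "X - {a, c}"] by auto
      let ?N = "{(a, b), (b, a), (c, d), (d, c), (e, f), (f, e)}"
      have "card ?N = 6" using ab cd ef by (auto simp: card_insert_if)
      moreover have "(\<Sum>p\<in>X. ?d p) + card ?N \<le> 42"
        using sum_degree_le[OF fin, of ?N] ab cd ef exposed_edge_sym 4 by auto
      ultimately show ?thesis by simp
    qed
    then have "real (\<Sum>p\<in>X. ?d p) \<le> 36" by (metis of_nat_le_iff of_nat_numeral)
    ultimately show ?thesis using 4 pi_bounds sqrt3_bounds unfolding sumd by simp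
  next
    \<comment> \<open>With n points the sum is at least 8 (4 + n) / 9, which is 32/3 > 6 sqrt 3 for
      n = 8, but too small for n = 7.\<close>
    case 5
    have "4 * pi \<le> 9 * pi / 8 * ?S + (\<Sum>p\<in>X. - pi)"
      by (rule config_angle_bound[OF X]) (auto simp: mono_def intro!: order_trans[OF sum_excess_le_general])
    then have "pi * (4 + card X) \<le> pi * (9 / 8 * ?S)" by (simp add: algebra_simps)
    then have "4 + card X \<le> 9 / 8 * ?S" by simp
    then show ?thesis using 5 sqrt3_bounds by simp
  qed
qed

lemma sum_set_le_sum_list:
  assumes "\<And>x. x \<in> set xs \<Longrightarrow> 0 \<le> (f x :: real)"
  shows "sum f (set xs) \<le> (\<Sum>x\<leftarrow>xs. f x)"
  using assms
proof (induction xs)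
  case (Cons x xs)
  then show ?case by (cases "x \<in> set xs") (auto simp: insert_absorb add_increasing)
qed simp

text \<open>A subset of least cardinality whose hull still contains the ball: a point in the hull of
  the others could be dropped.\<close>

lemma vertex_config_subset:
  assumes "finite Y" "cball 0 1 \<subseteq> convex hull Y"
  obtains X where "X \<subseteq> Y" "vertex_config X"
proof -
  let ?P = "\<lambda>X. X \<subseteq> Y \<and> cball 0 1 \<subseteq> convex hull X"
  obtain X where X: "?P X" "\<And>Z. ?P Z \<Longrightarrow> card X \<le> card Z"
    using assms exists_least_iff[of "\<lambda>n. \<exists>X. ?P X \<and> card X = n"] by (metis not_less order_refl)
  have fX: "finite X" using X(1) assms(1) finite_subset by blast
  have "p \<notin> convex hull (X - {p})" if "p \<in> X" for p
  proof
    assume "p \<in> convex hull (X - {p})"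
    then have "convex hull (insert p (X - {p})) = convex hull (X - {p})" by (rule hull_redundant)
    then have "?P (X - {p})" using X(1) that by (auto simp: insert_absorb)
    then have "card X \<le> card (X - {p})" by (rule X(2))
    then show False using card_Diff1_less[OF fX that] by simp
  qed
  then show thesis using that[of X] X(1) fX by (simp add: vertex_config_def)
qed

lemma ball3_norm_sum:
  fixes ps :: "(real^3) list"
  assumes "cball 0 1 \<subseteq> convex hull (set ps)"
  shows "6 * sqrt 3 \<le> (\<Sum>p\<leftarrow>ps. norm p)"
proof -
  obtain X where X: "X \<subseteq> set ps" "vertex_config X" using vertex_config_subset[OF _ assms] by auto
  have "6 * sqrt 3 \<le> sum norm X" using vertex_config_norm_sum[OF X(2)] .
  also have "\<dots> \<le> sum norm (set ps)" using X(1) by (intro sum_mono2) auto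
  also have "\<dots> \<le> (\<Sum>p\<leftarrow>ps. norm p)" by (rule sum_set_le_sum_list) simp
  finally show ?thesis .
qed

text \<open>The circular cone lies in the wedge of half angle arccos (1 / norm p) about p. The lemma
  serves the plane, where the two agree up to a null set.\<close>

lemma ball_frac_cap_le:
  fixes p :: "real^'n::{finite,wellorder}"
  assumes p: "1 \<le> norm p" and n: "CARD('n) \<ge> 2"
  shows "ball_frac {x. norm x \<le> p \<bullet> x} \<le> arccos (1 / norm p) / pi"
proof -
  define r b where "r = norm p" and "b = arccos (1 / norm p)"
  have r: "1 \<le> r" using p by (simp add: r_def)
  have p0: "p \<noteq> 0" "r \<noteq> 0" using p r by auto
  have b01: "0 \<le> 1 / r" "1 / r \<le> 1" "-1 \<le> 1 / r" using r by (auto intro: order_trans[of _ 0])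
  have b: "0 \<le> b" "b \<le> pi/2" "cos b = 1 / r"
    using b01 arccos_lbound[of "1 / r"] arccos_le_pi2[of "1 / r"] by (auto simp: b_def r_def cos_arccos)
  have sb: "0 \<le> sin b" using b by (intro sin_ge_zero) auto
  have sb2: "(sin b)\<^sup>2 = 1 - (1 / r)\<^sup>2" using b(3) sin_squared_eq[of b] by simp
  obtain q' where q': "q' \<noteq> 0" "orthogonal p q'" using orthogonal_to_vector_exists[of p] n by auto
  define e q where "e = p /\<^sub>R r" and "q = q' /\<^sub>R norm q'"
  have eq: "norm e = 1" "norm q = 1" "e \<bullet> q = 0" using p0 q' by (auto simp: e_def q_def r_def orthogonal_def)
  then have ee: "e \<bullet> e = 1" "q \<bullet> q = 1" "q \<bullet> e = 0" by (auto simp: norm_eq_1 inner_commute)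
  let ?N1 = "sin b *\<^sub>R e + cos b *\<^sub>R q" and ?N2 = "sin b *\<^sub>R e - cos b *\<^sub>R q"
  have "?N1 \<bullet> ?N1 = (sin b)\<^sup>2 + (cos b)\<^sup>2" "?N2 \<bullet> ?N2 = (sin b)\<^sup>2 + (cos b)\<^sup>2"
    by (auto simp: inner_simps ee eq power2_eq_square)
  then have nN: "norm ?N1 = 1" "norm ?N2 = 1" by (simp_all add: norm_eq_1)
  have ip: "?N1 \<bullet> ?N2 = - cos (2 * b)" by (auto simp: inner_simps ee eq cos_double power2_eq_square)
  have "{x. norm x \<le> p \<bullet> x} \<subseteq> wedge ?N1 ?N2"
  proof
    fix x assume "x \<in> {x. norm x \<le> p \<bullet> x}"
    then have x: "norm x \<le> r * (e \<bullet> x)" using p0 by (simp add: e_def field_simps)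
    define z s where "z = e \<bullet> x" and "s = q \<bullet> x"
    have "0 \<le> r * z" using x norm_ge_zero[of x] unfolding z_def by linarith
    then have z0: "0 \<le> z" using r by (simp add: zero_le_mult_iff)
    have "0 \<le> (x - z *\<^sub>R e - s *\<^sub>R q) \<bullet> (x - z *\<^sub>R e - s *\<^sub>R q)" by simp
    also have "\<dots> = x \<bullet> x - z\<^sup>2 - s\<^sup>2"
      by (simp add: inner_simps ee eq z_def s_def inner_commute power2_eq_square)
    finally have "z\<^sup>2 + s\<^sup>2 \<le> (norm x)\<^sup>2" by (simp add: power2_norm_eq_inner)
    also have "\<dots> \<le> (r * z)\<^sup>2" using x by (intro power_mono) (auto simp: z_def)
    finally have "s\<^sup>2 \<le> (r\<^sup>2 - 1) * z\<^sup>2" by (simp add: power_mult_distrib algebra_simps)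
    then have "s\<^sup>2 / r\<^sup>2 \<le> (r\<^sup>2 - 1) * z\<^sup>2 / r\<^sup>2" by (intro divide_right_mono) auto
    also have "\<dots> = (sin b * z)\<^sup>2" using r by (simp add: power_mult_distrib sb2 power_divide field_simps)
    finally have "(cos b * s)\<^sup>2 \<le> (sin b * z)\<^sup>2" by (simp add: b power_divide)
    then have "\<bar>cos b * s\<bar> \<le> sin b * z" using sb z0 by (metis abs_le_square_iff abs_of_nonneg mult_nonneg_nonneg)
    then show "x \<in> wedge ?N1 ?N2" by (auto simp: wedge_def inner_simps z_def s_def)
  qed
  moreover have "closed {x. norm x \<le> p \<bullet> x}" by (intro closed_Collect_le continuous_intros)
  ultimately have "ball_frac {x. norm x \<le> p \<bullet> x} \<le> ball_frac (wedge ?N1 ?N2)"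
    by (intro ball_frac_mono closed_wedge)
  also have "\<dots> = (pi - arccos (- cos (2 * b))) / (2 * pi)" using nN n by (simp add: ball_frac_wedge ip)
  also have "arccos (- cos (2 * b)) = pi - 2 * b" using b by (simp add: arccos_minus arccos_cos)
  finally show ?thesis by (simp add: b_def)
qed

lemma sec_tangent:
  assumes "x \<in> {-(pi/2)<..<pi/2}" "c \<in> {-(pi/2)<..<pi/2}"
  shows "1 / cos c + sin c / (cos c)\<^sup>2 * (x - c) \<le> 1 / cos x"
proof (rule has_derivative_tangent_le[where a="-(pi/2)" and b="pi/2" and f="\<lambda>x. 1 / cos x" and f'="\<lambda>x. sin x / (cos x)\<^sup>2"])
  fix x :: real assume "x \<in> {-(pi/2)<..<pi/2}"
  then have "cos x > 0" by (intro cos_gt_zero_pi) auto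
  then show "((\<lambda>x. 1 / cos x) has_real_derivative sin x / (cos x)\<^sup>2) (at x)"
    by (auto intro!: derivative_eq_intros simp: power2_eq_square)
next
  fix x y :: real assume xy: "x \<in> {-(pi/2)<..<pi/2}" "y \<in> {-(pi/2)<..<pi/2}" "x \<le> y"
  have c: "cos x > 0" "cos y > 0" using xy by (auto intro!: cos_gt_zero_pi)
  have st: "sin x \<le> sin y" using xy by (intro sin_monotone_2pi_le) auto
  have "\<bar>sin x * sin y\<bar> \<le> 1 * 1" unfolding abs_mult by (intro mult_mono) (auto simp: abs_sin_le_one)
  then have "0 \<le> (sin y - sin x) * (1 + sin x * sin y)" using st by (intro mult_nonneg_nonneg) auto
  also have "\<dots> = sin y * (cos x)\<^sup>2 - sin x * (cos y)\<^sup>2"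
    unfolding cos_squared_eq by (simp add: power2_eq_square algebra_simps)
  finally have "sin x * (cos y)\<^sup>2 \<le> sin y * (cos x)\<^sup>2" by simp
  then show "sin x / (cos x)\<^sup>2 \<le> sin y / (cos y)\<^sup>2" using c by (simp add: field_simps)
qed (use assms in auto)

lemma ball2_norm_sum:
  fixes ps :: "(real^2) list"
  assumes sub: "cball 0 1 \<subseteq> convex hull (set ps)"
  shows "4 * sqrt 2 \<le> (\<Sum>p\<leftarrow>ps. norm p)"
proof -
  \<comment> \<open>Points in the open unit disc satisfy \<open>norm x \<le> p \<bullet> x\<close>
    only for x = 0, so the remaining ones already cover the plane.\<close>
  define Y where "Y = {p \<in> set ps. 1 \<le> norm p}"
  define b where "b p = arccos (1 / norm p)" for p :: "real^2"
  let ?cap = "\<lambda>p::real^2. {x. norm x \<le> p \<bullet> x}"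
  have fY: "finite Y" by (simp add: Y_def)
  have ex: "\<exists>p\<in>Y. norm x \<le> p \<bullet> x" if x: "x \<noteq> 0" for x
  proof -
    have "\<exists>p\<in>set ps. norm x \<le> p \<bullet> x"
    proof (rule ccontr)
      assume "\<not> ?thesis"
      then have lt: "\<And>p. p \<in> set ps \<Longrightarrow> p \<bullet> x < norm x" by force
      have "x /\<^sub>R norm x \<in> convex hull (set ps)" using x by (intro subsetD[OF sub]) auto
      moreover have "convex hull (set ps) \<subseteq> {y. x \<bullet> y < norm x}"
        by (intro hull_minimal convex_halfspace_lt) (use lt in \<open>auto simp: inner_commute\<close>)
      ultimately have "x \<bullet> (x /\<^sub>R norm x) < norm x" by auto
      then show False using x by (simp add: power2_norm_eq_inner[symmetric] power2_eq_square)
    qed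
    then obtain p where p: "p \<in> set ps" "norm x \<le> p \<bullet> x" by blast
    then have "norm x \<le> norm p * norm x" using norm_cauchy_schwarz[of p x] by linarith
    then have "1 \<le> norm p" using x by simp
    then show ?thesis using p by (auto simp: Y_def)
  qed
  have "axis 1 1 \<noteq> (0::real^2)" by (simp add: axis_eq_0_iff)
  then have neY: "Y \<noteq> {}" using ex by blast
  have "\<exists>p\<in>Y. norm x \<le> p \<bullet> x" for x using ex[of x] neY by (cases "x = 0") auto
  then have "(\<Union>p\<in>Y. ?cap p) = UNIV" by auto
  moreover have "closed (?cap p)" for p by (intro closed_Collect_le continuous_intros)
  ultimately have "1 \<le> (\<Sum>p\<in>Y. ball_frac (?cap p))"
    using ball_frac_UN_le[OF fY, of ?cap] ball_frac_UNIV[where ?'n = 2] by simp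
  also have "\<dots> \<le> (\<Sum>p\<in>Y. b p / pi)"
    unfolding b_def by (intro sum_mono ball_frac_cap_le) (auto simp: Y_def)
  also have "\<dots> = (\<Sum>p\<in>Y. b p) / pi" by (simp add: sum_divide_distrib)
  finally have sumb: "pi \<le> (\<Sum>p\<in>Y. b p)" by (simp add: field_simps)
  have b: "0 \<le> b p \<and> b p < pi/2 \<and> norm p = 1 / cos (b p)" if "p \<in> Y" for p
  proof -
    have p: "1 \<le> norm p" using that by (simp add: Y_def)
    then have "0 < norm p" by linarith
    then have "0 < 1 / norm p" "1 / norm p \<le> 1" using p by (simp_all add: divide_le_eq)
    moreover have "-1 \<le> 1 / norm p" using \<open>0 < 1 / norm p\<close> by linarith
    ultimately have "-1 \<le> 1 / norm p" "1 / norm p \<le> 1" "arccos (1 / norm p) < arccos 0"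
      by (auto intro: arccos_less_arccos simp del: arccos_0)
    then have "0 \<le> b p" "b p < pi / 2" "cos (b p) = 1 / norm p"
      unfolding b_def by (auto intro: arccos_lbound cos_arccos)
    then show ?thesis by simp
  qed
  have tangent: "1 / cos c * card Y + sin c / (cos c)\<^sup>2 * (pi - c * card Y) \<le> (\<Sum>p\<in>Y. norm p)"
    if c: "0 \<le> c" "c < pi/2" for c
  proof -
    have "sin c / (cos c)\<^sup>2 \<ge> 0" using c by (intro divide_nonneg_nonneg sin_ge_zero) auto
    then have "1 / cos c * card Y + sin c / (cos c)\<^sup>2 * (pi - c * card Y)
        \<le> 1 / cos c * card Y + sin c / (cos c)\<^sup>2 * ((\<Sum>p\<in>Y. b p) - c * card Y)"
      using sumb by (intro add_left_mono mult_left_mono) auto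
    also have "\<dots> = (\<Sum>p\<in>Y. 1 / cos c + sin c / (cos c)\<^sup>2 * (b p - c))"
    proof -
      have "k * card Y + s * ((\<Sum>p\<in>Y. b p) - c * card Y) = (\<Sum>p\<in>Y. k + s * (b p - c))" for k s :: real
        by (simp add: sum.distrib sum_distrib_left[symmetric] sum_subtractf mult.commute)
      then show ?thesis .
    qed
    also have "\<dots> \<le> (\<Sum>p\<in>Y. norm p)"
    proof (rule sum_mono)
      fix p assume p: "p \<in> Y"
      show "1 / cos c + sin c / (cos c)\<^sup>2 * (b p - c) \<le> norm p"
        using sec_tangent[of "b p" c] b[OF p] c by auto
    qed
    finally show ?thesis .
  qed
  have "(\<Sum>p\<in>Y. b p) < (\<Sum>p\<in>Y. pi/2)" using b fY neY by (intro sum_strict_mono) auto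
  then have "(\<Sum>p\<in>Y. b p) < card Y * (pi/2)" by simp
  then have "2 * pi < card Y * pi" using sumb by linarith
  then have "3 \<le> card Y" by simp
  have "4 * sqrt 2 \<le> (\<Sum>p\<in>Y. norm p)"
  proof (cases "card Y = 3")
    case True
    \<comment> \<open>Three points are treated apart: the tangent at pi/4 would give less than 4
      sqrt 2, the one at pi/3 gives 6.\<close>
    have "4 * sqrt 2 \<le> 6" by (rule power2_le_imp_le) (auto simp: power_mult_distrib)
    also have "\<dots> \<le> (\<Sum>p\<in>Y. norm p)" using tangent[of "pi/3"] True by (simp add: cos_60)
    finally show ?thesis .
  next
    case False
    then have c4: "4 \<le> real (card Y)" using \<open>3 \<le> card Y\<close> by simp
    \<comment> \<open>The tangent at pi/4, the half angle for the square, gives a bound that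
      increases with the number of points and equals 4 sqrt 2 for four.\<close>
    have "1 / cos (pi/4) = sqrt 2" "sin (pi/4) / (cos (pi/4))\<^sup>2 = sqrt 2"
      by (simp_all add: cos_45 sin_45 power_divide real_div_sqrt)
    then have "sqrt 2 * card Y + sqrt 2 * (pi - pi/4 * card Y) \<le> (\<Sum>p\<in>Y. norm p)" using tangent[of "pi/4"] by simp
    moreover have "sqrt 2 * card Y + sqrt 2 * (pi - pi/4 * card Y) = sqrt 2 * ((1 - pi/4) * card Y + pi)"
      by (simp add: algebra_simps)
    moreover have "(1 - pi/4) * 4 \<le> (1 - pi/4) * card Y" using c4 pi_less_4 by (intro mult_left_mono) auto
    then have "sqrt 2 * 4 \<le> sqrt 2 * ((1 - pi/4) * card Y + pi)" by (intro mult_left_mono) auto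
    ultimately show ?thesis by linarith
  qed
  also have "\<dots> \<le> sum norm (set ps)" by (intro sum_mono2) (auto simp: Y_def)
  also have "\<dots> \<le> (\<Sum>p\<leftarrow>ps. norm p)" by (rule sum_set_le_sum_list) simp
  finally show ?thesis .
qed

theorem theorem4p1:
  shows "vein (cball 0 1 :: (real ^ 2) set) = 4 * sqrt 2
    \<and> vein (cball 0 1 :: (real ^ 3) set) = 6 * sqrt 3
    \<and> (\<forall>(K :: (real ^ 2) set) (L :: (real ^ 3) set).
         symmetric_convex_body K \<longrightarrow> symmetric_convex_body L \<longrightarrow>
         4 \<le> vein K \<and> vein K \<le> 6 \<and> 6 \<le> vein L \<and> vein L \<le> 18)"
proof (intro conjI allI impI)
  obtain ps where ps: "(cball 0 1 :: (real^2) set) \<subseteq> convex hull (set ps)"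
    using bounded_subset_hull[OF bounded_cball] by blast
  have "4 * sqrt 2 \<le> vein (cball 0 1 :: (real^2) set)"
    by (rule vein_ge[OF ps]) (simp add: body_norm_cball ball2_norm_sum)
  then show "vein (cball 0 1 :: (real^2) set) = 4 * sqrt 2"
    using vein_ball_le[where 'n=2] by simp
  obtain qs where qs: "(cball 0 1 :: (real^3) set) \<subseteq> convex hull (set qs)"
    using bounded_subset_hull[OF bounded_cball] by blast
  have "6 * sqrt 3 \<le> vein (cball 0 1 :: (real^3) set)"
    by (rule vein_ge[OF qs]) (simp add: body_norm_cball ball3_norm_sum)
  then show "vein (cball 0 1 :: (real^3) set) = 6 * sqrt 3"
    using vein_ball_le[where 'n=3] by simp
next
  fix K :: "(real^2) set" and L :: "(real^3) set"
  assume K: "symmetric_convex_body K" and L: "symmetric_convex_body L"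
  show "4 \<le> vein K" using vein_ge_ball[OF K ball2_norm_sum] by simp
  show "6 \<le> vein L" using vein_ge_ball[OF L ball3_norm_sum] by simp
  show "vein K \<le> 6" using K by (rule vein_le_six)
  show "vein L \<le> 18" using vein_le_general[OF L] by simp
qed

end
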